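(* Let $0<p_0<q_0\le\infty$ and let $\mathcal{F}$ be a family of ordered pairs $(f,g)$ of non-negative measurable functions on $\mathbb{R}^n$. Suppose that there exists $p$ with $p_0\le p\le q_0$, and $p<\infty$ if $q_0=\infty$, such that for $(f,g)\in\mathcal{F}$, $$\|f\|_{L^p(w)}\le C\|g\|_{L^p(w)},\qquad\text{for all }w\in A_{p/p_0}\cap RH_{(q_0/p)'}.$$ Then, for all $p_0<q<q_0$ and $(f,g)\in\mathcal{F}$, $$\|f\|_{L^q(w)}\le C\|g\|_{L^q(w)},\qquad\text{for all }w\in A_{q/p_0}\cap RH_{(q_0/q)'}.$$ Moreover, for all $p_0<q,r<q_0$ and $\{(f_j,g_j)\}_j\subset\mathcal{F}$, $$\Big\|\Big(\sum_jf_j^r\Big)^{1/r}\Big\|_{L^q(w)}\le C\,\Big\|\Big(\sum_jg_j^r\Big)^{1/r}\Big\|_{L^q(w)},\qquad\text{for all }w\in A_{q/p_0}\cap RH_{(q_0/q)'}.$$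
   Context: Convention: every inequality of the form $\|f\|_{L^p(w)}\le C\|g\|_{L^p(w)}$, $(f,g)\in\mathcal{F}$, means that it holds for all $(f,g)\in\mathcal{F}$ for which the left-hand side is finite, with a constant $C$ independent of the pair (the constant may depend on the weight); the same convention applies to the vector-valued inequality, with $C$ independent of the sequence $\{(f_j,g_j)\}_j$. The setting is $\mathbb{R}^n$ with Lebesgue measure. A weight $w$ is a non-negative locally integrable function, $L^p(w)=L^p(w\,dx)$. For $1<t<\infty$: $w\in A_t$ if $\big(\frac1{|B|}\int_Bw\big)\big(\frac1{|B|}\int_Bw^{1-t'}\big)^{t-1}\le C$ for all balls $B$; $w\in A_1$ if $\frac1{|B|}\int_Bw\le Cw(x)$ for a.e. $x\in B$, all $B$. For $1<t<\infty$: $w\in RH_t$ if $\big(\frac1{|B|}\int_Bw^t\big)^{1/t}\le C\frac1{|B|}\int_Bw$ for all balls $B$; $w\in RH_\infty$ if $w(x)\le C\frac1{|B|}\int_Bw$ for a.e. $x\in B$, all $B$; $RH_1$ is the class of all weights. Primes denote conjugate exponents: $(q_0/p)'=\infty$ if $p=q_0$, and $(q_0/p)'=1$ if $q_0=\infty$. *)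

theory Defs
  imports "HOL-Analysis.Analysis"
begin

text \<open>Real powers on \<open>[0,\<infinity>]\<close>, extending \<open>powr\<close> with the conventions of measure theory.
  In contrast to \<open>powr\<close> on the reals, negative powers of \<open>0\<close> are \<open>\<infinity>\<close>; this matters
  for the dual weight in the Muckenhoupt condition.\<close>

definition epow :: "ennreal \<Rightarrow> real \<Rightarrow> ennreal" where
  "epow x a =
     (if a = 0 then 1
      else if x = 0 then (if a < 0 then \<infinity> else 0)
      else if x = \<infinity> then (if a < 0 then 0 else \<infinity>)
      else ennreal (enn2real x powr a))"

text \<open>The conjugate exponent \<open>s'\<close>, given by \<open>1/s + 1/s' = 1\<close>; in particular
  \<open>1' = \<infinity>\<close> and \<open>\<infinity>' = 1\<close>.\<close>

definition conj_exponent :: "ennreal \<Rightarrow> ennreal" where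
  "conj_exponent s = inverse (1 - inverse s)"

definition weight :: "(real ^ 'n \<Rightarrow> real) \<Rightarrow> bool" where
  "weight w \<longleftrightarrow> (\<forall>x. 0 \<le> w x) \<and> (\<forall>K. compact K \<longrightarrow> w absolutely_integrable_on K)"

definition average :: "(real ^ 'n) set \<Rightarrow> (real ^ 'n \<Rightarrow> ennreal) \<Rightarrow> ennreal" where
  "average B u = (\<integral>\<^sup>+x\<in>B. u x \<partial>lebesgue) / emeasure lebesgue B"

text \<open>The Muckenhoupt class \<open>A\<^sub>t\<close>, meant for \<open>1 \<le> t < \<infinity>\<close>. For \<open>t > 1\<close> the exponent
  \<open>1 - t'\<close> is written out as \<open>1 - t/(t-1)\<close>.\<close>

definition A_class :: "real \<Rightarrow> (real ^ 'n \<Rightarrow> real) set" where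
  "A_class t = {w. weight w \<and>
     (if t = 1
      then \<exists>C::real. \<forall>c r. 0 < r \<longrightarrow>
             (AE x in lebesgue. x \<in> ball c r \<longrightarrow>
                average (ball c r) (\<lambda>y. ennreal (w y)) \<le> ennreal C * ennreal (w x))
      else \<exists>C::real. \<forall>c r. 0 < r \<longrightarrow>
             average (ball c r) (\<lambda>y. ennreal (w y)) *
             epow (average (ball c r) (\<lambda>y. epow (ennreal (w y)) (1 - t / (t - 1)))) (t - 1)
               \<le> ennreal C)}"

text \<open>The reverse Hoelder class \<open>RH\<^sub>s\<close>, meant for \<open>1 \<le> s \<le> \<infinity>\<close>.\<close>

definition RH_class :: "ennreal \<Rightarrow> (real ^ 'n \<Rightarrow> real) set" where
  "RH_class s = {w. weight w \<and>
     (if s = 1 then True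
      else if s = \<infinity>
      then \<exists>C::real. \<forall>c r. 0 < r \<longrightarrow>
             (AE x in lebesgue. x \<in> ball c r \<longrightarrow>
                ennreal (w x) \<le> ennreal C * average (ball c r) (\<lambda>y. ennreal (w y)))
      else \<exists>C::real. \<forall>c r. 0 < r \<longrightarrow>
             epow (average (ball c r) (\<lambda>y. epow (ennreal (w y)) (enn2real s))) (1 / enn2real s)
               \<le> ennreal C * average (ball c r) (\<lambda>y. ennreal (w y)))}"

text \<open>The (quasi-)norm of \<open>L\<^sup>p(w) = L\<^sup>p(w dx)\<close> for \<open>0 < p < \<infinity>\<close> and a non-negative function.\<close>

definition Lp_norm :: "real \<Rightarrow> (real ^ 'n \<Rightarrow> real) \<Rightarrow> (real ^ 'n \<Rightarrow> ennreal) \<Rightarrow> ennreal" where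
  "Lp_norm p w f =
     epow (\<integral>\<^sup>+x. epow (f x) p \<partial>density lebesgue (\<lambda>x. ennreal (w x))) (1 / p)"

text \<open>The inequality \<open>\<parallel>f\<parallel> \<le> C \<parallel>g\<parallel>\<close> in \<open>L\<^sup>p(w)\<close> for all pairs of \<open>\<F>\<close> whose left-hand side
  is finite, with one constant for the whole family.\<close>

definition Lp_bound ::
  "real \<Rightarrow> (real ^ 'n \<Rightarrow> real) \<Rightarrow>
   ((real ^ 'n \<Rightarrow> ennreal) \<times> (real ^ 'n \<Rightarrow> ennreal)) set \<Rightarrow> bool" where
  "Lp_bound p w \<F> \<longleftrightarrow>
     (\<exists>C::real. 0 < C \<and>
        (\<forall>(f, g)\<in>\<F>. Lp_norm p w f < \<infinity> \<longrightarrow> Lp_norm p w f \<le> ennreal C * Lp_norm p w g))"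

text \<open>\<open>(\<Sum>\<^sub>j f\<^sub>j\<^sup>r)\<^sup>1\<^sup>/\<^sup>r\<close> over a finite or countable index set.\<close>

definition lr_sum ::
  "real \<Rightarrow> nat set \<Rightarrow> (nat \<Rightarrow> real ^ 'n \<Rightarrow> ennreal) \<Rightarrow> real ^ 'n \<Rightarrow> ennreal" where
  "lr_sum r J f x = epow (\<Sum>\<^sub>\<infinity>j\<in>J. epow (f j x) r) (1 / r)"

end

theory Submission
  imports Defs
begin

text \<open>
  The hypothesis provides a constant for every weight separately, with no control of that constant
  by the characteristics of the weight, so one argues by a gliding hump. If the inequality fails
  at \<open>q\<close> for \<open>w\<close>, there are pairs \<open>(f k, g k)\<close> that violate it with constants growing
  exponentially in \<open>k\<close>, and it is enough to find a single weight \<open>W\<close>, admissible at the exponent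
  \<open>p\<close>, that sees all of them.

  Put \<open>a = 1/p0\<close>, \<open>b = 1/q0\<close>. Then \<open>om = w powr (1/(1 - q b))\<close> is a Muckenhoupt weight of class
  \<open>tau = q (a - b)/(1 - q b)\<close>, with \<open>w = om powr (1 - q b)\<close>. Let \<open>h\<close> be the normalized sum of all
  \<open>f k powr q\<close> and \<open>g k powr q\<close>. The Rubio de Francia algorithm on the two sides of the duality
  between \<open>om\<close> and \<open>om powr (1 - tau')\<close> gives \<open>A\<^sub>1\<close> weights \<open>v\<close> and \<open>u\<close> such that
  \<open>V = v powr tau * om\<close> and \<open>U = u powr tau' * om powr (1 - tau')\<close> are integrable and dominate
  \<open>h * w\<close>. The weight \<open>W = u powr (1 - p b) * v powr (1 - p a)\<close> is admissible at \<open>p\<close>, and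
  \<open>\<phi> powr p * W = X powr (p/q) * V powr -\<theta> * U powr m\<close> for \<open>X = \<phi> powr q * w\<close>, where
  \<open>p/q + m = 1 + \<theta>\<close>. Young's inequality bounds this from above by \<open>V + U\<close> if \<open>X \<le> V\<close>, and from
  below by a multiple of \<open>X\<close> minus a multiple of \<open>V\<close> if \<open>X \<le> U\<close>, which contradicts the hypothesis
  for \<open>W\<close>.

  The Rubio de Francia algorithm needs Muckenhoupt's theorem on the maximal operator, which
  Lerner's pointwise inequality reduces to maximal operators of doubling measures, hence to
  Vitali's covering lemma. For the vector-valued inequality, the scalar one at the exponent \<open>r\<close>,
  summed over \<open>j\<close>, is the hypothesis with \<open>p = r\<close> for the family of \<open>\<ell>\<^sup>r\<close> sums.
\<close>

section \<open>Maximal operators of doubling measures\<close>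

lemma epow_ennreal: "0 < y \<or> (0 \<le> y \<and> 0 < a) \<Longrightarrow> epow (ennreal y) a = ennreal (y powr a)"
  by (auto simp: epow_def)

lemma epow_0 [simp]: "0 < a \<Longrightarrow> epow 0 a = 0"
  by (simp add: epow_def)

lemma epow_top [simp]: "0 < a \<Longrightarrow> epow top a = top"
  by (simp add: epow_def)

lemma epow_exponent_0 [simp]: "epow x 0 = 1"
  by (simp add: epow_def)

lemma epow_exponent_1 [simp]: "epow x 1 = x"
  by (cases x) (auto simp: epow_def top_ennreal.rep_eq)

lemma ennreal_trichotomy:
  obtains (zero) "x = (0::ennreal)" | (top) "x = top" | (pos) y where "0 < y" "x = ennreal y"
  by (cases x) (auto simp: less_le)

lemma epow_mono: "x \<le> y \<Longrightarrow> 0 \<le> a \<Longrightarrow> epow x a \<le> epow y a"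
  by (cases x rule: ennreal_trichotomy; cases y rule: ennreal_trichotomy)
    (auto simp: epow_def top_unique intro!: ennreal_leI powr_mono2)

text \<open>Nonnegative exponents only: for a negative one the product of \<open>0\<close> and
  \<open>top\<close> has power \<open>top\<close>, whereas the product of the two powers is
  \<open>0\<close>.\<close>

lemma epow_mult: "0 \<le> a \<Longrightarrow> epow (x * y) a = epow x a * epow y a"
  by (cases x rule: ennreal_trichotomy; cases y rule: ennreal_trichotomy)
    (auto simp: epow_def ennreal_mult'[symmetric] powr_mult ennreal_mult_eq_top_iff ennreal_mult_top ennreal_top_mult)

lemma epow_epow: "epow (epow x a) b = epow x (a * b)"
  by (cases x rule: ennreal_trichotomy)
    (auto simp: epow_def powr_powr mult_less_0_iff zero_less_mult_iff ennreal_eq_zero_iff)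

lemma epow_le_iff: "0 < a \<Longrightarrow> epow x a \<le> y \<longleftrightarrow> x \<le> epow y (1 / a)"
  using epow_mono[of x "epow y (1 / a)" a] epow_mono[of "epow x a" y "1 / a"]
  by (auto simp: epow_epow)

lemma epow_eq_0_iff [simp]: "0 < a \<Longrightarrow> epow x a = 0 \<longleftrightarrow> x = 0"
  by (cases x rule: ennreal_trichotomy) (auto simp: epow_def)

lemma epow_eq_top_iff [simp]: "0 < a \<Longrightarrow> epow x a = top \<longleftrightarrow> x = top"
  by (cases x rule: ennreal_trichotomy) (auto simp: epow_def)

lemma epow_less_top_iff [simp]: "0 < a \<Longrightarrow> epow x a < top \<longleftrightarrow> x < top"
  using epow_eq_top_iff[of a x] by (metis less_top)

lemma borel_measurable_epow [measurable (raw)]: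
  assumes [measurable]: "f \<in> borel_measurable M"
  shows "(\<lambda>x. epow (f x) a) \<in> borel_measurable M"
proof -
  have [measurable]: "(\<lambda>x. enn2real (f x) powr a) \<in> borel_measurable M"
    by (intro powr_real_measurable) simp_all
  have "{x \<in> space M. f x = 0} \<in> sets M" "{x \<in> space M. f x = \<infinity>} \<in> sets M"
    by simp_all
  then show ?thesis
    unfolding epow_def by (intro measurable_If) simp_all
qed

section \<open>The maximal operator and its weak type bound\<close>

definition doubling :: "'a::euclidean_space measure \<Rightarrow> real \<Rightarrow> bool" where
  "doubling \<mu> D \<longleftrightarrow> sets \<mu> = sets lebesgue \<and>
     (\<forall>c r. 0 < r \<longrightarrow> emeasure \<mu> (ball c r) < \<infinity> \<and>
        emeasure \<mu> (ball c (5 * r)) \<le> ennreal D * emeasure \<mu> (ball c r))"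

text \<open>The operator is uncentred: the ball need only contain \<open>x\<close>. Hence
  \<open>{x. t < maximal \<mu> f x}\<close> is a union of balls, thus open, and the maximal function
  is measurable for every \<open>f\<close>.\<close>

definition maximal :: "'a::euclidean_space measure \<Rightarrow> ('a \<Rightarrow> ennreal) \<Rightarrow> 'a \<Rightarrow> ennreal" where
  "maximal \<mu> f x = (SUP (c, r)\<in>{(c, r). 0 < r \<and> x \<in> ball c r}.
     (\<integral>\<^sup>+y\<in>ball c r. f y \<partial>\<mu>) / emeasure \<mu> (ball c r))"

lemma ball_average_le_maximal:
  assumes "0 < r" "x \<in> ball c r"
  shows "(\<integral>\<^sup>+y\<in>ball c r. f y \<partial>\<mu>) / emeasure \<mu> (ball c r) \<le> maximal \<mu> f x"
  unfolding maximal_def by (rule SUP_upper2[of "(c, r)"]) (use assms in auto)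

lemma maximal_le_iff:
  "maximal \<mu> f x \<le> b \<longleftrightarrow>
    (\<forall>c r. 0 < r \<longrightarrow> x \<in> ball c r \<longrightarrow> (\<integral>\<^sup>+y\<in>ball c r. f y \<partial>\<mu>) / emeasure \<mu> (ball c r) \<le> b)"
  unfolding maximal_def SUP_le_iff by auto

lemma maximal_greater_eq:
  "{x. t < maximal \<mu> f x} =
    (\<Union>(c, r)\<in>{(c, r). 0 < r \<and> t < (\<integral>\<^sup>+y\<in>ball c r. f y \<partial>\<mu>) / emeasure \<mu> (ball c r)}. ball c r)"
  unfolding maximal_def by (fastforce simp: less_SUP_iff)

lemma open_maximal_greater: "open {x. t < maximal \<mu> f x}"
  unfolding maximal_greater_eq by auto

lemma sets_maximal_greater: "{x. t < maximal \<mu> f x} \<in> sets lebesgue"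
proof -
  have "{x. t < maximal \<mu> f x} \<in> sets lborel"
    unfolding sets_lborel by (rule borel_open[OF open_maximal_greater])
  then show ?thesis by (rule sets_completionI_sets)
qed

lemma borel_measurable_maximal: "maximal \<mu> f \<in> borel_measurable borel"
  by (rule borel_measurableI_greater) (simp add: open_maximal_greater)

lemma borel_measurable_maximal_lebesgue [measurable]: "maximal \<mu> f \<in> borel_measurable lebesgue"
  by (rule measurable_completion) (simp add: borel_measurable_maximal cong: measurable_cong_sets)

lemma maximal_mono: "(\<And>x. f x \<le> g x) \<Longrightarrow> maximal \<mu> f x \<le> maximal \<mu> g x"
  unfolding maximal_le_iff
  by (intro allI impI, rule order_trans[OF _ ball_average_le_maximal])
    (auto intro!: divide_right_mono_ennreal nn_integral_mono mult_right_mono)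

text \<open>The average of a constant is at most that constant, also over balls of measure zero.
  This lets the part of a function below half a level be discarded in the interpolation
  argument.\<close>

lemma maximal_const_add:
  assumes "sets \<mu> = sets lebesgue" "f \<in> borel_measurable lebesgue"
    and "\<And>c r. 0 < r \<Longrightarrow> emeasure \<mu> (ball c r) < \<infinity>"
  shows "maximal \<mu> (\<lambda>y. t + f y) x \<le> t + maximal \<mu> f x"
  unfolding maximal_le_iff
proof (intro allI impI)
  fix c and r :: real assume r: "0 < r" "x \<in> ball c r"
  have [measurable]: "f \<in> borel_measurable \<mu>" "ball c r \<in> sets \<mu>"
    using assms(1,2) by (simp_all add: measurable_cong_sets[OF assms(1) refl])
  have "(\<integral>\<^sup>+y\<in>ball c r. (t + f y) \<partial>\<mu>) = t * emeasure \<mu> (ball c r) + (\<integral>\<^sup>+y\<in>ball c r. f y \<partial>\<mu>)"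
    by (simp add: distrib_right nn_integral_add nn_integral_cmult_indicator)
  moreover have "t * emeasure \<mu> (ball c r) / emeasure \<mu> (ball c r) \<le> t"
    using assms(3)[OF r(1), of c]
    by (cases "emeasure \<mu> (ball c r) = 0") (simp_all add: ennreal_mult_divide_eq)
  ultimately show "(\<integral>\<^sup>+y\<in>ball c r. (t + f y) \<partial>\<mu>) / emeasure \<mu> (ball c r) \<le> t + maximal \<mu> f x"
    using ball_average_le_maximal[OF r, where f=f and \<mu>=\<mu>]
    by (simp add: add_divide_distrib_ennreal add_mono)
qed

text \<open>The covering family is indexed by pairs of a centre and a radius; writing its total
  measure as an integral over a counting measure avoids enumerating it.\<close>

lemma emeasure_UN_le_count_space:
  assumes "countable I" "\<And>i. i \<in> I \<Longrightarrow> A i \<in> sets M"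
  shows "emeasure M (\<Union>i\<in>I. A i) \<le> (\<integral>\<^sup>+i. emeasure M (A i) \<partial>count_space I)"
proof -
  have "emeasure M (\<Union>i\<in>I. A i) = (\<integral>\<^sup>+x. indicator (\<Union>i\<in>I. A i) x \<partial>M)"
    using assms by (intro nn_integral_indicator[symmetric] sets.countable_UN') auto
  also have "\<dots> \<le> (\<integral>\<^sup>+x. \<integral>\<^sup>+i. indicator (A i) x \<partial>count_space I \<partial>M)"
  proof (intro nn_integral_mono)
    fix x show "indicator (\<Union>i\<in>I. A i) x \<le> (\<integral>\<^sup>+i. indicator (A i) x \<partial>count_space I)"
    proof (cases "x \<in> (\<Union>i\<in>I. A i)")
      case True
      then obtain i where "i \<in> I" "x \<in> A i" by blast
      then show ?thesis
        using nn_integral_ge_point[of i I "\<lambda>i. indicator (A i) x"] by (simp add: indicator_def)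
    qed simp
  qed
  also have "\<dots> = (\<integral>\<^sup>+i. emeasure M (A i) \<partial>count_space I)"
    using assms by (subst nn_integral_count_space_nn_integral) (auto intro!: nn_integral_cong)
  finally show ?thesis .
qed

text \<open>The superlevel set is the union of the balls over which the average of \<open>f\<close>
  exceeds \<open>t\<close>. Vitali's lemma selects disjoint ones among them whose fivefold
  enlargements still cover, which is why \<open>doubling\<close> is stated with the factor 5. As
  that lemma asks for bounded radii, radii up to \<open>n\<close> are treated first, and
  \<open>n\<close> tends to infinity at the end.\<close>

lemma maximal_weak_type:
  assumes D: "doubling \<mu> D" and f: "f \<in> borel_measurable lebesgue"
  shows "t * emeasure \<mu> {x. t < maximal \<mu> f x} \<le> ennreal D * (\<integral>\<^sup>+x. f x \<partial>\<mu>)"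
proof -
  have sets [measurable_cong]: "sets \<mu> = sets lebesgue" using D by (simp add: doubling_def)
  have fm [measurable]: "f \<in> borel_measurable \<mu>"
    using f by (simp add: measurable_cong_sets[OF sets refl])
  have ball [measurable]: "ball c r \<in> sets \<mu>" for c r by (simp add: sets)
  define K where "K n = {(c, r). 0 < r \<and> r \<le> real n \<and>
    t < (\<integral>\<^sup>+y\<in>ball c r. f y \<partial>\<mu>) / emeasure \<mu> (ball c r)}" for n :: nat
  define S where "S n = (\<Union>(c, r)\<in>K n. ball c r)" for n
  have Un: "{x. t < maximal \<mu> f x} = (\<Union>n. S n)"
    unfolding maximal_greater_eq S_def K_def using real_arch_simple by fastforce
  have inc: "incseq S"
    unfolding incseq_def S_def K_def by fastforce
  have Sm: "S n \<in> sets \<mu>" for n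
    proof -
    have "open (S n)" unfolding S_def by (rule open_UN) auto
    then have "S n \<in> sets lborel" by simp
    then show ?thesis unfolding sets by (rule sets_completionI_sets)
  qed
  have bound: "t * emeasure \<mu> (S n) \<le> ennreal D * (\<integral>\<^sup>+x. f x \<partial>\<mu>)" for n
  proof -
    have cover: "S n \<subseteq> (\<Union>i\<in>K n. ball (fst i) (snd i))" by (auto simp: S_def split_def)
    have radius: "0 < snd i \<and> snd i \<le> real n" if "i \<in> K n" for i
      using that by (auto simp: K_def)
    obtain C where C: "countable C" "C \<subseteq> K n"
      "pairwise (\<lambda>i j. disjnt (ball (fst i) (snd i)) (ball (fst j) (snd j))) C"
      "S n \<subseteq> (\<Union>i\<in>C. ball (fst i) (5 * snd i))"
      by (rule Vitali_covering_lemma_balls[OF cover radius])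
    have "t * emeasure \<mu> (S n) \<le> t * emeasure \<mu> (\<Union>i\<in>C. ball (fst i) (5 * snd i))"
      using C by (intro mult_left_mono emeasure_mono sets.countable_UN') auto
    also have "\<dots> \<le> t * (\<integral>\<^sup>+i. emeasure \<mu> (ball (fst i) (5 * snd i)) \<partial>count_space C)"
      using C by (intro mult_left_mono emeasure_UN_le_count_space) auto
    also have "\<dots> = (\<integral>\<^sup>+i. t * emeasure \<mu> (ball (fst i) (5 * snd i)) \<partial>count_space C)"
      by (simp add: nn_integral_cmult)
    also have "\<dots> \<le> (\<integral>\<^sup>+i. ennreal D * emeasure (density \<mu> f) (ball (fst i) (snd i)) \<partial>count_space C)"
    proof (intro nn_integral_mono)
      fix i assume "i \<in> space (count_space C)"
      then have i: "0 < snd i"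
        "t < (\<integral>\<^sup>+y\<in>ball (fst i) (snd i). f y \<partial>\<mu>) / emeasure \<mu> (ball (fst i) (snd i))"
        using C(2) by (auto simp: K_def)
      let ?m = "emeasure \<mu> (ball (fst i) (snd i))" and ?I = "\<integral>\<^sup>+y\<in>ball (fst i) (snd i). f y \<partial>\<mu>"
      have m: "?m < \<infinity>" "emeasure \<mu> (ball (fst i) (5 * snd i)) \<le> ennreal D * ?m"
        using D i(1) by (auto simp: doubling_def)
      have "t * ?m \<le> ?I"
      proof (cases "?m = 0")
        case False
        have "t * ?m \<le> (?I / ?m) * ?m" using i(2) by (intro mult_right_mono) auto
        also have "\<dots> = ?I" using False m(1) by (simp add: ennreal_divide_times)
        finally show ?thesis .
      qed simp
      then have "t * (ennreal D * ?m) \<le> ennreal D * ?I"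
        by (metis mult.left_commute mult_left_mono zero_le)
      moreover have "t * emeasure \<mu> (ball (fst i) (5 * snd i)) \<le> t * (ennreal D * ?m)"
        using m(2) by (intro mult_left_mono) auto
      ultimately show "t * emeasure \<mu> (ball (fst i) (5 * snd i))
        \<le> ennreal D * emeasure (density \<mu> f) (ball (fst i) (snd i))"
        by (simp add: emeasure_density)
    qed
    also have "\<dots> = ennreal D * (\<integral>\<^sup>+i. emeasure (density \<mu> f) (ball (fst i) (snd i)) \<partial>count_space C)"
      by (simp add: nn_integral_cmult)
    also have "(\<integral>\<^sup>+i. emeasure (density \<mu> f) (ball (fst i) (snd i)) \<partial>count_space C)
      = emeasure (density \<mu> f) (\<Union>i\<in>C. ball (fst i) (snd i))"
      using C by (intro emeasure_UN_countable[symmetric])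
        (auto simp: disjoint_family_on_def pairwise_def disjnt_def)
    also have "\<dots> \<le> emeasure (density \<mu> f) (space \<mu>)"
      using emeasure_space[of "density \<mu> f"] by simp
    also have "\<dots> = (\<integral>\<^sup>+x. f x \<partial>\<mu>)"
      by (simp add: emeasure_density cong: nn_integral_cong)
    finally show ?thesis by (simp add: mult_left_mono)
  qed
  have "emeasure \<mu> {x. t < maximal \<mu> f x} = (SUP n. emeasure \<mu> (S n))"
    unfolding Un using Sm inc by (intro SUP_emeasure_incseq[symmetric]) auto
  then have "t * emeasure \<mu> {x. t < maximal \<mu> f x} = (SUP n. t * emeasure \<mu> (S n))"
    by (simp add: SUP_mult_left_ennreal)
  then show ?thesis using bound by (simp add: SUP_le_iff)
qed

section \<open>Dyadic decomposition and the strong type bound\<close>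

lemma nn_integral_int_geometric:
  fixes m :: int and q :: real
  assumes "0 < q"
  shows "(\<integral>\<^sup>+k. ennreal (2 powr (q * real_of_int k)) * indicator {..m} k \<partial>count_space UNIV)
    = ennreal (2 powr (q * real_of_int m) / (1 - 2 powr - q))"
proof -
  have lt: "2 powr - q < (1::real)" using assms by (simp add: powr_minus_divide)
  have "bij_betw (\<lambda>j. m - int j) UNIV {..m}"
    by (rule bij_betwI[where g="\<lambda>k. nat (m - k)"]) auto
  from nn_integral_bij_count_space[OF this, of "\<lambda>k. ennreal (2 powr (q * real_of_int k))"]
  have "(\<integral>\<^sup>+k. ennreal (2 powr (q * real_of_int k)) * indicator {..m} k \<partial>count_space UNIV)
    = (\<integral>\<^sup>+j. ennreal (2 powr (q * real_of_int (m - int j))) \<partial>count_space UNIV)"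
    by (subst nn_integral_count_space_indicator[symmetric]) simp_all
  also have "\<dots> = (\<Sum>j. ennreal (2 powr (q * real_of_int (m - int j))))"
    by (rule nn_integral_count_space_nat)
  also have "(\<lambda>j. ennreal (2 powr (q * real_of_int (m - int j))))
    = (\<lambda>j. ennreal (2 powr (q * real_of_int m) * (2 powr - q) ^ j))"
    by (auto simp: powr_diff powr_minus_divide algebra_simps powr_realpow[symmetric] powr_powr power_one_over fun_eq_iff)
  also have "(\<Sum>j. ennreal (2 powr (q * real_of_int m) * (2 powr - q) ^ j))
    = ennreal (\<Sum>j. 2 powr (q * real_of_int m) * (2 powr - q) ^ j)"
    using lt by (intro suminf_ennreal2 summable_mult summable_geometric) auto
  also have "(\<Sum>j. 2 powr (q * real_of_int m) * (2 powr - q) ^ j)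
    = 2 powr (q * real_of_int m) / (1 - 2 powr - q)"
    using lt by (subst suminf_mult) (auto simp: suminf_geometric summable_geometric)
  finally show ?thesis .
qed

lemma dyadic_bracket:
  assumes "0 < (y::real)"
  obtains k :: int where "2 powr real_of_int k < y" "y \<le> 2 powr (real_of_int k + 1)"
proof
  let ?k = "\<lceil>log 2 y\<rceil> - 1"
  show "2 powr real_of_int ?k < y"
    using assms by (subst less_log_iff[symmetric]) (auto, linarith)
  show "y \<le> 2 powr (real_of_int ?k + 1)"
    using assms by (subst log_le_iff[symmetric]) auto
qed

text \<open>A discrete layer-cake bound. For a positive finite \<open>M\<close> the level just below
  \<open>M\<close> suffices on its own; for \<open>M = top\<close> all levels are present and their
  terms are unbounded.\<close>

lemma epow_le_dyadic_sum:
  assumes "0 < p"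
  shows "epow M p \<le> (\<integral>\<^sup>+k. ennreal (2 powr (p * (real_of_int k + 1))) *
    indicator {k. ennreal (2 powr real_of_int k) < M} k \<partial>count_space UNIV)" (is "_ \<le> (\<integral>\<^sup>+k. ?f k \<partial>_)")
proof (cases M rule: ennreal_trichotomy)
  case zero
  then show ?thesis using assms by simp
next
  case (pos y)
  obtain k :: int where k: "2 powr real_of_int k < y" "y \<le> 2 powr (real_of_int k + 1)"
    using dyadic_bracket[OF pos(1)] .
  have "y powr p \<le> (2 powr (real_of_int k + 1)) powr p"
    using k(2) pos(1) assms by (intro powr_mono2) auto
  also have "\<dots> = 2 powr (p * (real_of_int k + 1))" by (simp add: powr_powr mult.commute)
  finally have "epow M p \<le> ?f k"
    using k(1) pos by (simp add: epow_ennreal ennreal_leI ennreal_lessI indicator_def)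
  also have "\<dots> \<le> (\<integral>\<^sup>+k. ?f k \<partial>count_space UNIV)" by (rule nn_integral_ge_point) simp
  finally show ?thesis .
next
  case top
  have "of_nat n \<le> (\<integral>\<^sup>+k. ?f k \<partial>count_space UNIV)" for n
  proof -
    obtain m :: nat where m: "log 2 (real (Suc n)) < real m * p"
      using assms reals_Archimedean3 by blast
    have "real n \<le> 2 powr log 2 (real (Suc n))" by simp
    also have "\<dots> \<le> 2 powr (p * (real m + 1))"
      using m assms by (intro powr_mono) (auto simp: algebra_simps)
    finally have "ennreal (real n) \<le> ?f (int m)"
      using top by (simp add: ennreal_leI indicator_def)
    also have "\<dots> \<le> (\<integral>\<^sup>+k. ?f k \<partial>count_space UNIV)" by (rule nn_integral_ge_point) simp
    finally show ?thesis by (simp add: ennreal_of_nat_eq_real_of_nat)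
  qed
  then have "\<not> (\<integral>\<^sup>+k. ?f k \<partial>count_space UNIV) < top"
    by (meson ennreal_Ex_less_of_nat not_le)
  then have "(\<integral>\<^sup>+k. ?f k \<partial>count_space UNIV) = top"
    by (simp only: less_top[symmetric] not_not)
  then show ?thesis by (simp only: top_greatest)
qed

text \<open>For a positive finite \<open>y\<close> the levels that count lie in a half-line ending
  at \<open>m + 1\<close>, where \<open>2 powr m\<close> is below \<open>y\<close>. The geometric
  series is comparable to its top term, which is of order \<open>y powr q\<close>.\<close>

lemma mult_dyadic_sum_le_epow:
  assumes "0 < q"
  shows "y * (\<integral>\<^sup>+k. ennreal (2 powr (q * real_of_int k)) *
      indicator {k. ennreal (2 powr (real_of_int k - 1)) < y} k \<partial>count_space UNIV)
    \<le> ennreal (2 powr q / (1 - 2 powr - q)) * epow y (q + 1)"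
proof -
  have L: "0 < 1 - 2 powr - q" using assms by (simp add: powr_minus_divide)
  show ?thesis
  proof (cases y rule: ennreal_trichotomy)
    case top
    have "ennreal (2 powr q / (1 - 2 powr - q)) * epow y (q + 1) = top"
      using top assms L by (simp add: ennreal_mult_top)
    then show ?thesis by (simp only: top_greatest)
  next
    case (pos z)
    obtain m :: int where m: "2 powr real_of_int m < z" "z \<le> 2 powr (real_of_int m + 1)"
      using dyadic_bracket[OF pos(1)] .
    have "{k. ennreal (2 powr (real_of_int k - 1)) < y} \<subseteq> {..m + 1}"
    proof safe
      fix k :: int assume "ennreal (2 powr (real_of_int k - 1)) < y"
      then have "2 powr (real_of_int k - 1) < z" using pos by (simp add: ennreal_less_iff)
      then have "2 powr (real_of_int k - 1) < 2 powr (real_of_int m + 1)" using m(2) by linarith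
      then show "k \<le> m + 1" by simp
    qed
    then have "(\<integral>\<^sup>+k. ennreal (2 powr (q * real_of_int k)) *
        indicator {k. ennreal (2 powr (real_of_int k - 1)) < y} k \<partial>count_space UNIV)
      \<le> (\<integral>\<^sup>+k. ennreal (2 powr (q * real_of_int k)) * indicator {..m + 1} k \<partial>count_space UNIV)"
      by (intro nn_integral_mono mult_left_mono) (auto simp: indicator_def)
    also have "\<dots> = ennreal (2 powr (q * real_of_int (m + 1)) / (1 - 2 powr - q))"
      by (rule nn_integral_int_geometric[OF assms])
    also have "\<dots> \<le> ennreal (2 powr q / (1 - 2 powr - q) * z powr q)"
    proof -
      have "2 powr (q * real_of_int (m + 1)) = 2 powr q * (2 powr real_of_int m) powr q"
        by (simp add: powr_powr algebra_simps powr_add[symmetric])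
      also have "\<dots> \<le> 2 powr q * z powr q"
        using m(1) assms by (intro mult_left_mono powr_mono2) auto
      finally show ?thesis using L by (intro ennreal_leI) (simp add: divide_right_mono)
    qed
    finally have "y * (\<integral>\<^sup>+k. ennreal (2 powr (q * real_of_int k)) *
        indicator {k. ennreal (2 powr (real_of_int k - 1)) < y} k \<partial>count_space UNIV)
      \<le> ennreal z * ennreal (2 powr q / (1 - 2 powr - q) * z powr q)"
      unfolding pos(2) by (rule mult_left_mono) simp
    also have "\<dots> = ennreal (2 powr q / (1 - 2 powr - q)) * epow y (q + 1)"
      using pos L assms
      by (simp add: epow_ennreal ennreal_mult[symmetric] powr_add algebra_simps del: ennreal_mult'')
    finally show ?thesis .
  qed simp
qed

text \<open>Marcinkiewicz interpolation between the weak type bound and the trivial bound for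
  constants. At the level \<open>2 powr k\<close> only \<open>g k\<close>, the part of
  \<open>f\<close> above half the level, matters; the weak type bounds are summed over
  \<open>k\<close>, and the sum is then taken inside the integral.\<close>

lemma maximal_strong_type:
  assumes D: "doubling \<mu> D" and p: "1 < p"
  shows "\<exists>C::real. 0 < C \<and> (\<forall>f\<in>borel_measurable lebesgue.
    (\<integral>\<^sup>+x. epow (maximal \<mu> f x) p \<partial>\<mu>) \<le> ennreal C * (\<integral>\<^sup>+x. epow (f x) p \<partial>\<mu>))"
proof -
  define q where "q = p - 1"
  \<comment> \<open>\<open>doubling\<close> does not ask for a positive \<open>D\<close>; the
    maximum makes the final constant positive.\<close>
  define E where "E = max D 1"
  have q: "0 < q" "p = q + 1" and E: "0 < E" "D \<le> E" using p by (auto simp: q_def E_def)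
  have L: "0 < 1 - 2 powr - q" using q by (simp add: powr_minus_divide)
  have sets [measurable_cong]: "sets \<mu> = sets lebesgue" using D by (simp add: doubling_def)
  have fin: "emeasure \<mu> (ball c r) < \<infinity>" if "0 < r" for c r using D that by (simp add: doubling_def)
  let ?B = "2 powr q / (1 - 2 powr - q)"
  have main: "(\<integral>\<^sup>+x. epow (maximal \<mu> f x) p \<partial>\<mu>) \<le> ennreal (E * 2 powr (p + 1) * ?B) * (\<integral>\<^sup>+x. epow (f x) p \<partial>\<mu>)"
    if f: "f \<in> borel_measurable lebesgue" for f
  proof -
    have fm [measurable]: "f \<in> borel_measurable \<mu>"
      using f by (simp add: measurable_cong_sets[OF sets refl])
    have Mm [measurable]: "maximal \<mu> f \<in> borel_measurable \<mu>"
      using borel_measurable_maximal_lebesgue by (simp add: measurable_cong_sets[OF sets refl])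
    define g where "g k x = f x * indicator {x. ennreal (2 powr (real_of_int k - 1)) < f x} x" for k :: int and x
    have gm [measurable]: "g k \<in> borel_measurable \<mu>" for k
      unfolding g_def by measurable
    have lev_sets: "{x. t < maximal \<mu> h x} \<in> sets \<mu>" for t h
      unfolding sets by (rule sets_maximal_greater)
    have lev: "ennreal (2 powr (p * (real_of_int k + 1))) * emeasure \<mu> {x. ennreal (2 powr real_of_int k) < maximal \<mu> f x}
      \<le> ennreal (E * 2 powr (p + 1)) * (ennreal (2 powr (q * real_of_int k)) * (\<integral>\<^sup>+x. g k x \<partial>\<mu>))" for k
    proof -
      let ?t = "2 powr (real_of_int k - 1)"
      have sub: "{x. ennreal (2 powr real_of_int k) < maximal \<mu> f x} \<subseteq> {x. ennreal ?t < maximal \<mu> (g k) x}"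
      proof safe
        fix x assume *: "ennreal (2 powr real_of_int k) < maximal \<mu> f x"
        have "maximal \<mu> f x \<le> maximal \<mu> (\<lambda>x. ennreal ?t + g k x) x"
          by (rule maximal_mono) (auto simp: g_def indicator_def)
        also have "\<dots> \<le> ennreal ?t + maximal \<mu> (g k) x"
          using gm[of k] fin by (intro maximal_const_add) (simp_all add: sets measurable_cong_sets[OF sets refl])
        finally have "ennreal (2 powr real_of_int k) < ennreal ?t + maximal \<mu> (g k) x"
          using * by (rule less_le_trans[rotated])
        moreover have "ennreal (2 powr real_of_int k) = ennreal ?t + ennreal ?t"
          by (simp add: ennreal_plus[symmetric] powr_diff del: ennreal_plus)
        ultimately show "ennreal ?t < maximal \<mu> (g k) x"
          by (metis add_left_mono not_le)
      qed
      have "ennreal ?t * emeasure \<mu> {x. ennreal (2 powr real_of_int k) < maximal \<mu> f x}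
        \<le> ennreal ?t * emeasure \<mu> {x. ennreal ?t < maximal \<mu> (g k) x}"
        by (intro mult_left_mono emeasure_mono sub lev_sets) simp
      also have "\<dots> \<le> ennreal D * (\<integral>\<^sup>+x. g k x \<partial>\<mu>)"
        using gm[of k] by (intro maximal_weak_type D) (simp add: measurable_cong_sets[OF sets refl])
      also have "\<dots> \<le> ennreal E * (\<integral>\<^sup>+x. g k x \<partial>\<mu>)"
        using E by (intro mult_right_mono ennreal_leI) auto
      finally have "ennreal (2 powr (p + 1) * 2 powr (q * real_of_int k)) * (ennreal ?t * emeasure \<mu> {x. ennreal (2 powr real_of_int k) < maximal \<mu> f x})
        \<le> ennreal (2 powr (p + 1) * 2 powr (q * real_of_int k)) * (ennreal E * (\<integral>\<^sup>+x. g k x \<partial>\<mu>))"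
        by (rule mult_left_mono) simp
      moreover have "ennreal (2 powr (p * (real_of_int k + 1))) = ennreal (2 powr (p + 1) * 2 powr (q * real_of_int k)) * ennreal ?t"
        by (simp add: ennreal_mult[symmetric] powr_add[symmetric] q_def algebra_simps)
      ultimately show ?thesis
        using E by (simp add: ennreal_mult mult_ac)
    qed
    have "(\<integral>\<^sup>+x. epow (maximal \<mu> f x) p \<partial>\<mu>)
      \<le> (\<integral>\<^sup>+x. \<integral>\<^sup>+k. ennreal (2 powr (p * (real_of_int k + 1))) *
          indicator {x. ennreal (2 powr real_of_int k) < maximal \<mu> f x} x \<partial>count_space UNIV \<partial>\<mu>)"
      using p epow_le_dyadic_sum[of p] by (intro nn_integral_mono) (simp add: indicator_def)
    also have "\<dots> = (\<integral>\<^sup>+k. \<integral>\<^sup>+x. ennreal (2 powr (p * (real_of_int k + 1))) *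
          indicator {x. ennreal (2 powr real_of_int k) < maximal \<mu> f x} x \<partial>\<mu> \<partial>count_space UNIV)"
      by (rule nn_integral_count_space_nn_integral) auto
    also have "\<dots> = (\<integral>\<^sup>+k. ennreal (2 powr (p * (real_of_int k + 1))) *
          emeasure \<mu> {x. ennreal (2 powr real_of_int k) < maximal \<mu> f x} \<partial>count_space UNIV)"
      by (intro nn_integral_cong nn_integral_cmult_indicator lev_sets)
    also have "\<dots> \<le> (\<integral>\<^sup>+k. ennreal (E * 2 powr (p + 1)) * (ennreal (2 powr (q * real_of_int k)) * (\<integral>\<^sup>+x. g k x \<partial>\<mu>)) \<partial>count_space UNIV)"
      by (intro nn_integral_mono lev)
    also have "\<dots> = ennreal (E * 2 powr (p + 1)) * (\<integral>\<^sup>+k. \<integral>\<^sup>+x. ennreal (2 powr (q * real_of_int k)) * g k x \<partial>\<mu> \<partial>count_space UNIV)"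
      by (simp add: nn_integral_cmult)
    also have "(\<integral>\<^sup>+k. \<integral>\<^sup>+x. ennreal (2 powr (q * real_of_int k)) * g k x \<partial>\<mu> \<partial>count_space UNIV)
      = (\<integral>\<^sup>+x. \<integral>\<^sup>+k. ennreal (2 powr (q * real_of_int k)) * g k x \<partial>count_space UNIV \<partial>\<mu>)"
      by (rule nn_integral_count_space_nn_integral[symmetric]) auto
    also have "\<dots> = (\<integral>\<^sup>+x. f x * (\<integral>\<^sup>+k. ennreal (2 powr (q * real_of_int k)) *
        indicator {k. ennreal (2 powr (real_of_int k - 1)) < f x} k \<partial>count_space UNIV) \<partial>\<mu>)"
      by (intro nn_integral_cong, subst nn_integral_cmult[symmetric])
        (auto simp: g_def indicator_def mult.commute intro!: nn_integral_cong)
    finally have "(\<integral>\<^sup>+x. epow (maximal \<mu> f x) p \<partial>\<mu>) \<le> ennreal (E * 2 powr (p + 1)) *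
      (\<integral>\<^sup>+x. f x * (\<integral>\<^sup>+k. ennreal (2 powr (q * real_of_int k)) *
        indicator {k. ennreal (2 powr (real_of_int k - 1)) < f x} k \<partial>count_space UNIV) \<partial>\<mu>)" .
    also have "\<dots> \<le> ennreal (E * 2 powr (p + 1)) * (\<integral>\<^sup>+x. ennreal ?B * epow (f x) p \<partial>\<mu>)"
      unfolding q(2) by (intro mult_left_mono nn_integral_mono mult_dyadic_sum_le_epow q) simp
    also have "(\<integral>\<^sup>+x. ennreal ?B * epow (f x) p \<partial>\<mu>) = ennreal ?B * (\<integral>\<^sup>+x. epow (f x) p \<partial>\<mu>)"
      by (intro nn_integral_cmult) measurable
    also have "ennreal (E * 2 powr (p + 1)) * (ennreal ?B * (\<integral>\<^sup>+x. epow (f x) p \<partial>\<mu>))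
      = ennreal (E * 2 powr (p + 1) * ?B) * (\<integral>\<^sup>+x. epow (f x) p \<partial>\<mu>)"
      using E L by (subst ennreal_mult) (auto simp: mult.assoc)
    finally show ?thesis .
  qed
  show ?thesis
    using E L main by (intro exI[of _ "E * 2 powr (p + 1) * ?B"] conjI ballI) auto
qed

section \<open>Muckenhoupt's theorem\<close>

abbreviation wmeasure :: "('a::euclidean_space \<Rightarrow> real) \<Rightarrow> 'a measure" where
  "wmeasure w \<equiv> density lebesgue (\<lambda>x. ennreal (w x))"

lemma measure_ball_scale:
  fixes c :: "'a::euclidean_space"
  assumes "0 < r" "0 < k"
  shows "measure lebesgue (ball c (k * r)) = k ^ DIM('a) * measure lebesgue (ball c r)"
  using assms by (simp add: content_ball power_mult_distrib)

lemma measure_ball_pos: "0 < r \<Longrightarrow> 0 < measure lebesgue (ball c r)"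
  by (simp add: content_ball unit_ball_vol_pos)

lemma emeasure_ball_eq: "emeasure lebesgue (ball c r) = ennreal (measure lebesgue (ball c r))"
  by (intro emeasure_eq_ennreal_measure) (use emeasure_lborel_ball_finite[of c r] in auto)

text \<open>The Muckenhoupt condition for \<open>w\<close> and its dual weight \<open>s\<close>,
  with the denominators of the averages cleared: the powers of the measure of the ball add up to
  \<open>t\<close>. Carrying both weights makes the condition symmetric, so that each result on
  \<open>w\<close> transfers to \<open>s\<close>.\<close>

locale muckenhoupt_pair =
  fixes w s :: "'a::euclidean_space \<Rightarrow> real" and t t' K :: real
  assumes w_measurable [measurable]: "w \<in> borel_measurable lebesgue"
    and s_measurable [measurable]: "s \<in> borel_measurable lebesgue"
    and t: "1 < t" "t' = t / (t - 1)"
    and w_pos: "0 < w x"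
    and s_eq: "s x = w x powr (1 - t')"
    and w_finite: "0 < r \<Longrightarrow> emeasure (wmeasure w) (ball c r) < \<infinity>"
    and s_finite: "0 < r \<Longrightarrow> emeasure (wmeasure s) (ball c r) < \<infinity>"
    and K: "0 < K"
    and A_condition: "0 < r \<Longrightarrow> measure (wmeasure w) (ball c r) * measure (wmeasure s) (ball c r) powr (t - 1)
      \<le> K * measure lebesgue (ball c r) powr t"
begin

lemma exponents: "1 < t'" "(t - 1) * (t' - 1) = 1" "(t - 1) * t' = t" "t = t' / (t' - 1)"
proof -
  have *: "t' - 1 = 1 / (t - 1)" using t by (simp add: diff_divide_distrib[symmetric] field_simps)
  then show "(t - 1) * (t' - 1) = 1" using t(1) by simp
  show "1 < t'" using * t(1) by (metis diff_gt_0_iff_gt zero_less_divide_1_iff)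
  show "(t - 1) * t' = t" using t by simp
  show "t = t' / (t' - 1)" unfolding * unfolding t(2) using t(1) by simp
qed

lemma s_pos: "0 < s x"
  using w_pos[of x] by (simp add: s_eq)

lemma w_eq: "w x = s x powr (1 - t)"
proof -
  have "(1 - t') * (1 - t) = 1" using exponents(2) by (simp add: algebra_simps)
  then show ?thesis using w_pos[of x] by (simp add: s_eq powr_powr)
qed

text \<open>Raising the condition to the power \<open>t' - 1\<close> interchanges the two weights,
  because \<open>t - 1\<close> and \<open>t' - 1\<close> are reciprocal.\<close>

lemma dual: "muckenhoupt_pair s w t' t (K powr (t' - 1))"
proof
  show "measure (wmeasure s) (ball c r) * measure (wmeasure w) (ball c r) powr (t' - 1)
      \<le> K powr (t' - 1) * measure lebesgue (ball c r) powr t'" if "0 < r" for c r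
  proof -
    have "(measure (wmeasure w) (ball c r) * measure (wmeasure s) (ball c r) powr (t - 1)) powr (t' - 1)
      \<le> (K * measure lebesgue (ball c r) powr t) powr (t' - 1)"
      using A_condition[OF that, of c] exponents by (intro powr_mono2) auto
    moreover have "t * (t' - 1) = t'" using exponents(3) by (simp add: algebra_simps)
    ultimately show ?thesis
      using K exponents(2)
      by (simp only: powr_mult powr_powr mult.commute[of "measure (wmeasure s) (ball c r)"] powr_one measure_nonneg)
  qed
  show "w x = s x powr (1 - t)" "0 < s x" for x by (rule w_eq s_pos)+
  show "1 < t'" "t = t' / (t' - 1)" by (rule exponents)+
  show "0 < K powr (t' - 1)" using K by simp
qed (fact s_measurable w_measurable s_finite w_finite)+

lemma w_ball_pos: "0 < r \<Longrightarrow> 0 < measure (wmeasure w) (ball c r)"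
proof (rule ccontr)
  assume r: "0 < r" and "\<not> 0 < measure (wmeasure w) (ball c r)"
  then have "measure (wmeasure w) (ball c r) = 0" by (simp add: zero_less_measure_iff)
  then have "emeasure (wmeasure w) (ball c r) = 0"
    using w_finite[OF r, of c] by (auto simp: measure_def enn2real_eq_0_iff)
  then have "ball c r \<in> null_sets (wmeasure w)" by (auto intro!: null_setsI)
  then have "AE x in lebesgue. x \<in> ball c r \<longrightarrow> ennreal (w x) = 0"
    by (simp add: null_sets_density_iff)
  then have "AE x in lebesgue. x \<notin> ball c r"
    by eventually_elim (metis ennreal_eq_0_iff not_le w_pos)
  then have "ball c r \<in> null_sets lebesgue"
    by (subst (asm) AE_iff_null_sets[symmetric]) auto
  then show False
    using measure_ball_pos[OF r, of c] by (simp add: null_sets_def measure_def)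
qed

lemma s_ball_pos: "0 < r \<Longrightarrow> 0 < measure (wmeasure s) (ball c r)"
  by (rule muckenhoupt_pair.w_ball_pos[OF dual])

lemma emeasure_w_ball: "0 < r \<Longrightarrow> emeasure (wmeasure w) (ball c r) = ennreal (measure (wmeasure w) (ball c r))"
  using w_finite[of r c] by (intro emeasure_eq_ennreal_measure) auto

lemma emeasure_s_ball: "0 < r \<Longrightarrow> emeasure (wmeasure s) (ball c r) = ennreal (measure (wmeasure s) (ball c r))"
  by (rule muckenhoupt_pair.emeasure_w_ball[OF dual])

text \<open>A substitute for Hoelder's inequality: where \<open>l * w < 1\<close>, the dual weight is at least
  \<open>l powr (t' - 1)\<close>.\<close>

lemma ball_measure_le:
  assumes r: "0 < r"
  shows "measure lebesgue (ball c r) powr t \<le> 2 powr t *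
    (measure (wmeasure w) (ball c r) * measure (wmeasure s) (ball c r) powr (t - 1))"
proof -
  let ?B = "measure lebesgue (ball c r)" and ?W = "measure (wmeasure w) (ball c r)"
    and ?S = "measure (wmeasure s) (ball c r)"
  \<comment> \<open>With this choice \<open>l * ?W\<close> is half of \<open>?B\<close> and can be
    absorbed on the left.\<close>
  define l where "l = ?B / (2 * ?W)"
  have B: "0 < ?B" and W: "0 < ?W" and S: "0 < ?S"
    using r measure_ball_pos w_ball_pos s_ball_pos by auto
  then have l: "0 < l" by (simp add: l_def)
  have pt: "1 \<le> l * w x + l powr (1 - t') * s x" for x
  proof (cases "1 \<le> l * w x")
    case True
    then show ?thesis using s_pos[of x] by (simp add: add_increasing2)
  next
    case False
    have "l powr (1 - t') * s x = (l * w x) powr (1 - t')"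
      using l w_pos[of x] by (simp add: s_eq powr_mult)
    moreover have "1 \<le> (l * w x) powr (1 - t')"
      using False l w_pos[of x] exponents powr_mono2'[of "1 - t'" "l * w x" 1] by simp
    ultimately show ?thesis using l w_pos[of x] by (simp add: add_increasing)
  qed
  have [measurable]: "ball c r \<in> sets lebesgue" by simp
  have "ennreal ?B = (\<integral>\<^sup>+x. indicator (ball c r) x \<partial>lebesgue)"
    by (simp add: emeasure_ball_eq)
  also have "\<dots> \<le> (\<integral>\<^sup>+x. (ennreal l * (ennreal (w x) * indicator (ball c r) x)
      + ennreal (l powr (1 - t')) * (ennreal (s x) * indicator (ball c r) x)) \<partial>lebesgue)"
  proof (intro nn_integral_mono)
    fix x
    have "ennreal 1 \<le> ennreal l * ennreal (w x) + ennreal (l powr (1 - t')) * ennreal (s x)"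
      using pt[of x] l w_pos[of x] s_pos[of x]
      by (simp add: ennreal_mult[symmetric] ennreal_plus[symmetric] less_imp_le del: ennreal_plus)
    then show "indicator (ball c r) x \<le> ennreal l * (ennreal (w x) * indicator (ball c r) x)
      + ennreal (l powr (1 - t')) * (ennreal (s x) * indicator (ball c r) x)"
      by (simp add: indicator_def)
  qed
  also have "\<dots> = ennreal l * emeasure (wmeasure w) (ball c r)
      + ennreal (l powr (1 - t')) * emeasure (wmeasure s) (ball c r)"
    by (subst nn_integral_add, measurable, subst nn_integral_cmult, measurable, subst nn_integral_cmult,
      measurable, simp add: emeasure_density)
  also have "\<dots> = ennreal (l * ?W + l powr (1 - t') * ?S)"
    using l by (simp add: emeasure_w_ball[OF r] emeasure_s_ball[OF r] ennreal_mult[symmetric])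
  finally have "?B \<le> l * ?W + l powr (1 - t') * ?S"
    using l by (subst (asm) ennreal_le_iff) auto
  moreover have "l * ?W = ?B / 2" using W by (simp add: l_def)
  ultimately have "?B / 2 \<le> l powr (1 - t') * ?S" by simp
  then have "(?B / 2) powr (t - 1) \<le> (l powr (1 - t') * ?S) powr (t - 1)"
    using B t by (intro powr_mono2) auto
  also have "\<dots> = l powr (- 1) * ?S powr (t - 1)"
  proof -
    have "(1 - t') * (t - 1) = - 1" using exponents(2) by (simp add: algebra_simps)
    then show ?thesis using l by (simp add: powr_mult powr_powr)
  qed
  also have "\<dots> = (2 * ?W / ?B) * ?S powr (t - 1)"
    using B W by (simp add: l_def powr_minus_divide)
  finally have "(?B / 2) powr (t - 1) * (?B / 2) \<le> ?W * ?S powr (t - 1)"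
    using B by (simp add: field_simps)
  moreover have "(?B / 2) powr (t - 1) * (?B / 2) = ?B powr t / 2 powr t"
    using B powr_add[of "?B / 2" "t - 1" 1] by (simp add: powr_divide)
  ultimately have "?B powr t / 2 powr t \<le> ?W * ?S powr (t - 1)" by linarith
  then show ?thesis by (simp add: divide_le_eq mult.commute)
qed

text \<open>The condition on the large ball bounds its \<open>w\<close> measure by Lebesgue measure,
  and \<open>ball_measure_le\<close> on the small ball turns Lebesgue measure back into the weights.
  Enlarging the \<open>s\<close> measure of the small ball to that of the large one then lets this
  factor cancel.\<close>

lemma doubling_w: "doubling (wmeasure w) (K * (10 ^ DIM('a)) powr t)"
  unfolding doubling_def
proof (intro conjI allI impI)
  fix c :: 'a and r :: real assume r: "0 < r"
  let ?n = "DIM('a)"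
  let ?B = "measure lebesgue (ball c r)" and ?W = "\<lambda>r. measure (wmeasure w) (ball c r)"
    and ?S = "\<lambda>r. measure (wmeasure s) (ball c r)"
  have r5: "0 < 5 * r" using r by simp
  have "ball c r \<subseteq> ball c (5 * r)" using r by (intro subset_ball) simp
  then have "emeasure (wmeasure s) (ball c r) \<le> emeasure (wmeasure s) (ball c (5 * r))"
    by (intro emeasure_mono) auto
  then have S: "?S r \<le> ?S (5 * r)" by (simp add: emeasure_s_ball r)
  have "?W (5 * r) * ?S (5 * r) powr (t - 1) \<le> K * (5 ^ ?n * ?B) powr t"
    using A_condition[OF r5, of c] by (simp only: measure_ball_scale[OF r zero_less_numeral])
  also have "\<dots> = K * (5 ^ ?n) powr t * ?B powr t"
    by (simp add: powr_mult)
  also have "\<dots> \<le> K * (5 ^ ?n) powr t * (2 powr t * (?W r * ?S r powr (t - 1)))"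
    using K by (intro mult_left_mono ball_measure_le r) auto
  also have "\<dots> \<le> K * (5 ^ ?n) powr t * (2 powr t * (?W r * ?S (5 * r) powr (t - 1)))"
    using K t S by (intro mult_left_mono powr_mono2) auto
  finally have "?W (5 * r) \<le> K * (5 ^ ?n) powr t * (2 powr t * ?W r)"
    using s_ball_pos[OF r5, of c] by simp
  \<comment> \<open>The factor \<open>2 powr t\<close> is enlarged so that it merges with
    \<open>5 ^ ?n\<close> into a power of 10.\<close>
  also have "\<dots> \<le> K * (5 ^ ?n) powr t * ((2 ^ ?n) powr t * ?W r)"
    using K t w_ball_pos[OF r, of c]
    by (intro mult_left_mono mult_right_mono powr_mono2) (auto simp: self_le_power)
  also have "\<dots> = K * (10 ^ ?n) powr t * ?W r"
    by (simp add: powr_mult[symmetric] power_mult_distrib[symmetric] mult.assoc[symmetric])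
  finally show "emeasure (wmeasure w) (ball c (5 * r)) \<le> ennreal (K * (10 ^ ?n) powr t) * emeasure (wmeasure w) (ball c r)"
    using K r by (simp add: emeasure_w_ball ennreal_mult[symmetric])
qed (use w_finite in auto)

lemma doubling_s: "doubling (wmeasure s) (K powr (t' - 1) * (10 ^ DIM('a)) powr t')"
  by (rule muckenhoupt_pair.doubling_w[OF dual])

text \<open>On a ball \<open>B\<close> containing \<open>x\<close>, the mean of \<open>f\<close> with respect to Lebesgue measure is a multiple of
  the mean of \<open>f / s\<close> with respect to \<open>s\<close>; the latter is at most the maximal function of \<open>f / s\<close> at
  every point of \<open>B\<close>, so its power can be averaged over \<open>B\<close> with respect to \<open>w\<close>.\<close>

lemma lerner_pointwise:
  assumes f [measurable]: "f \<in> borel_measurable lebesgue"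
  shows "epow (maximal lebesgue f x) (t - 1) \<le> ennreal K *
    maximal (wmeasure w) (\<lambda>y. epow (maximal (wmeasure s) (\<lambda>z. f z * ennreal (1 / s z)) y) (t - 1) * ennreal (1 / w y)) x"
    (is "_ \<le> _ * maximal _ ?h x")
proof -
  have t1: "0 < t - 1" using t by simp
  have "maximal lebesgue f x \<le> epow (ennreal K * maximal (wmeasure w) ?h x) (1 / (t - 1))"
    unfolding maximal_le_iff
  proof (intro allI impI)
    fix c and r :: real assume r: "0 < r" "x \<in> ball c r"
    have [measurable]: "ball c r \<in> sets lebesgue" by simp
    define I where "I = (\<integral>\<^sup>+y\<in>ball c r. f y \<partial>lebesgue)"
    define B where "B = measure lebesgue (ball c r)"
    define W where "W = measure (wmeasure w) (ball c r)"
    define S where "S = measure (wmeasure s) (ball c r)"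
    have pos: "0 < B" "0 < W" "0 < S"
      using r measure_ball_pos w_ball_pos s_ball_pos by (auto simp: B_def W_def S_def)
    have eB: "emeasure lebesgue (ball c r) = ennreal B"
      unfolding B_def by (rule emeasure_ball_eq)
    have eW: "emeasure (wmeasure w) (ball c r) = ennreal W" and eS: "emeasure (wmeasure s) (ball c r) = ennreal S"
      unfolding W_def S_def using r by (auto intro!: emeasure_w_ball emeasure_s_ball)
    have Is: "(\<integral>\<^sup>+y\<in>ball c r. (f y * ennreal (1 / s y)) \<partial>wmeasure s) = I"
    proof -
      have "(\<integral>\<^sup>+y\<in>ball c r. (f y * ennreal (1 / s y)) \<partial>wmeasure s)
        = (\<integral>\<^sup>+y. ennreal (s y) * (f y * ennreal (1 / s y) * indicator (ball c r) y) \<partial>lebesgue)"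
        by (rule nn_integral_density) measurable
      also have "\<dots> = I" unfolding I_def
      proof (rule nn_integral_cong)
        fix y
        have "ennreal (s y) * ennreal (1 / s y) = 1"
          using s_pos[of y] by (simp add: ennreal_mult'[symmetric])
        then show "ennreal (s y) * (f y * ennreal (1 / s y) * indicator (ball c r) y) = f y * indicator (ball c r) y"
          by (metis mult.assoc mult.commute mult_1)
      qed
      finally show ?thesis .
    qed
    have le_s: "I / ennreal S \<le> maximal (wmeasure s) (\<lambda>z. f z * ennreal (1 / s z)) y" if "y \<in> ball c r" for y
      using ball_average_le_maximal[OF r(1) that, where f = "\<lambda>z. f z * ennreal (1 / s z)" and \<mu> = "wmeasure s"]
      by (simp only: Is eS)
    define J where "J = epow (I / ennreal S) (t - 1)"
    have "J * ennreal B = (\<integral>\<^sup>+y. J * indicator (ball c r) y \<partial>lebesgue)"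
      by (simp add: nn_integral_cmult_indicator eB)
    also have "\<dots> \<le> (\<integral>\<^sup>+y. ennreal (w y) * (?h y * indicator (ball c r) y) \<partial>lebesgue)"
    proof (rule nn_integral_mono)
      fix y
      show "J * indicator (ball c r) y \<le> ennreal (w y) * (?h y * indicator (ball c r) y)"
      proof (cases "y \<in> ball c r")
        case True
        have "J \<le> epow (maximal (wmeasure s) (\<lambda>z. f z * ennreal (1 / s z)) y) (t - 1)"
          unfolding J_def using le_s[OF True] t1 by (intro epow_mono) auto
        also have "\<dots> = ennreal (w y) * ?h y"
        proof -
          have "ennreal (w y) * ennreal (1 / w y) = 1"
            using w_pos[of y] by (simp add: ennreal_mult'[symmetric])
          then show ?thesis by (simp only: mult.left_commute[of "ennreal (w y)"] mult_1_right)
        qed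
        finally show ?thesis using True by simp
      qed simp
    qed
    also have "\<dots> = (\<integral>\<^sup>+y\<in>ball c r. ?h y \<partial>wmeasure w)"
      by (rule nn_integral_density[symmetric]) measurable
    finally have "J * ennreal B / ennreal W \<le> (\<integral>\<^sup>+y\<in>ball c r. ?h y \<partial>wmeasure w) / ennreal W"
      by (rule divide_right_mono_ennreal)
    also have "\<dots> \<le> maximal (wmeasure w) ?h x"
      using ball_average_le_maximal[OF r, where f = ?h and \<mu> = "wmeasure w"] by (simp only: eW)
    finally have JM: "J * ennreal B / ennreal W \<le> maximal (wmeasure w) ?h x" .
    have div: "y / ennreal z = y * ennreal (1 / z)" if "0 < z" for y z
      using that by (simp add: divide_ennreal_def inverse_ennreal inverse_eq_divide)
    have "epow (I / ennreal B) (t - 1) = epow I (t - 1) * ennreal ((1 / B) powr (t - 1))"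
      using pos t1 by (simp add: div epow_mult epow_ennreal)
    \<comment> \<open>The Muckenhoupt condition trades the normalization by \<open>B\<close> for the
      normalizations by \<open>S\<close> and \<open>W\<close> that occur in
      \<open>J * ennreal B / ennreal W\<close>.\<close>
    also have "\<dots> \<le> epow I (t - 1) * ennreal (K * (1 / S) powr (t - 1) * B / W)"
    proof (intro mult_left_mono ennreal_leI)
      have "W * S powr (t - 1) \<le> K * B powr t"
        using A_condition[OF r(1), of c] by (simp only: B_def W_def S_def)
      also have "B powr t = B powr (t - 1) * B" using pos powr_add[of B "t - 1" 1] by simp
      finally show "(1 / B) powr (t - 1) \<le> K * (1 / S) powr (t - 1) * B / W"
        using pos by (simp add: powr_divide field_simps)
    qed simp
    also have "\<dots> = ennreal K * (epow I (t - 1) * ennreal ((1 / S) powr (t - 1)) * ennreal B * ennreal (1 / W))"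
    proof -
      have "ennreal (K * (1 / S) powr (t - 1) * B / W) = ennreal K * ennreal ((1 / S) powr (t - 1)) * ennreal B * ennreal (1 / W)"
        using K pos by (simp add: ennreal_mult'[symmetric])
      then show ?thesis by (simp only: mult_ac)
    qed
    also have "\<dots> = ennreal K * (J * ennreal B / ennreal W)"
      using pos t1 by (simp add: J_def div epow_mult epow_ennreal)
    also have "\<dots> \<le> ennreal K * maximal (wmeasure w) ?h x" using JM by (rule mult_left_mono) simp
    finally show "(\<integral>\<^sup>+y\<in>ball c r. f y \<partial>lebesgue) / emeasure lebesgue (ball c r)
      \<le> epow (ennreal K * maximal (wmeasure w) ?h x) (1 / (t - 1))"
      unfolding epow_le_iff[OF t1] eB I_def .
  qed
  then show ?thesis unfolding epow_le_iff[OF t1] .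
qed

text \<open>Lerner's bound is raised to the power \<open>t'\<close>, which gives the exponent
  \<open>t\<close> on the left as \<open>(t - 1) * t' = t\<close>. The outer operator is bounded at
  the exponent \<open>t'\<close> for \<open>w\<close> and the inner one at \<open>t\<close> for
  \<open>s\<close>, both measures being doubling. The factors \<open>1 / w\<close> and
  \<open>1 / s\<close> change the weight to \<open>s\<close> and back, since
  \<open>w * (1 / w) powr t'\<close> is \<open>s\<close> and \<open>s * (1 / s) powr t\<close> is
  \<open>w\<close>.\<close>

lemma maximal_bounded:
  "\<exists>C::real. 0 < C \<and> (\<forall>f\<in>borel_measurable lebesgue.
    (\<integral>\<^sup>+x. epow (maximal lebesgue f x) t \<partial>wmeasure w) \<le> ennreal C * (\<integral>\<^sup>+x. epow (f x) t \<partial>wmeasure w))"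
proof -
  have t1: "0 < t - 1" using t by simp
  obtain C1 where C1: "0 < C1" "\<And>f. f \<in> borel_measurable lebesgue \<Longrightarrow>
    (\<integral>\<^sup>+x. epow (maximal (wmeasure w) f x) t' \<partial>wmeasure w) \<le> ennreal C1 * (\<integral>\<^sup>+x. epow (f x) t' \<partial>wmeasure w)"
    using maximal_strong_type[OF doubling_w exponents(1)] by blast
  obtain C2 where C2: "0 < C2" "\<And>f. f \<in> borel_measurable lebesgue \<Longrightarrow>
    (\<integral>\<^sup>+x. epow (maximal (wmeasure s) f x) t \<partial>wmeasure s) \<le> ennreal C2 * (\<integral>\<^sup>+x. epow (f x) t \<partial>wmeasure s)"
    using maximal_strong_type[OF doubling_s t(1)] by blast
  have main: "(\<integral>\<^sup>+x. epow (maximal lebesgue f x) t \<partial>wmeasure w)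
    \<le> ennreal (K powr t' * C1 * C2) * (\<integral>\<^sup>+x. epow (f x) t \<partial>wmeasure w)"
    if f [measurable]: "f \<in> borel_measurable lebesgue" for f
  proof -
    let ?g = "\<lambda>z. f z * ennreal (1 / s z)"
    let ?h = "\<lambda>y. epow (maximal (wmeasure s) ?g y) (t - 1) * ennreal (1 / w y)"
    have g [measurable]: "?g \<in> borel_measurable lebesgue" by measurable
    have h [measurable]: "?h \<in> borel_measurable lebesgue" by measurable
    have tt: "epow (epow y (t - 1)) t' = epow y t" for y
      by (simp add: epow_epow exponents(3))
    have t'0: "0 \<le> t'" using exponents(1) by simp
    have "(\<integral>\<^sup>+x. epow (maximal lebesgue f x) t \<partial>wmeasure w)
      \<le> (\<integral>\<^sup>+x. ennreal (K powr t') * epow (maximal (wmeasure w) ?h x) t' \<partial>wmeasure w)"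
    proof (rule nn_integral_mono)
      fix x
      have "epow (maximal lebesgue f x) t \<le> epow (ennreal K * maximal (wmeasure w) ?h x) t'"
        unfolding tt[symmetric] by (intro epow_mono lerner_pointwise f t'0)
      then show "epow (maximal lebesgue f x) t \<le> ennreal (K powr t') * epow (maximal (wmeasure w) ?h x) t'"
        using K t'0 by (simp add: epow_mult epow_ennreal)
    qed
    also have "\<dots> = ennreal (K powr t') * (\<integral>\<^sup>+x. epow (maximal (wmeasure w) ?h x) t' \<partial>wmeasure w)"
      by (rule nn_integral_cmult) measurable
    also have "\<dots> \<le> ennreal (K powr t') * (ennreal C1 * (\<integral>\<^sup>+x. epow (?h x) t' \<partial>wmeasure w))"
      by (intro mult_left_mono C1 h) simp
    also have "(\<integral>\<^sup>+x. epow (?h x) t' \<partial>wmeasure w) = (\<integral>\<^sup>+x. epow (maximal (wmeasure s) ?g x) t \<partial>wmeasure s)"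
    proof -
      have "(\<integral>\<^sup>+x. epow (?h x) t' \<partial>wmeasure w) = (\<integral>\<^sup>+x. ennreal (w x) * epow (?h x) t' \<partial>lebesgue)"
        by (rule nn_integral_density) measurable
      also have "\<dots> = (\<integral>\<^sup>+x. ennreal (s x) * epow (maximal (wmeasure s) ?g x) t \<partial>lebesgue)"
      proof (rule nn_integral_cong)
        fix x
        have "w x * (1 / w x) powr t' = s x"
          using w_pos[of x] by (simp add: s_eq powr_diff powr_divide)
        then have wt: "ennreal (w x) * ennreal ((1 / w x) powr t') = ennreal (s x)"
          using w_pos[of x] by (simp add: ennreal_mult'[symmetric])
        moreover
        have "epow (?h x) t' = epow (maximal (wmeasure s) ?g x) t * ennreal ((1 / w x) powr t')"
          using w_pos[of x] t'0 by (simp add: epow_mult tt epow_ennreal)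
        ultimately show "ennreal (w x) * epow (?h x) t' = ennreal (s x) * epow (maximal (wmeasure s) ?g x) t"
          by (simp only: wt[symmetric] mult.assoc mult.commute[of "epow (maximal (wmeasure s) ?g x) t"])
      qed
      also have "\<dots> = (\<integral>\<^sup>+x. epow (maximal (wmeasure s) ?g x) t \<partial>wmeasure s)"
        by (rule nn_integral_density[symmetric]) measurable
      finally show ?thesis .
    qed
    also have "ennreal (K powr t') * (ennreal C1 * (\<integral>\<^sup>+x. epow (maximal (wmeasure s) ?g x) t \<partial>wmeasure s))
      \<le> ennreal (K powr t') * (ennreal C1 * (ennreal C2 * (\<integral>\<^sup>+x. epow (?g x) t \<partial>wmeasure s)))"
      by (intro mult_left_mono C2 g) simp_all
    also have "(\<integral>\<^sup>+x. epow (?g x) t \<partial>wmeasure s) = (\<integral>\<^sup>+x. epow (f x) t \<partial>wmeasure w)"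
    proof -
      have "(\<integral>\<^sup>+x. epow (?g x) t \<partial>wmeasure s) = (\<integral>\<^sup>+x. ennreal (s x) * epow (?g x) t \<partial>lebesgue)"
        by (rule nn_integral_density) measurable
      also have "\<dots> = (\<integral>\<^sup>+x. ennreal (w x) * epow (f x) t \<partial>lebesgue)"
      proof (rule nn_integral_cong)
        fix x
        have "s x * (1 / s x) powr t = w x"
          using s_pos[of x] w_eq[of x] by (simp add: powr_diff powr_divide)
        then have "ennreal (s x) * ennreal ((1 / s x) powr t) = ennreal (w x)"
          using s_pos[of x] by (simp add: ennreal_mult'[symmetric])
        moreover have "epow (?g x) t = epow (f x) t * ennreal ((1 / s x) powr t)"
          using s_pos[of x] t by (simp add: epow_mult epow_ennreal)
        ultimately show "ennreal (s x) * epow (?g x) t = ennreal (w x) * epow (f x) t"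
          by (simp only: mult.commute[of "epow _ _"] mult.assoc[symmetric])
      qed
      also have "\<dots> = (\<integral>\<^sup>+x. epow (f x) t \<partial>wmeasure w)"
        by (rule nn_integral_density[symmetric]) measurable
      finally show ?thesis .
    qed
    also have "ennreal (K powr t') * (ennreal C1 * (ennreal C2 * (\<integral>\<^sup>+x. epow (f x) t \<partial>wmeasure w)))
      = ennreal (K powr t' * C1 * C2) * (\<integral>\<^sup>+x. epow (f x) t \<partial>wmeasure w)"
      using C1(1) C2(1) by (simp add: ennreal_mult mult.assoc)
    finally show ?thesis .
  qed
  show ?thesis
    using K C1(1) C2(1) main by (intro exI[of _ "K powr t' * C1 * C2"] conjI ballI) auto
qed

end

section \<open>The Rubio de Francia algorithm\<close>

lemma maximal_suminf_le:
  fixes g :: "nat \<Rightarrow> 'a::euclidean_space \<Rightarrow> ennreal"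
  assumes g [measurable]: "\<And>k. g k \<in> borel_measurable lebesgue"
  shows "maximal lebesgue (\<lambda>x. \<Sum>k. c k * g k x) x \<le> (\<Sum>k. c k * maximal lebesgue (g k) x)"
  unfolding maximal_le_iff
proof (intro allI impI)
  fix a and r :: real assume r: "0 < r" "x \<in> ball a r"
  have [measurable]: "ball a r \<in> sets lebesgue" by simp
  have "(\<integral>\<^sup>+y\<in>ball a r. (\<Sum>k. c k * g k y) \<partial>lebesgue)
      = (\<integral>\<^sup>+y. (\<Sum>k. c k * (g k y * indicator (ball a r) y)) \<partial>lebesgue)"
    unfolding ennreal_suminf_multc[symmetric] by (simp only: mult.assoc)
  also have "\<dots> = (\<Sum>k. \<integral>\<^sup>+y. c k * (g k y * indicator (ball a r) y) \<partial>lebesgue)"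
    by (rule nn_integral_suminf) measurable
  also have "\<dots> = (\<Sum>k. c k * (\<integral>\<^sup>+y\<in>ball a r. g k y \<partial>lebesgue))"
    by (intro suminf_cong nn_integral_cmult) measurable
  finally have "(\<integral>\<^sup>+y\<in>ball a r. (\<Sum>k. c k * g k y) \<partial>lebesgue) / emeasure lebesgue (ball a r)
    = (\<Sum>k. c k * ((\<integral>\<^sup>+y\<in>ball a r. g k y \<partial>lebesgue) / emeasure lebesgue (ball a r)))"
    by (simp only: ennreal_suminf_divide[symmetric] ennreal_times_divide)
  also have "\<dots> \<le> (\<Sum>k. c k * maximal lebesgue (g k) x)"
    by (intro suminf_le mult_left_mono ball_average_le_maximal r) auto
  finally show "(\<integral>\<^sup>+y\<in>ball a r. (\<Sum>k. c k * g k y) \<partial>lebesgue) / emeasure lebesgue (ball a r)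
    \<le> (\<Sum>k. c k * maximal lebesgue (g k) x)" .
qed

lemma suminf_half_powers_le:
  fixes y :: "nat \<Rightarrow> ennreal"
  assumes "\<And>k. y k \<le> Z"
  shows "(\<Sum>k. ennreal ((1 / 2) ^ k) * y k) \<le> 2 * Z"
proof -
  have "(\<Sum>k. ennreal ((1 / 2) ^ k) * y k) \<le> (\<Sum>k. ennreal ((1 / 2) ^ k) * Z)"
    by (intro suminf_le mult_left_mono assms) auto
  also have "\<dots> = (\<Sum>k. ennreal ((1 / 2) ^ k)) * Z" by (rule ennreal_suminf_multc)
  also have "(\<Sum>k. ennreal ((1 / 2) ^ k)) = ennreal (\<Sum>k. (1 / 2) ^ k)"
    by (intro suminf_ennreal2 summable_geometric) auto
  also have "(\<Sum>k. (1 / 2) ^ k) = (2::real)" by (subst suminf_geometric) auto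
  finally show ?thesis by simp
qed

text \<open>Comparison with the supremum of \<open>y\<close> replaces Minkowski's inequality, at the cost of a
  factor that geometric decay of \<open>y\<close> absorbs.\<close>

lemma epow_suminf_half_powers_le:
  fixes y :: "nat \<Rightarrow> ennreal"
  assumes t: "0 < t"
  shows "epow (\<Sum>k. ennreal ((1 / 2) ^ k) * y k) t \<le> ennreal (2 powr t) * (\<Sum>k. epow (y k) t)"
proof -
  have "y k \<le> epow (\<Sum>j. epow (y j) t) (1 / t)" for k
  proof -
    have "(\<Sum>j\<in>{k}. epow (y j) t) \<le> (\<Sum>j. epow (y j) t)"
      by (intro sum_le_suminf) auto
    then show ?thesis unfolding epow_le_iff[OF t, symmetric] by simp
  qed
  then have "(\<Sum>k. ennreal ((1 / 2) ^ k) * y k) \<le> 2 * epow (\<Sum>j. epow (y j) t) (1 / t)"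
    by (rule suminf_half_powers_le)
  then have "epow (\<Sum>k. ennreal ((1 / 2) ^ k) * y k) t \<le> epow (ennreal 2 * epow (\<Sum>j. epow (y j) t) (1 / t)) t"
    using t by (intro epow_mono) auto
  also have "\<dots> = ennreal (2 powr t) * (\<Sum>k. epow (y k) t)"
    using t by (subst epow_mult) (auto simp: epow_epow epow_ennreal simp del: ennreal_numeral)
  finally show ?thesis .
qed

text \<open>The majorant is a series of iterates of the maximal operator at \<open>H\<close> with
  geometric coefficients. Its first term is \<open>H\<close>, and applying the operator shifts the
  series by one term at the cost of the factor \<open>4 * A\<close>. Since \<open>A powr t\<close>
  is the constant of the operator bound, the coefficients outweigh the growth of the
  iterates.\<close>

lemma rubio_de_francia:
  fixes \<mu> :: "'a::euclidean_space measure"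
  assumes sets [measurable_cong]: "sets \<mu> = sets lebesgue" and t: "0 < t"
    and bounded: "\<exists>C::real. 0 < C \<and> (\<forall>f\<in>borel_measurable lebesgue.
      (\<integral>\<^sup>+x. epow (maximal lebesgue f x) t \<partial>\<mu>) \<le> ennreal C * (\<integral>\<^sup>+x. epow (f x) t \<partial>\<mu>))"
    and H: "H \<in> borel_measurable lebesgue" "(\<integral>\<^sup>+x. epow (H x) t \<partial>\<mu>) < \<infinity>"
  shows "\<exists>v\<in>borel_measurable lebesgue. (\<forall>x. H x \<le> v x) \<and> (\<integral>\<^sup>+x. epow (v x) t \<partial>\<mu>) < \<infinity> \<and>
    (\<exists>A>0. \<forall>x. maximal lebesgue v x \<le> ennreal A * v x)"
proof -
  obtain C where C: "0 < C" "\<And>f. f \<in> borel_measurable lebesgue \<Longrightarrow>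
    (\<integral>\<^sup>+x. epow (maximal lebesgue f x) t \<partial>\<mu>) \<le> ennreal C * (\<integral>\<^sup>+x. epow (f x) t \<partial>\<mu>)"
    using bounded by blast
  define A where "A = C powr (1 / t)"
  have A: "0 < A" "A powr t = C" using C t by (auto simp: A_def powr_powr)
  define g where "g k = ((maximal lebesgue) ^^ k) H" for k
  have g0: "g 0 = H" and gS: "g (Suc k) = maximal lebesgue (g k)" for k by (simp_all add: g_def)
  have gm: "g k \<in> borel_measurable lebesgue" for k
    by (cases k) (simp_all only: g0 gS H borel_measurable_maximal_lebesgue)
  have gm' [measurable]: "g k \<in> borel_measurable \<mu>" for k
    using gm by (simp add: measurable_cong_sets[OF sets refl])
  have gint: "(\<integral>\<^sup>+x. epow (g k x) t \<partial>\<mu>) \<le> ennreal (C ^ k) * (\<integral>\<^sup>+x. epow (H x) t \<partial>\<mu>)" for k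
  proof (induction k)
    case (Suc k)
    have "(\<integral>\<^sup>+x. epow (g (Suc k) x) t \<partial>\<mu>) \<le> ennreal C * (\<integral>\<^sup>+x. epow (g k x) t \<partial>\<mu>)"
      unfolding gS by (rule C(2)[OF gm])
    also have "\<dots> \<le> ennreal C * (ennreal (C ^ k) * (\<integral>\<^sup>+x. epow (H x) t \<partial>\<mu>))"
      by (intro mult_left_mono Suc) simp
    finally show ?case using C(1) by (simp add: ennreal_mult mult.assoc)
  qed (simp add: g0)
  \<comment> \<open>The ratio \<open>1 / (4 * A)\<close> in \<open>v\<close> is split: a factor one
    half is spent on \<open>epow_suminf_half_powers_le\<close>, and the remaining
    \<open>1 / (2 * A)\<close> makes the integrals of \<open>epow (y k x) t\<close> decay
    geometrically.\<close>
  define y where "y k x = ennreal ((1 / (2 * A)) ^ k) * g k x" for k x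
  define v where "v x = (\<Sum>k. ennreal ((1 / (4 * A)) ^ k) * g k x)" for x
  have v_eq: "v x = (\<Sum>k. ennreal ((1 / 2) ^ k) * y k x)" for x
    unfolding v_def y_def mult.assoc[symmetric] using A(1)
    by (intro suminf_cong arg_cong2[where f="(*)"] refl)
      (simp add: ennreal_mult[symmetric] power_mult_distrib[symmetric])
  have vm: "v \<in> borel_measurable lebesgue"
    unfolding v_def using gm by measurable
  have "H x \<le> v x" for x
  proof -
    have "(\<Sum>k\<in>{0}. ennreal ((1 / (4 * A)) ^ k) * g k x) \<le> v x"
      unfolding v_def by (intro sum_le_suminf) auto
    then show ?thesis by (simp add: g0)
  qed
  moreover have "(\<integral>\<^sup>+x. epow (v x) t \<partial>\<mu>) < \<infinity>"
  proof -
    let ?I = "\<integral>\<^sup>+x. epow (H x) t \<partial>\<mu>"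
    have "(\<integral>\<^sup>+x. epow (v x) t \<partial>\<mu>) \<le> (\<integral>\<^sup>+x. ennreal (2 powr t) * (\<Sum>k. epow (y k x) t) \<partial>\<mu>)"
      unfolding v_eq by (intro nn_integral_mono epow_suminf_half_powers_le t)
    also have "\<dots> = ennreal (2 powr t) * (\<Sum>k. \<integral>\<^sup>+x. epow (y k x) t \<partial>\<mu>)"
      unfolding y_def by (subst nn_integral_cmult, measurable, subst nn_integral_suminf, measurable)
    also have "\<dots> \<le> ennreal (2 powr t) * (\<Sum>k. ennreal ((1 / 2 powr t) ^ k) * ?I)"
    proof (intro mult_left_mono suminf_le)
      fix k
      have "(\<integral>\<^sup>+x. epow (y k x) t \<partial>\<mu>) = (\<integral>\<^sup>+x. ennreal ((1 / (2 powr t * C)) ^ k) * epow (g k x) t \<partial>\<mu>)"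
      proof (rule nn_integral_cong)
        fix x
        have "((1 / (2 * A)) ^ k) powr t = ((1 / (2 * A)) powr t) ^ k"
          using A(1) by (simp add: powr_realpow[symmetric] powr_powr mult.commute)
        also have "\<dots> = (1 / (2 powr t * C)) ^ k" using A by (simp add: powr_divide powr_mult)
        finally show "epow (y k x) t = ennreal ((1 / (2 powr t * C)) ^ k) * epow (g k x) t"
          using t A(1) by (simp add: y_def epow_mult epow_ennreal)
      qed
      also have "\<dots> = ennreal ((1 / (2 powr t * C)) ^ k) * (\<integral>\<^sup>+x. epow (g k x) t \<partial>\<mu>)"
        by (rule nn_integral_cmult) measurable
      also have "\<dots> \<le> ennreal ((1 / (2 powr t * C)) ^ k) * (ennreal (C ^ k) * ?I)"
        by (intro mult_left_mono gint) simp
      also have "\<dots> = ennreal ((1 / (2 powr t * C)) ^ k * C ^ k) * ?I"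
        using C(1) by (subst ennreal_mult) (auto simp: mult.assoc)
      also have "(1 / (2 powr t * C)) ^ k * C ^ k = (1 / 2 powr t) ^ k"
        using C(1) by (simp add: power_mult_distrib[symmetric])
      finally show "(\<integral>\<^sup>+x. epow (y k x) t \<partial>\<mu>) \<le> ennreal ((1 / 2 powr t) ^ k) * ?I" .
    qed auto
    also have "(\<Sum>k. ennreal ((1 / 2 powr t) ^ k) * ?I) = (\<Sum>k. ennreal ((1 / 2 powr t) ^ k)) * ?I"
      by (rule ennreal_suminf_multc)
    also have "ennreal (2 powr t) * ((\<Sum>k. ennreal ((1 / 2 powr t) ^ k)) * ?I) < \<infinity>"
    proof -
      have "(\<Sum>k. ennreal ((1 / 2 powr t) ^ k)) \<noteq> top"
        using t by (intro ennreal_suminf_neq_top summable_geometric) auto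
      then show ?thesis using H(2) by (simp add: ennreal_mult_less_top less_top)
    qed
    finally show ?thesis .
  qed
  moreover have "maximal lebesgue v x \<le> ennreal (4 * A) * v x" for x
  proof -
    have "maximal lebesgue v x \<le> (\<Sum>k. ennreal ((1 / (4 * A)) ^ k) * g (Suc k) x)"
      unfolding v_def gS by (rule maximal_suminf_le[OF gm])
    also have "\<dots> = (\<Sum>k. ennreal (4 * A) * (ennreal ((1 / (4 * A)) ^ Suc k) * g (Suc k) x))"
    proof (rule suminf_cong)
      fix k
      have "(1 / (4 * A)) ^ k = 4 * A * (1 / (4 * A)) ^ Suc k" using A(1) by simp
      then have "ennreal ((1 / (4 * A)) ^ k) = ennreal (4 * A) * ennreal ((1 / (4 * A)) ^ Suc k)"
        using A(1) by (metis ennreal_mult less_imp_le mult_pos_pos zero_le_divide_1_iff zero_le_power zero_less_numeral)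
      then show "ennreal ((1 / (4 * A)) ^ k) * g (Suc k) x
        = ennreal (4 * A) * (ennreal ((1 / (4 * A)) ^ Suc k) * g (Suc k) x)"
        by (simp only: mult.assoc)
    qed
    also have "\<dots> = ennreal (4 * A) * (\<Sum>k. ennreal ((1 / (4 * A)) ^ Suc k) * g (Suc k) x)"
      by (rule ennreal_suminf_cmult)
    also have "\<dots> \<le> ennreal (4 * A) * v x"
    proof (intro mult_left_mono)
      show "(\<Sum>k. ennreal ((1 / (4 * A)) ^ Suc k) * g (Suc k) x) \<le> v x"
        unfolding v_def
        using suminf_offset[of "\<lambda>k. ennreal ((1 / (4 * A)) ^ k) * g k x" 1] by simp
    qed simp
    finally show ?thesis .
  qed
  ultimately show ?thesis
    using A(1) vm by (intro bexI[of _ v] conjI exI[of _ "4 * A"]) auto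
qed

section \<open>Products of powers of \<open>A\<^sub>1\<close> weights\<close>

lemma average_mono_AE:
  "AE x in lebesgue. x \<in> B \<longrightarrow> f x \<le> g x \<Longrightarrow> average B f \<le> average B g"
  unfolding average_def
  by (intro divide_right_mono_ennreal nn_integral_mono_AE) (auto simp: indicator_def elim!: eventually_mono)

lemma average_cong_AE:
  assumes "AE x in lebesgue. f x = g x"
  shows "average B f = average B g"
proof (rule antisym)
  show "average B f \<le> average B g" "average B g \<le> average B f"
    using assms by (auto intro!: average_mono_AE elim!: eventually_mono)
qed

lemma average_cmult:
  assumes [measurable]: "f \<in> borel_measurable lebesgue" "B \<in> sets lebesgue"
  shows "average B (\<lambda>x. k * f x) = k * average B f"
  unfolding average_def by (simp add: mult.assoc nn_integral_cmult ennreal_times_divide)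

lemma average_add:
  assumes [measurable]: "f \<in> borel_measurable lebesgue" "g \<in> borel_measurable lebesgue" "B \<in> sets lebesgue"
  shows "average B (\<lambda>x. f x + g x) = average B f + average B g"
  unfolding average_def by (simp add: distrib_right nn_integral_add add_divide_distrib_ennreal)

lemma average_ball_const:
  assumes "0 < r"
  shows "average (ball c r) (\<lambda>x. k) = k"
proof -
  have "emeasure lebesgue (ball c r) \<noteq> 0" "emeasure lebesgue (ball c r) \<noteq> top"
    using measure_ball_pos[OF assms, of c] by (auto simp: emeasure_ball_eq)
  then show ?thesis
    unfolding average_def by (simp add: nn_integral_cmult_indicator ennreal_mult_divide_eq)
qed

lemma average_ball_affine:
  assumes f: "f \<in> borel_measurable lebesgue" and "0 < r"
  shows "average (ball c r) (\<lambda>x. j + k * f x) = j + k * average (ball c r) f"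
proof -
  have B: "ball c r \<in> sets lebesgue" by simp
  have "(\<lambda>x. k * f x) \<in> borel_measurable lebesgue" using f by measurable
  from average_add[OF _ this B, of "\<lambda>x. j"] show ?thesis
    by (simp only: average_cmult[OF f B] average_ball_const[OF assms(2)] borel_measurable_const)
qed

lemma nn_integral_ball_eq_average:
  assumes "0 < r"
  shows "(\<integral>\<^sup>+x\<in>ball c r. f x \<partial>lebesgue) = average (ball c r) f * emeasure lebesgue (ball c r)"
proof -
  have "emeasure lebesgue (ball c r) \<noteq> 0" "emeasure lebesgue (ball c r) \<noteq> top"
    using measure_ball_pos[OF assms, of c] by (auto simp: emeasure_ball_eq)
  then show ?thesis
    unfolding average_def by (simp add: ennreal_divide_times less_top)
qed

lemma powr_le_tangent:
  fixes x :: real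
  assumes "0 < x" "0 \<le> a" "a \<le> 1"
  shows "x powr a \<le> (1 - a) + a * x"
  using Youngs_inequality_0[of a "1 - a" x 1] assms by simp

lemma powr_minus_ge_tangent:
  fixes x :: real
  assumes "0 < x" "0 \<le> a"
  shows "1 + a \<le> x powr - a + a * x"
proof -
  have "1 - a * (x - 1) \<le> 1 + - a * ln x"
    using mult_left_mono[OF ln_le_minus_one[OF assms(1)] assms(2)] by simp
  also have "\<dots> \<le> exp (- a * ln x)" by (rule exp_ge_add_one_self)
  also have "\<dots> = x powr - a" using assms by (simp add: powr_def)
  finally show ?thesis by (simp add: algebra_simps)
qed

lemma ennreal_le_affine:
  assumes "a \<le> b + k * y" "0 \<le> b" "0 \<le> k" "0 \<le> y"
  shows "ennreal a \<le> ennreal b + ennreal k * ennreal y"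
proof -
  have "ennreal a \<le> ennreal (b + k * y)" using assms by (intro ennreal_leI)
  also have "\<dots> = ennreal b + ennreal k * ennreal y"
    using assms by (simp add: ennreal_mult)
  finally show ?thesis .
qed

text \<open>Jensen's inequality for a concave power, by averaging its tangent line at the mean
  \<open>m\<close>.\<close>

lemma average_powr_le:
  assumes [measurable]: "u \<in> borel_measurable lebesgue"
    and u: "\<And>x. 0 < u x" and r: "0 < r" and a: "0 \<le> a" "a \<le> 1"
    and m: "0 < m" "average (ball c r) (\<lambda>x. ennreal (u x)) = ennreal m"
  shows "average (ball c r) (\<lambda>x. ennreal (u x powr a)) \<le> ennreal (m powr a)"
proof -
  have "u x powr a \<le> m powr a * (1 - a) + (m powr a * a / m) * u x" for x
  proof -
    have "u x powr a = m powr a * (u x / m) powr a" using u[of x] m(1) by (simp add: powr_divide)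
    also have "\<dots> \<le> m powr a * ((1 - a) + a * (u x / m))"
      using u[of x] m(1) a by (intro mult_left_mono powr_le_tangent) auto
    finally show ?thesis by (simp add: algebra_simps)
  qed
  note tangent = this
  have "average (ball c r) (\<lambda>x. ennreal (u x powr a))
    \<le> average (ball c r) (\<lambda>x. ennreal (m powr a * (1 - a)) + ennreal (m powr a * a / m) * ennreal (u x))"
    using m(1) a u
    by (intro average_mono_AE AE_I2 impI ennreal_le_affine[OF tangent]) (simp_all add: less_imp_le)
  also have "\<dots> = ennreal (m powr a * (1 - a)) + ennreal (m powr a * a / m) * ennreal m"
    unfolding m(2)[symmetric] by (rule average_ball_affine[OF _ r]) measurable
  also have "\<dots> = ennreal (m powr a)"
  proof -
    have "ennreal (m powr a * a / m) * ennreal m = ennreal (m powr a * a)"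
      using m(1) a by (subst ennreal_mult[symmetric]) auto
    moreover have "m powr a = m powr a * (1 - a) + m powr a * a" by (simp add: algebra_simps)
    ultimately show ?thesis
      using a by (metis diff_ge_0_iff_ge ennreal_plus mult_nonneg_nonneg powr_ge_zero)
  qed
  finally show ?thesis .
qed

text \<open>Jensen's inequality for a convex power. The linear term of the tangent line is kept on
  the side of the average and cancelled at the end, since subtraction in \<open>ennreal\<close> is
  truncated.\<close>

lemma average_powr_minus_ge:
  assumes [measurable]: "v \<in> borel_measurable lebesgue"
    and v: "\<And>x. 0 < v x" and r: "0 < r" and a: "0 \<le> a"
    and m: "0 < m" "average (ball c r) (\<lambda>x. ennreal (v x)) = ennreal m"
  shows "ennreal (m powr - a) \<le> average (ball c r) (\<lambda>x. ennreal (v x powr - a))"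
proof -
  have "m powr - a * (1 + a) \<le> v x powr - a + (m powr - a * a / m) * v x" for x
  proof -
    have "m powr - a * (1 + a) \<le> m powr - a * ((v x / m) powr - a + a * (v x / m))"
      using v[of x] m(1) a by (intro mult_left_mono powr_minus_ge_tangent) auto
    moreover have "v x powr - a = m powr - a * (v x / m) powr - a"
      using v[of x] m(1) by (simp add: powr_divide)
    ultimately show ?thesis by (simp add: algebra_simps)
  qed
  note tangent = this
  have "average (ball c r) (\<lambda>x. ennreal (m powr - a * (1 + a)))
    \<le> average (ball c r) (\<lambda>x. ennreal (v x powr - a) + ennreal (m powr - a * a / m) * ennreal (v x))"
    using m(1) a v
    by (intro average_mono_AE AE_I2 impI ennreal_le_affine[OF tangent]) (simp_all add: less_imp_le)
  also have "\<dots> = average (ball c r) (\<lambda>x. ennreal (v x powr - a)) + ennreal (m powr - a * a / m) * ennreal m"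
  proof -
    have vm: "(\<lambda>x. ennreal (v x)) \<in> borel_measurable lebesgue"
      "(\<lambda>x. ennreal (v x powr - a)) \<in> borel_measurable lebesgue"
      "(\<lambda>x. ennreal (m powr - a * a / m) * ennreal (v x)) \<in> borel_measurable lebesgue"
      by measurable
    have B: "ball c r \<in> sets lebesgue" by simp
    show ?thesis
      unfolding average_add[OF vm(2,3) B] average_cmult[OF vm(1) B] m(2) by (rule refl)
  qed
  also have "ennreal (m powr - a * a / m) * ennreal m = ennreal (m powr - a * a)"
    using m(1) a by (subst ennreal_mult[symmetric]) auto
  also have "average (ball c r) (\<lambda>x. ennreal (m powr - a * (1 + a))) = ennreal (m powr - a) + ennreal (m powr - a * a)"
    unfolding average_ball_const[OF r] distrib_left using a by (subst ennreal_plus[symmetric]) auto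
  finally have "ennreal (m powr - a) + ennreal (m powr - a * a)
    \<le> average (ball c r) (\<lambda>x. ennreal (v x powr - a)) + ennreal (m powr - a * a)" .
  then show ?thesis
    using ennreal_add_left_cancel_le[of "ennreal (m powr - a * a)"] by (simp add: add.commute)
qed

section \<open>\<open>A\<^sub>1\<close> weights and products of their powers\<close>

definition A1_weight :: "real \<Rightarrow> (real ^ 'n \<Rightarrow> real) \<Rightarrow> bool" where
  "A1_weight A v \<longleftrightarrow> v \<in> borel_measurable lebesgue \<and> (\<forall>x. 0 < v x) \<and> 0 < A \<and>
     (\<forall>c r. 0 < r \<longrightarrow> (\<exists>m>0. average (ball c r) (\<lambda>x. ennreal (v x)) = ennreal m \<and>
        (AE x in lebesgue. x \<in> ball c r \<longrightarrow> m \<le> A * v x)))"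

text \<open>Balls about the origin suffice, because every compact set lies in one of them.\<close>

lemma weightI:
  fixes W :: "real ^ 'n \<Rightarrow> real"
  assumes [measurable]: "W \<in> borel_measurable lebesgue" and W: "\<And>x. 0 \<le> W x"
    and fin: "\<And>r. 0 < r \<Longrightarrow> average (ball 0 r) (\<lambda>x. ennreal (W x)) < \<infinity>"
  shows "weight W"
  unfolding weight_def
proof (intro conjI allI impI W)
  fix K :: "(real ^ 'n) set" assume K: "compact K"
  then obtain r where r: "0 < r" "K \<subseteq> ball 0 r"
    by (meson bounded_subset_ballD compact_imp_bounded)
  have Km [measurable]: "K \<in> sets lebesgue"
    using K by (simp add: borel_compact)
  have "(\<integral>\<^sup>+x. ennreal (norm (indicator K x *\<^sub>R W x)) \<partial>lebesgue) \<le> (\<integral>\<^sup>+x\<in>ball 0 r. ennreal (W x) \<partial>lebesgue)"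
    using r(2) W by (intro nn_integral_mono) (auto simp: indicator_def)
  also have "\<dots> < \<infinity>"
    unfolding nn_integral_ball_eq_average[OF r(1)]
    using fin[OF r(1)] by (simp add: ennreal_mult_less_top emeasure_ball_eq)
  finally have "(\<integral>\<^sup>+x. ennreal (norm (indicator K x *\<^sub>R W x)) \<partial>lebesgue) < \<infinity>" .
  then show "W absolutely_integrable_on K"
    unfolding set_integrable_def by (intro integrableI_bounded) measurable
qed

lemma average_cmult_real:
  assumes "f \<in> borel_measurable lebesgue" "0 \<le> k" "\<And>x. 0 \<le> f x"
  shows "average (ball c r) (\<lambda>x. ennreal (k * f x)) = ennreal k * average (ball c r) (\<lambda>x. ennreal (f x))"
proof -
  have "(\<lambda>x. ennreal (k * f x)) = (\<lambda>x. ennreal k * ennreal (f x))"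
    using assms by (simp add: ennreal_mult)
  moreover have "(\<lambda>x. ennreal (f x)) \<in> borel_measurable lebesgue" using assms(1) by measurable
  ultimately show ?thesis by (simp only: average_cmult[of _ "ball c r"]) (simp add: average_cmult)
qed

text \<open>The easy direction of Jones factorization, refined by a reverse Hoelder exponent:
  \<open>v powr - g\<close> is responsible for the Muckenhoupt class \<open>g + 1\<close>, and
  \<open>u powr a\<close> for the reverse Hoelder class \<open>1 / a\<close>.\<close>

locale A1_product =
  fixes u v :: "real ^ 'n \<Rightarrow> real" and A D a g :: real
  assumes u: "A1_weight A u" and v: "A1_weight D v"
    and a: "0 \<le> a" "a \<le> 1" and g: "0 \<le> g"
begin

definition W :: "real ^ 'n \<Rightarrow> real" where
  "W x = u x powr a * v x powr - g"

lemma um [measurable]: "u \<in> borel_measurable lebesgue" and vm [measurable]: "v \<in> borel_measurable lebesgue"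
  and u_pos: "0 < u x" and v_pos: "0 < v x" and A: "0 < A" and D: "0 < D"
  using u v by (auto simp: A1_weight_def)

lemma W_measurable [measurable]: "W \<in> borel_measurable lebesgue"
  unfolding W_def by measurable

lemma W_pos: "0 < W x"
  using u_pos[of x] v_pos[of x] by (simp add: W_def)

text \<open>On a ball an \<open>A\<^sub>1\<close> weight is bounded below by a multiple of its mean.
  For \<open>v\<close> this bounds the negative power, hence \<open>W\<close>, from above; for
  \<open>u\<close> it bounds \<open>W\<close> from below. The remaining factor is averaged by
  Jensen's inequality in each case.\<close>

lemma ball_estimates:
  assumes r: "0 < r"
  obtains m n where "0 < m" "0 < n"
    "average (ball c r) (\<lambda>x. ennreal (u x)) = ennreal m"
    "average (ball c r) (\<lambda>x. ennreal (v x)) = ennreal n"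
    "AE x in lebesgue. x \<in> ball c r \<longrightarrow> m \<le> A * u x"
    "AE x in lebesgue. x \<in> ball c r \<longrightarrow> n \<le> D * v x"
    "average (ball c r) (\<lambda>x. ennreal (W x)) \<le> ennreal ((D / n) powr g * m powr a)"
    "ennreal ((m / A) powr a * n powr - g) \<le> average (ball c r) (\<lambda>x. ennreal (W x))"
proof -
  obtain m where m: "0 < m" "average (ball c r) (\<lambda>x. ennreal (u x)) = ennreal m"
      "AE x in lebesgue. x \<in> ball c r \<longrightarrow> m \<le> A * u x"
    using u r unfolding A1_weight_def by blast
  obtain n where n: "0 < n" "average (ball c r) (\<lambda>x. ennreal (v x)) = ennreal n"
      "AE x in lebesgue. x \<in> ball c r \<longrightarrow> n \<le> D * v x"
    using v r unfolding A1_weight_def by blast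
  have "average (ball c r) (\<lambda>x. ennreal (W x)) \<le> average (ball c r) (\<lambda>x. ennreal ((D / n) powr g * u x powr a))"
  proof (rule average_mono_AE, use n(3) in eventually_elim, intro impI ennreal_leI)
    fix x assume "x \<in> ball c r \<longrightarrow> n \<le> D * v x" "x \<in> ball c r"
    then have "n / D \<le> v x" using D by (simp add: field_simps)
    then have "v x powr - g \<le> (n / D) powr - g"
      using D n(1) g by (intro powr_mono2') auto
    also have "\<dots> = (D / n) powr g" using D n(1) by (simp add: powr_minus_divide powr_divide)
    finally show "W x \<le> (D / n) powr g * u x powr a"
      unfolding W_def by (simp add: mult.commute mult_left_mono)
  qed
  also have "\<dots> = ennreal ((D / n) powr g) * average (ball c r) (\<lambda>x. ennreal (u x powr a))"
    by (rule average_cmult_real) auto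
  also have "\<dots> \<le> ennreal ((D / n) powr g) * ennreal (m powr a)"
    by (intro mult_left_mono average_powr_le um u_pos r a m) auto
  also have "\<dots> = ennreal ((D / n) powr g * m powr a)" by (simp add: ennreal_mult)
  finally have up: "average (ball c r) (\<lambda>x. ennreal (W x)) \<le> ennreal ((D / n) powr g * m powr a)" .
  have "ennreal ((m / A) powr a * n powr - g) = ennreal ((m / A) powr a) * ennreal (n powr - g)"
    by (simp add: ennreal_mult)
  also have "\<dots> \<le> ennreal ((m / A) powr a) * average (ball c r) (\<lambda>x. ennreal (v x powr - g))"
    by (intro mult_left_mono average_powr_minus_ge vm v_pos r g n) auto
  also have "\<dots> = average (ball c r) (\<lambda>x. ennreal ((m / A) powr a * v x powr - g))"
    by (rule average_cmult_real[symmetric]) auto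
  also have "\<dots> \<le> average (ball c r) (\<lambda>x. ennreal (W x))"
  proof (rule average_mono_AE, use m(3) in eventually_elim, intro impI ennreal_leI)
    fix x assume "x \<in> ball c r \<longrightarrow> m \<le> A * u x" "x \<in> ball c r"
    then have "m / A \<le> u x" using A by (simp add: field_simps)
    then show "(m / A) powr a * v x powr - g \<le> W x"
      unfolding W_def using A m(1) a by (intro mult_right_mono powr_mono2) auto
  qed
  finally show ?thesis using up m n that by blast
qed

lemma weight_W: "weight W"
proof (rule weightI[OF W_measurable less_imp_le[OF W_pos]])
  fix r :: real assume r: "0 < r"
  obtain m n where "average (ball 0 r) (\<lambda>x. ennreal (W x)) \<le> ennreal ((D / n) powr g * m powr a)"
    by (rule ball_estimates[OF r, of 0])
  then show "average (ball 0 r) (\<lambda>x. ennreal (W x)) < \<infinity>"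
    by (rule order_le_less_trans) simp
qed

text \<open>The dual power of \<open>W\<close> is \<open>u powr (- (a / g)) * v\<close>. Here
  \<open>u\<close> is bounded below and \<open>v\<close> is averaged, so that the means
  \<open>m\<close> and \<open>n\<close> cancel against those in the upper bound for
  \<open>W\<close>. For \<open>g = 0\<close> there is no dual power, and the pointwise
  \<open>A\<^sub>1\<close> condition is inherited from \<open>u\<close>.\<close>

lemma W_in_A_class: "W \<in> A_class (g + 1)"
proof (cases "g = 0")
  case True
  have "AE x in lebesgue. x \<in> ball c r \<longrightarrow>
    average (ball c r) (\<lambda>y. ennreal (W y)) \<le> ennreal (A powr a) * ennreal (W x)" if r: "0 < r" for c r
  proof -
    obtain m n where m: "0 < m" "AE x in lebesgue. x \<in> ball c r \<longrightarrow> m \<le> A * u x"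
      and n: "0 < n" and up: "average (ball c r) (\<lambda>x. ennreal (W x)) \<le> ennreal ((D / n) powr g * m powr a)"
      by (rule ball_estimates[OF r, of c])
    show ?thesis
    proof (use m(2) in eventually_elim, intro impI)
      fix x assume "x \<in> ball c r \<longrightarrow> m \<le> A * u x" "x \<in> ball c r"
      then have "m powr a \<le> (A * u x) powr a" using m(1) a by (intro powr_mono2) auto
      also have "\<dots> = A powr a * W x"
        unfolding W_def using True A u_pos[of x] v_pos[of x] by (simp add: powr_mult)
      finally have "ennreal (m powr a) \<le> ennreal (A powr a) * ennreal (W x)"
        using W_pos[of x] by (simp add: ennreal_mult[symmetric] ennreal_leI)
      then show "average (ball c r) (\<lambda>y. ennreal (W y)) \<le> ennreal (A powr a) * ennreal (W x)"
        using up True n D by simp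
    qed
  qed
  then show ?thesis
    unfolding A_class_def using True weight_W by auto
next
  case False
  then have g0: "0 < g" using g by simp
  have "average (ball c r) (\<lambda>y. ennreal (W y)) *
      epow (average (ball c r) (\<lambda>y. epow (ennreal (W y)) (1 - (g + 1) / g))) g
    \<le> ennreal (D powr g * A powr a)" if r: "0 < r" for c r
  proof -
    obtain m n where m: "0 < m" "AE x in lebesgue. x \<in> ball c r \<longrightarrow> m \<le> A * u x"
      and n: "0 < n" "average (ball c r) (\<lambda>x. ennreal (v x)) = ennreal n"
      and up: "average (ball c r) (\<lambda>x. ennreal (W x)) \<le> ennreal ((D / n) powr g * m powr a)"
      by (rule ball_estimates[OF r, of c])
    have "average (ball c r) (\<lambda>y. epow (ennreal (W y)) (1 - (g + 1) / g))
      \<le> average (ball c r) (\<lambda>x. ennreal ((A / m) powr (a / g) * v x))"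
    proof (rule average_mono_AE, use m(2) in eventually_elim, intro impI)
      fix x assume "x \<in> ball c r \<longrightarrow> m \<le> A * u x" "x \<in> ball c r"
      then have le: "m / A \<le> u x" using A by (simp add: field_simps)
      have "W x powr (- 1 / g) = u x powr (- (a / g)) * v x"
        using u_pos[of x] v_pos[of x] g0 by (simp add: W_def powr_mult powr_powr)
      also have "\<dots> \<le> (m / A) powr (- (a / g)) * v x"
        using le A m(1) a g0 v_pos[of x] by (intro mult_right_mono powr_mono2') auto
      also have "(m / A) powr (- (a / g)) = (A / m) powr (a / g)"
        using A m(1) by (simp add: powr_minus_divide powr_divide)
      finally have "ennreal (W x powr (- 1 / g)) \<le> ennreal ((A / m) powr (a / g) * v x)"
        by (rule ennreal_leI)
      moreover have "1 - (g + 1) / g = - 1 / g" using g0 by (simp add: field_simps)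
      ultimately show "epow (ennreal (W x)) (1 - (g + 1) / g) \<le> ennreal ((A / m) powr (a / g) * v x)"
        using W_pos[of x] by (simp add: epow_ennreal)
    qed
    also have "\<dots> = ennreal ((A / m) powr (a / g)) * average (ball c r) (\<lambda>x. ennreal (v x))"
      using v_pos by (intro average_cmult_real vm) (auto simp: less_imp_le)
    also have "\<dots> = ennreal ((A / m) powr (a / g) * n)"
      using n by (simp add: ennreal_mult)
    finally have "epow (average (ball c r) (\<lambda>y. epow (ennreal (W y)) (1 - (g + 1) / g))) g
      \<le> epow (ennreal ((A / m) powr (a / g) * n)) g"
      using g by (rule epow_mono)
    also have "\<dots> = ennreal ((A / m) powr a * n powr g)"
      using A m(1) n(1) g0 by (simp add: epow_ennreal powr_mult powr_powr)
    finally have "average (ball c r) (\<lambda>y. ennreal (W y)) *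
        epow (average (ball c r) (\<lambda>y. epow (ennreal (W y)) (1 - (g + 1) / g))) g
      \<le> ennreal ((D / n) powr g * m powr a) * ennreal ((A / m) powr a * n powr g)"
      by (intro mult_mono up) auto
    also have "\<dots> = ennreal (D powr g * A powr a)"
      using A D m(1) n(1) by (simp add: ennreal_mult[symmetric] powr_divide)
    finally show ?thesis .
  qed
  then show ?thesis
    unfolding A_class_def using False weight_W by auto
qed

text \<open>For \<open>a\<close> strictly between 0 and 1, \<open>W powr (1 / a)\<close> is
  \<open>u\<close> times a negative power of \<open>v\<close>; the lower bound for \<open>v\<close>
  and the mean of \<open>u\<close> control its average. For \<open>a = 0\<close> only the power of
  \<open>v\<close> remains and the bound is pointwise, as the class with exponent \<infinity>
  demands; for \<open>a = 1\<close> the class consists of all weights.\<close>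

lemma W_in_RH_class: "W \<in> RH_class (if a = 0 then \<infinity> else ennreal (1 / a))"
proof -
  consider "a = 1" | "a = 0" | "0 < a" "a < 1" using a by linarith
  then show ?thesis
  proof cases
    case 1
    then show ?thesis unfolding RH_class_def using weight_W by simp
  next
    case 2
    have "AE x in lebesgue. x \<in> ball c r \<longrightarrow>
      ennreal (W x) \<le> ennreal (D powr g) * average (ball c r) (\<lambda>y. ennreal (W y))" if r: "0 < r" for c r
    proof -
      obtain m n where m: "0 < m" and n: "0 < n" "AE x in lebesgue. x \<in> ball c r \<longrightarrow> n \<le> D * v x"
        and lo: "ennreal ((m / A) powr a * n powr - g) \<le> average (ball c r) (\<lambda>x. ennreal (W x))"
        by (rule ball_estimates[OF r, of c])
      show ?thesis
      proof (use n(2) in eventually_elim, intro impI)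
        fix x assume "x \<in> ball c r \<longrightarrow> n \<le> D * v x" "x \<in> ball c r"
        then have "n / D \<le> v x" using D by (simp add: field_simps)
        then have "W x \<le> (n / D) powr - g"
          unfolding W_def using 2 D n(1) g u_pos[of x] v_pos[of x] by (simp add: powr_mono2')
        also have "\<dots> = D powr g * n powr - g"
          using D n(1) by (simp add: powr_minus_divide powr_divide)
        finally have "ennreal (W x) \<le> ennreal (D powr g) * ennreal (n powr - g)"
          by (simp add: ennreal_mult[symmetric] ennreal_leI)
        also have "ennreal (n powr - g) \<le> average (ball c r) (\<lambda>y. ennreal (W y))"
          using lo 2 A m by simp
        finally show "ennreal (W x) \<le> ennreal (D powr g) * average (ball c r) (\<lambda>y. ennreal (W y))"
          by (simp add: mult_left_mono)
      qed
    qed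
    then show ?thesis
      unfolding RH_class_def using 2 weight_W by auto
  next
    case 3
    have "epow (average (ball c r) (\<lambda>y. epow (ennreal (W y)) (1 / a))) a
      \<le> ennreal (D powr g * A powr a) * average (ball c r) (\<lambda>y. ennreal (W y))" if r: "0 < r" for c r
    proof -
      obtain m n where m: "0 < m" "average (ball c r) (\<lambda>x. ennreal (u x)) = ennreal m"
        and n: "0 < n" "AE x in lebesgue. x \<in> ball c r \<longrightarrow> n \<le> D * v x"
        and lo: "ennreal ((m / A) powr a * n powr - g) \<le> average (ball c r) (\<lambda>x. ennreal (W x))"
        by (rule ball_estimates[OF r, of c])
      have "average (ball c r) (\<lambda>y. epow (ennreal (W y)) (1 / a))
        \<le> average (ball c r) (\<lambda>x. ennreal ((D / n) powr (g / a) * u x))"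
      proof (rule average_mono_AE, use n(2) in eventually_elim, intro impI)
        fix x assume "x \<in> ball c r \<longrightarrow> n \<le> D * v x" "x \<in> ball c r"
        then have le: "n / D \<le> v x" using D by (simp add: field_simps)
        have "W x powr (1 / a) = v x powr (- (g / a)) * u x"
          using u_pos[of x] v_pos[of x] 3 by (simp add: W_def powr_mult powr_powr)
        also have "\<dots> \<le> (n / D) powr (- (g / a)) * u x"
          using le D n(1) g 3 u_pos[of x] by (intro mult_right_mono powr_mono2') auto
        also have "(n / D) powr (- (g / a)) = (D / n) powr (g / a)"
          using D n(1) by (simp add: powr_minus_divide powr_divide)
        finally have "ennreal (W x powr (1 / a)) \<le> ennreal ((D / n) powr (g / a) * u x)"
          by (rule ennreal_leI)
        then show "epow (ennreal (W x)) (1 / a) \<le> ennreal ((D / n) powr (g / a) * u x)"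
          using W_pos[of x] by (simp add: epow_ennreal)
      qed
      also have "\<dots> = ennreal ((D / n) powr (g / a)) * average (ball c r) (\<lambda>x. ennreal (u x))"
        using u_pos by (intro average_cmult_real um) (auto simp: less_imp_le)
      also have "\<dots> = ennreal ((D / n) powr (g / a) * m)"
        using m by (simp add: ennreal_mult)
      finally have "epow (average (ball c r) (\<lambda>y. epow (ennreal (W y)) (1 / a))) a
        \<le> epow (ennreal ((D / n) powr (g / a) * m)) a"
        using a(1) by (rule epow_mono)
      also have "\<dots> = ennreal ((D / n) powr g * m powr a)"
        using D m(1) n(1) 3 by (simp add: epow_ennreal powr_mult powr_powr)
      also have "\<dots> = ennreal (D powr g * A powr a) * ennreal ((m / A) powr a * n powr - g)"
        using A D m(1) n(1) by (simp add: ennreal_mult[symmetric] powr_divide powr_minus_divide)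
      also have "\<dots> \<le> ennreal (D powr g * A powr a) * average (ball c r) (\<lambda>y. ennreal (W y))"
        using lo by (rule mult_left_mono) simp
      finally show ?thesis .
    qed
    moreover have "ennreal (1 / a) \<noteq> 1" "enn2real (ennreal (1 / a)) = 1 / a"
      using 3 by (simp_all add: ennreal_eq_1)
    ultimately show ?thesis
      unfolding RH_class_def using 3 weight_W by auto
  qed
qed

end

section \<open>From the weight at \<open>q\<close> to a pair of \<open>A\<^sub>1\<close> weights\<close>

lemma AE_ball_ex:
  assumes "0 < r" "AE x in lebesgue. x \<in> ball c r \<longrightarrow> P x"
  shows "\<exists>x\<in>ball c r. P x"
proof (rule ccontr)
  assume "\<not> ?thesis"
  with assms(2) have "AE x in lebesgue. x \<notin> ball c r" by (auto elim!: eventually_mono)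
  then have "ball c r \<in> null_sets lebesgue"
    by (subst (asm) AE_iff_null_sets[symmetric]) auto
  then show False
    using measure_ball_pos[OF assms(1), of c] by (simp add: null_sets_def measure_def)
qed

lemma average_ball_pos:
  assumes [measurable]: "f \<in> borel_measurable lebesgue" and r: "0 < r"
    and pos: "AE x in lebesgue. 0 < f x"
  shows "0 < average (ball c r) f"
proof -
  have [measurable]: "ball c r \<in> sets lebesgue" by simp
  have "(\<integral>\<^sup>+x\<in>ball c r. f x \<partial>lebesgue) \<noteq> 0"
  proof
    assume "(\<integral>\<^sup>+x\<in>ball c r. f x \<partial>lebesgue) = 0"
    then have "AE x in lebesgue. f x * indicator (ball c r) x = 0"
      by (subst (asm) nn_integral_0_iff_AE) measurable
    then have "AE x in lebesgue. x \<in> ball c r \<longrightarrow> False"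
      using pos by eventually_elim auto
    from AE_ball_ex[OF r this] show False by auto
  qed
  then show ?thesis
    unfolding average_def by (simp add: ennreal_zero_less_divide emeasure_ball_eq zero_less_iff_neq_zero)
qed

text \<open>If the maximal function vanishes at one point, \<open>f\<close> vanishes almost
  everywhere on each ball about that point, and these balls exhaust the space.\<close>

lemma maximal_pos:
  assumes [measurable]: "f \<in> borel_measurable lebesgue" and "\<not> (AE x in lebesgue. f x = 0)"
  shows "0 < maximal lebesgue f x"
proof (rule ccontr)
  assume "\<not> 0 < maximal lebesgue f x"
  then have 0: "maximal lebesgue f x = 0" by (simp add: zero_less_iff_neq_zero)
  have "AE y in lebesgue. y \<in> ball x (real (Suc n)) \<longrightarrow> f y = 0" for n
  proof -
    have [measurable]: "ball x (real (Suc n)) \<in> sets lebesgue" by simp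
    have "(\<integral>\<^sup>+y\<in>ball x (real (Suc n)). f y \<partial>lebesgue) / emeasure lebesgue (ball x (real (Suc n))) \<le> maximal lebesgue f x"
      by (intro ball_average_le_maximal) auto
    then have "(\<integral>\<^sup>+y\<in>ball x (real (Suc n)). f y \<partial>lebesgue) = 0"
      unfolding 0 by (simp add: emeasure_ball_eq del: of_nat_Suc)
    then have "AE y in lebesgue. f y * indicator (ball x (real (Suc n))) y = 0"
      by (subst (asm) nn_integral_0_iff_AE) measurable
    then show ?thesis by (auto elim!: eventually_mono)
  qed
  then have "AE y in lebesgue. \<forall>n. y \<in> ball x (real (Suc n)) \<longrightarrow> f y = 0"
    unfolding AE_all_countable by blast
  then have "AE y in lebesgue. f y = 0"
  proof eventually_elim
    fix y assume *: "\<forall>n. y \<in> ball x (real (Suc n)) \<longrightarrow> f y = 0"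
    obtain n where "dist x y < real n" using reals_Archimedean2 by blast
    then have "y \<in> ball x (real (Suc n))" by simp
    then show "f y = 0" using * by blast
  qed
  then show False using assms(2) by simp
qed

text \<open>On the null set where \<open>v\<close> is infinite its value is replaced by 1, which no
  average notices. Positivity everywhere comes from \<open>maximal_pos\<close>; the average over a
  ball is finite because the ball contains a point where \<open>v\<close> is finite.\<close>

lemma A1_weight_of_maximal:
  fixes v :: "real ^ 'n \<Rightarrow> ennreal"
  assumes v [measurable]: "v \<in> borel_measurable lebesgue" and A: "0 < A"
    and max: "\<And>x. maximal lebesgue v x \<le> ennreal A * v x"
    and fin: "AE x in lebesgue. v x < \<infinity>" and nz: "\<not> (AE x in lebesgue. v x = 0)"
  shows "\<exists>v'. A1_weight A v' \<and> (AE x in lebesgue. ennreal (v' x) = v x)"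
proof -
  define v' where "v' x = (if v x < \<infinity> then enn2real (v x) else 1)" for x
  have v_pos: "0 < v x" for x
  proof (rule ccontr)
    assume "\<not> 0 < v x"
    then have "v x = 0" by (simp add: zero_less_iff_neq_zero)
    then show False using max[of x] maximal_pos[OF v nz, of x] by simp
  qed
  have v'_pos: "0 < v' x" for x
    using v_pos[of x] by (auto simp: v'_def enn2real_positive_iff)
  have v'm [measurable]: "v' \<in> borel_measurable lebesgue"
    unfolding v'_def by measurable
  have eq: "AE x in lebesgue. ennreal (v' x) = v x"
    using fin by eventually_elim (simp add: v'_def)
  have "\<exists>m>0. average (ball c r) (\<lambda>x. ennreal (v' x)) = ennreal m \<and>
      (AE x in lebesgue. x \<in> ball c r \<longrightarrow> m \<le> A * v' x)" if r: "0 < r" for c r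
  proof -
    have av: "average (ball c r) (\<lambda>x. ennreal (v' x)) = average (ball c r) v"
      by (rule average_cong_AE[OF eq])
    have le: "average (ball c r) v \<le> ennreal A * v x" if "x \<in> ball c r" for x
      using ball_average_le_maximal[OF r that, where f = v and \<mu> = lebesgue] max[of x]
      unfolding average_def by (rule order_trans)
    have "AE x in lebesgue. x \<in> ball c r \<longrightarrow> v x < \<infinity>"
      using fin by eventually_elim simp
    from AE_ball_ex[OF r this] obtain x where "x \<in> ball c r" "v x < \<infinity>" by (rule bexE)
    then have "average (ball c r) v < \<infinity>"
      using le[of x] by (auto simp: ennreal_mult_less_top elim!: order_le_less_trans)
    moreover have "0 < average (ball c r) v"
      using v_pos by (intro average_ball_pos r v) auto
    ultimately obtain m where m: "0 < m" "average (ball c r) v = ennreal m"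
      by (cases "average (ball c r) v" rule: ennreal_trichotomy) auto
    have "AE x in lebesgue. x \<in> ball c r \<longrightarrow> m \<le> A * v' x"
    proof (use eq in eventually_elim, intro impI)
      fix x assume "ennreal (v' x) = v x" "x \<in> ball c r"
      then have "ennreal m \<le> ennreal (A * v' x)"
        using le[of x] m A v'_pos[of x] by (simp add: ennreal_mult)
      then show "m \<le> A * v' x" using A v'_pos[of x] by (simp add: less_imp_le)
    qed
    then show ?thesis using m av by auto
  qed
  then have "A1_weight A v'"
    unfolding A1_weight_def using v'm v'_pos A by blast
  with eq show ?thesis by blast
qed

section \<open>Regularity of weights and the power that absorbs the reverse Hoelder
  condition\<close>

lemma weight_integrable:
  fixes w :: "real ^ 'n \<Rightarrow> real"
  assumes "weight w" "compact K"
  shows "integrable lebesgue (\<lambda>x. indicator K x *\<^sub>R w x)"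
proof -
  have "w absolutely_integrable_on K" using assms by (simp add: weight_def)
  then show ?thesis by (simp only: set_integrable_def)
qed

text \<open>A weight is the pointwise limit of its integrable restrictions to growing balls.\<close>

lemma weight_measurable:
  fixes w :: "real ^ 'n \<Rightarrow> real"
  assumes "weight w"
  shows "w \<in> borel_measurable lebesgue"
proof (rule borel_measurable_LIMSEQ_real)
  show "(\<lambda>n. indicator (cball 0 (real n)) x *\<^sub>R w x) \<longlonglongrightarrow> w x" for x
  proof (rule tendsto_eventually)
    obtain n where "norm x \<le> real n" using real_arch_simple by blast
    then show "\<forall>\<^sub>F n in sequentially. indicator (cball 0 (real n)) x *\<^sub>R w x = w x"
      by (intro eventually_sequentiallyI[of n]) (auto simp: indicator_def)
  qed
  show "(\<lambda>x. indicator (cball 0 (real n)) x *\<^sub>R w x) \<in> borel_measurable lebesgue" for n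
    by (intro borel_measurable_integrable weight_integrable assms compact_cball)
qed

lemma weight_average_finite:
  fixes w :: "real ^ 'n \<Rightarrow> real"
  assumes "weight w" and r: "0 < r"
  shows "average (ball c r) (\<lambda>x. ennreal (w x)) < \<infinity>"
proof -
  have "integrable lebesgue (\<lambda>x. indicator (cball c r) x *\<^sub>R w x)"
    by (intro weight_integrable assms compact_cball)
  then have "(\<integral>\<^sup>+x. ennreal (norm (indicator (cball c r) x *\<^sub>R w x)) \<partial>lebesgue) < \<infinity>"
    by (simp add: integrable_iff_bounded)
  moreover have "(\<integral>\<^sup>+x\<in>ball c r. ennreal (w x) \<partial>lebesgue)
    \<le> (\<integral>\<^sup>+x. ennreal (norm (indicator (cball c r) x *\<^sub>R w x)) \<partial>lebesgue)"
    using assms by (intro nn_integral_mono) (auto simp: indicator_def weight_def)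
  ultimately have "(\<integral>\<^sup>+x\<in>ball c r. ennreal (w x) \<partial>lebesgue) < \<infinity>" by simp
  then have "average (ball c r) (\<lambda>x. ennreal (w x)) \<noteq> top"
    unfolding average_def using measure_ball_pos[OF r, of c]
    by (auto simp: ennreal_divide_eq_top_iff emeasure_ball_eq)
  then show ?thesis by (simp add: less_top)
qed

text \<open>Where \<open>w\<close> vanishes its negative power is \<infinity>, so a finite dual
  average on a ball excludes a zero set of positive measure there. That average is finite once
  \<open>w\<close> is not null on the ball. On a ball where \<open>w\<close> is null the product is
  0 and the condition is silent, hence the passage to large balls.\<close>

lemma A_class_pos:
  fixes w :: "real ^ 'n \<Rightarrow> real"
  assumes w: "w \<in> A_class t" and t: "1 < t" and nz: "\<not> (AE x in lebesgue. w x = 0)"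
  shows "AE x in lebesgue. 0 < w x"
proof -
  have weight: "weight w" using w by (simp add: A_class_def)
  have w0: "0 \<le> w x" for x using weight by (simp add: weight_def)
  note [measurable] = weight_measurable[OF weight]
  obtain C where C: "\<And>c r. 0 < r \<Longrightarrow> average (ball c r) (\<lambda>y. ennreal (w y)) *
      epow (average (ball c r) (\<lambda>y. epow (ennreal (w y)) (1 - t / (t - 1)))) (t - 1) \<le> ennreal C"
    using w t unfolding A_class_def by auto
  have neg: "1 - t / (t - 1) < 0" using t by (simp add: field_simps)
  have le: "AE x in lebesgue. x \<in> ball 0 (real (Suc n)) \<longrightarrow> 0 < w x"
    if n: "\<not> (AE x in lebesgue. x \<in> ball 0 (real (Suc n)) \<longrightarrow> w x = 0)" for n
  proof -
    let ?B = "ball 0 (real (Suc n)) :: (real ^ 'n) set"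
    have [measurable]: "?B \<in> sets lebesgue" by simp
    have "average ?B (\<lambda>y. ennreal (w y)) \<noteq> 0"
    proof
      assume "average ?B (\<lambda>y. ennreal (w y)) = 0"
      then have "(\<integral>\<^sup>+y\<in>?B. ennreal (w y) \<partial>lebesgue) = 0"
        unfolding average_def by (simp add: emeasure_ball_eq del: of_nat_Suc)
      then have "AE y in lebesgue. ennreal (w y) * indicator ?B y = 0"
        by (subst (asm) nn_integral_0_iff_AE) measurable
      then have "AE y in lebesgue. y \<in> ?B \<longrightarrow> w y = 0"
      proof eventually_elim
        fix y assume "ennreal (w y) * indicator ?B y = 0"
        then show "y \<in> ?B \<longrightarrow> w y = 0" using w0[of y] by (auto simp: indicator_def ennreal_eq_0_iff)
      qed
      then show False using n by simp
    qed
    moreover have "average ?B (\<lambda>y. ennreal (w y)) *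
      epow (average ?B (\<lambda>y. epow (ennreal (w y)) (1 - t / (t - 1)))) (t - 1) < top"
      using C[of "real (Suc n)" 0] by (rule order_le_less_trans) auto
    ultimately have "average ?B (\<lambda>y. epow (ennreal (w y)) (1 - t / (t - 1))) \<noteq> top"
      using t by (auto simp: ennreal_mult_top)
    then have "(\<integral>\<^sup>+y. epow (ennreal (w y)) (1 - t / (t - 1)) * indicator ?B y \<partial>lebesgue) \<noteq> top"
      unfolding average_def by (auto simp: ennreal_divide_eq_top_iff emeasure_ball_eq simp del: of_nat_Suc)
    then have "AE y in lebesgue. epow (ennreal (w y)) (1 - t / (t - 1)) * indicator ?B y \<noteq> \<infinity>"
      by (intro nn_integral_noteq_infinite) (auto simp del: of_nat_Suc)
    then show ?thesis
    proof eventually_elim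
      fix y assume "epow (ennreal (w y)) (1 - t / (t - 1)) * indicator ?B y \<noteq> \<infinity>"
      then show "y \<in> ?B \<longrightarrow> 0 < w y"
        using w0[of y] neg by (auto simp: epow_def indicator_def less_le)
    qed
  qed
  have mono: "AE x in lebesgue. x \<in> ball 0 (real (Suc m)) \<longrightarrow> w x = 0"
    if "m \<le> n" "AE x in lebesgue. x \<in> ball 0 (real (Suc n)) \<longrightarrow> w x = 0" for m n
    using that(2)
  proof eventually_elim
    fix x assume "x \<in> ball 0 (real (Suc n)) \<longrightarrow> w x = 0"
    then show "x \<in> ball 0 (real (Suc m)) \<longrightarrow> w x = 0" using that(1) by auto
  qed
  have ex: "\<exists>n. norm x < real (Suc n)" for x :: "real ^ 'n"
    using reals_Archimedean2[of "norm x"] by (metis less_trans of_nat_Suc less_add_one add.commute)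
  obtain N where N: "\<not> (AE x in lebesgue. x \<in> ball 0 (real (Suc N)) \<longrightarrow> w x = 0)"
  proof (rule ccontr)
    assume "\<not> thesis"
    then have "AE x in lebesgue. \<forall>n. x \<in> ball 0 (real (Suc n)) \<longrightarrow> w x = 0"
      using that unfolding AE_all_countable by blast
    then have "AE x in lebesgue. w x = 0"
    proof eventually_elim
      fix x assume "\<forall>n. x \<in> ball 0 (real (Suc n)) \<longrightarrow> w x = 0"
      then show "w x = 0" using ex[of x] by auto
    qed
    then show False using nz by simp
  qed
  have "AE x in lebesgue. x \<in> ball 0 (real (Suc (max N n))) \<longrightarrow> 0 < w x" for n
    using mono[of N "max N n"] N by (intro le) auto
  then have "AE x in lebesgue. \<forall>n. x \<in> ball 0 (real (Suc (max N n))) \<longrightarrow> 0 < w x"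
    unfolding AE_all_countable by blast
  then show ?thesis
  proof eventually_elim
    fix x assume *: "\<forall>n. x \<in> ball 0 (real (Suc (max N n))) \<longrightarrow> 0 < w x"
    obtain n where "norm x < real (Suc n)" using ex by blast
    then have "x \<in> ball 0 (real (Suc (max N n)))" by simp
    then show "0 < w x" using * by blast
  qed
qed

lemma emeasure_wmeasure_ball:
  fixes c :: "real ^ 'n"
  assumes [measurable]: "f \<in> borel_measurable lebesgue" and r: "0 < r"
  shows "emeasure (wmeasure f) (ball c r) = average (ball c r) (\<lambda>x. ennreal (f x)) * emeasure lebesgue (ball c r)"
proof -
  have "emeasure (wmeasure f) (ball c r) = (\<integral>\<^sup>+x\<in>ball c r. ennreal (f x) \<partial>lebesgue)"
    by (rule emeasure_density) auto
  then show ?thesis by (simp only: nn_integral_ball_eq_average[OF r])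
qed

text \<open>One half of the characterization of the intersection of a Muckenhoupt and a reverse
  Hoelder class by the power \<open>w powr s\<close>. Since \<open>s * (1 - tau')\<close> equals
  \<open>1 - t / (t - 1)\<close>, the dual weights of \<open>om\<close> and of \<open>w\<close>
  agree almost everywhere: the Muckenhoupt condition for \<open>w\<close> controls the averages of
  \<open>sig\<close>, and the reverse Hoelder inequality those of \<open>om\<close>.\<close>

lemma muckenhoupt_pair_powr:
  fixes w :: "real ^ 'n \<Rightarrow> real"
  assumes w: "w \<in> A_class t" and t: "1 < t" and s: "1 \<le> s" and nz: "\<not> (AE x in lebesgue. w x = 0)"
    and RH: "\<exists>C::real. \<forall>c r. 0 < r \<longrightarrow> epow (average (ball c r) (\<lambda>y. epow (ennreal (w y)) s)) (1 / s)
        \<le> ennreal C * average (ball c r) (\<lambda>y. ennreal (w y))"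
    and om: "\<And>x. om x = (if 0 < w x then w x powr s else 1)"
    and tau: "tau = s * (t - 1) + 1" "tau' = tau / (tau - 1)"
    and sig: "\<And>x. sig x = om x powr (1 - tau')"
  shows "\<exists>K. muckenhoupt_pair om sig tau tau' K"
proof -
  have weight: "weight w" using w by (simp add: A_class_def)
  note wm [measurable] = weight_measurable[OF weight]
  have pos: "AE x in lebesgue. 0 < w x" by (rule A_class_pos[OF w t nz])
  obtain C0 where C0: "\<And>c r. 0 < r \<Longrightarrow> average (ball c r) (\<lambda>y. ennreal (w y)) *
      epow (average (ball c r) (\<lambda>y. epow (ennreal (w y)) (1 - t / (t - 1)))) (t - 1) \<le> ennreal C0"
    using w t unfolding A_class_def by auto
  obtain D0 where D0: "\<And>c r. 0 < r \<Longrightarrow> epow (average (ball c r) (\<lambda>y. epow (ennreal (w y)) s)) (1 / s)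
        \<le> ennreal D0 * average (ball c r) (\<lambda>y. ennreal (w y))"
    using RH by blast
  \<comment> \<open>The constants in the definitions of the classes are arbitrary reals; the maxima
    make them positive.\<close>
  define C where "C = max C0 1"
  define D where "D = max D0 1"
  have CD: "0 < C" "0 < D" "C0 \<le> C" "D0 \<le> D" by (auto simp: C_def D_def)
  have tau1: "tau - 1 = s * (t - 1)" "0 < s * (t - 1)" using tau s t by auto
  then have "1 < tau" by linarith
  have om_pos: "0 < om x" for x using om[of x] by auto
  have omm [measurable]: "om \<in> borel_measurable lebesgue"
  proof -
    have "om = (\<lambda>x. if 0 < w x then w x powr s else 1)" using om by (simp add: fun_eq_iff)
    moreover have "(\<lambda>x. if 0 < w x then w x powr s else 1) \<in> borel_measurable lebesgue" by measurable
    ultimately show ?thesis by simp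
  qed
  have sigm [measurable]: "sig \<in> borel_measurable lebesgue"
  proof -
    have "sig = (\<lambda>x. om x powr (1 - tau'))" using sig by (simp add: fun_eq_iff)
    moreover have "(\<lambda>x. om x powr (1 - tau')) \<in> borel_measurable lebesgue" by measurable
    ultimately show ?thesis by simp
  qed
  have tt: "1 - tau' = - 1 / (s * (t - 1))" "1 - t / (t - 1) = - 1 / (t - 1)"
  proof -
    have "1 - tau' = - 1 / (tau - 1)" using tau(2) \<open>1 < tau\<close> by (simp add: field_simps)
    then show "1 - tau' = - 1 / (s * (t - 1))" by (simp only: tau1)
    show "1 - t / (t - 1) = - 1 / (t - 1)" using t by (simp add: field_simps)
  qed
  have est: "\<exists>a b M. 0 < a \<and> 0 \<le> b \<and> 0 \<le> M \<and>
      average (ball c r) (\<lambda>x. ennreal (om x)) = ennreal M \<and>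
      average (ball c r) (\<lambda>x. ennreal (sig x)) = ennreal b \<and>
      M powr (1 / s) \<le> D * a \<and> a * b powr (t - 1) \<le> C" if r: "0 < r" for c r
  proof -
    have omav: "average (ball c r) (\<lambda>x. ennreal (om x)) = average (ball c r) (\<lambda>y. epow (ennreal (w y)) s)"
      by (rule average_cong_AE, use pos in eventually_elim) (auto simp: om epow_ennreal)
    have sigav: "average (ball c r) (\<lambda>x. ennreal (sig x)) = average (ball c r) (\<lambda>y. epow (ennreal (w y)) (1 - t / (t - 1)))"
    proof (rule average_cong_AE, use pos in eventually_elim)
      fix x assume "0 < w x"
      then show "ennreal (sig x) = epow (ennreal (w x)) (1 - t / (t - 1))"
        using s t by (simp add: sig om epow_ennreal powr_powr tt)
    qed
    have "0 < average (ball c r) (\<lambda>y. ennreal (w y))"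
      by (rule average_ball_pos[OF _ r]) (use pos in auto)
    moreover have "average (ball c r) (\<lambda>y. ennreal (w y)) < top"
      using weight_average_finite[OF weight r] by simp
    ultimately obtain a where a: "0 < a" "average (ball c r) (\<lambda>y. ennreal (w y)) = ennreal a"
      by (cases "average (ball c r) (\<lambda>y. ennreal (w y))" rule: ennreal_trichotomy) auto
    have omle: "epow (average (ball c r) (\<lambda>x. ennreal (om x))) (1 / s) \<le> ennreal (D * a)"
    proof -
      have "epow (average (ball c r) (\<lambda>x. ennreal (om x))) (1 / s) \<le> ennreal D0 * ennreal a"
        using D0[OF r, of c] by (simp only: omav a(2))
      also have "\<dots> \<le> ennreal D * ennreal a" using CD by (intro mult_right_mono ennreal_leI) auto
      finally show ?thesis using CD a by (simp add: ennreal_mult)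
    qed
    have sigle: "ennreal a * epow (average (ball c r) (\<lambda>x. ennreal (sig x))) (t - 1) \<le> ennreal C"
    proof -
      have "ennreal a * epow (average (ball c r) (\<lambda>x. ennreal (sig x))) (t - 1) \<le> ennreal C0"
        using C0[OF r, of c] by (simp only: sigav a(2))
      also have "\<dots> \<le> ennreal C" using CD by (intro ennreal_leI) auto
      finally show ?thesis .
    qed
    have "average (ball c r) (\<lambda>x. ennreal (om x)) \<noteq> top"
      using omle s by (auto simp: top_unique)
    then obtain M where M: "0 \<le> M" "average (ball c r) (\<lambda>x. ennreal (om x)) = ennreal M"
      by (cases "average (ball c r) (\<lambda>x. ennreal (om x))") auto
    have "average (ball c r) (\<lambda>x. ennreal (sig x)) \<noteq> top"
      using sigle t a(1) by (auto simp: top_unique ennreal_mult_top)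
    then obtain b where b: "0 \<le> b" "average (ball c r) (\<lambda>x. ennreal (sig x)) = ennreal b"
      by (cases "average (ball c r) (\<lambda>x. ennreal (sig x))") auto
    have "M powr (1 / s) \<le> D * a"
      using omle M s CD a by (simp add: epow_ennreal)
    moreover have "a * b powr (t - 1) \<le> C"
      using sigle b t CD a by (simp add: epow_ennreal ennreal_mult[symmetric])
    ultimately show ?thesis using a M b by blast
  qed
  have fin: "emeasure (wmeasure om) (ball c r) < \<infinity>" "emeasure (wmeasure sig) (ball c r) < \<infinity>"
    if r: "0 < r" for c r
    using est[OF r, of c] r
    by (auto simp: emeasure_wmeasure_ball emeasure_ball_eq ennreal_mult[symmetric])
  show ?thesis
  proof (intro exI[of _ "D powr s * C powr s"] muckenhoupt_pair.intro omm sigm fin)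
    show "1 < tau" by fact
    show "tau' = tau / (tau - 1)" by fact
    show "0 < om x" for x by (rule om_pos)
    show "sig x = om x powr (1 - tau')" for x by (rule sig)
    show "0 < D powr s * C powr s" using CD by simp
    show "measure (wmeasure om) (ball c r) * measure (wmeasure sig) (ball c r) powr (tau - 1)
      \<le> D powr s * C powr s * measure lebesgue (ball c r) powr tau" if r: "0 < r" for c r
    proof -
      obtain a b M where e: "0 < a" "0 \<le> b" "0 \<le> M"
        "average (ball c r) (\<lambda>x. ennreal (om x)) = ennreal M"
        "average (ball c r) (\<lambda>x. ennreal (sig x)) = ennreal b"
        "M powr (1 / s) \<le> D * a" "a * b powr (t - 1) \<le> C"
        using est[OF r, of c] by blast
      define B where "B = measure lebesgue (ball c r)"
      have B: "0 < B" "emeasure lebesgue (ball c r) = ennreal B"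
        unfolding B_def by (rule measure_ball_pos[OF r] emeasure_ball_eq)+
      have mo: "measure (wmeasure om) (ball c r) = M * B"
        unfolding measure_def emeasure_wmeasure_ball[OF omm r] e B using e B by (simp add: ennreal_mult[symmetric])
      have ms: "measure (wmeasure sig) (ball c r) = b * B"
        unfolding measure_def emeasure_wmeasure_ball[OF sigm r] e B using e B by (simp add: ennreal_mult[symmetric])
      have "M = (M powr (1 / s)) powr s" using e s by (simp add: powr_powr)
      also have "\<dots> \<le> (D * a) powr s" using e s by (intro powr_mono2) auto
      finally have "M * b powr (s * (t - 1)) \<le> (D * a) powr s * b powr (s * (t - 1))"
        by (rule mult_right_mono) simp
      also have "\<dots> = D powr s * (a * b powr (t - 1)) powr s"
        using CD e by (simp add: powr_mult powr_powr mult.commute[of s])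
      also have "\<dots> \<le> D powr s * C powr s"
        using e s by (intro mult_left_mono powr_mono2) auto
      finally have *: "M * b powr (s * (t - 1)) \<le> D powr s * C powr s" .
      have "M * B * (b * B) powr (tau - 1) = M * b powr (s * (t - 1)) * (B powr (tau - 1) * B)"
        using e B by (simp add: powr_mult tau1)
      also have "B powr (tau - 1) * B = B powr tau"
        using B powr_add[of B "tau - 1" 1] by simp
      also have "M * b powr (s * (t - 1)) * B powr tau \<le> D powr s * C powr s * B powr tau"
        using * by (rule mult_right_mono) simp
      finally show ?thesis unfolding mo ms B_def[symmetric] .
    qed
  qed
qed

section \<open>Extrapolation\<close>

lemma weight_factorization:
  fixes p q a b tau tau' \<theta> m \<phi> u v c :: real
  assumes q: "0 < q" and b: "q * b < 1" and a: "1 < q * a"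
    and tau: "tau = q * (a - b) / (1 - q * b)" "tau' = q * (a - b) / (q * a - 1)"
    and th: "\<theta> = (p * a - 1) / tau" "m = (1 - p * b) / tau'"
    and pos: "0 < u" "0 < v" "0 < c" "0 \<le> \<phi>"
  shows "\<phi> powr p * (u powr (1 - p * b) * v powr - (p * a - 1))
    = (\<phi> powr q * c powr (1 - q * b)) powr (p / q) * (v powr tau * c) powr - \<theta> * (u powr tau' * c powr (1 - tau')) powr m"
proof -
  have ab: "0 < q * (a - b)" using a b by (simp add: algebra_simps)
  have t1: "1 - tau' = - tau' / tau"
  proof -
    have "1 - tau' = - (1 - q * b) / (q * a - 1)" using a by (simp add: tau divide_simps) (simp add: algebra_simps)
    moreover have "tau' / tau = (1 - q * b) / (q * a - 1)"
    proof -
      have "a \<noteq> b" "q \<noteq> 0" using ab by auto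
      then show ?thesis using b by (simp add: tau)
    qed
    ultimately show ?thesis by (simp only: minus_divide_left[symmetric])
  qed
  have t0: "0 < tau" "0 < tau'" using a b ab by (auto simp: tau)
  have e1: "tau' * m = 1 - p * b" using t0 by (simp add: th)
  have e2: "tau * - \<theta> = - (p * a - 1)" using t0 by (simp add: th)
  have e3: "(1 - tau') * m = - (1 - p * b) / tau" 
  proof -
    have "(1 - tau') * m = - (tau' * m) / tau" by (simp add: t1)
    then show ?thesis by (simp only: e1)
  qed
  \<comment> \<open>The definitions of \<open>\<theta>\<close> and \<open>m\<close> match the
    exponents of \<open>v\<close> and \<open>u\<close>. With them the powers of \<open>c\<close>,
    which stands for the value of \<open>om\<close>, cancel, so that \<open>om\<close> does not
    enter the weight at \<open>p\<close>.\<close>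
  have e4: "(1 - q * b) * (p / q) + (- \<theta>) + (1 - tau') * m = 0"
  proof -
    have "(1 - q * b) * (p / q) = p * (a - b) / tau"
      using q a b ab by (simp add: tau field_simps)
    then have "(1 - q * b) * (p / q) + (- \<theta>) + (1 - tau') * m = (p * (a - b) + - (p * a - 1) + - (1 - p * b)) / tau"
      by (simp only: e3 th(1) add_divide_distrib minus_divide_left)
    then show ?thesis by (simp add: algebra_simps)
  qed
  have "(\<phi> powr q * c powr (1 - q * b)) powr (p / q) * (v powr tau * c) powr - \<theta> * (u powr tau' * c powr (1 - tau')) powr m
    = \<phi> powr (q * (p / q)) * v powr (tau * - \<theta>) * u powr (tau' * m)
      * (c powr ((1 - q * b) * (p / q)) * c powr - \<theta> * c powr ((1 - tau') * m))"
    using pos by (simp add: powr_mult powr_powr mult_ac)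
  also have "c powr ((1 - q * b) * (p / q)) * c powr - \<theta> * c powr ((1 - tau') * m) = 1"
    unfolding powr_add[symmetric] e4 using pos by simp
  finally show ?thesis
    unfolding e1 e2 using q by (simp add: mult_ac)
qed

text \<open>This says that the exponents \<open>p / q\<close>, \<open>- \<theta>\<close> and
  \<open>m\<close> in the factorization add up to 1. By this homogeneity the convexity inequalities
  below give bounds linear in the three factors.\<close>

lemma exponent_relation:
  fixes p q a b tau tau' \<theta> m :: real
  assumes q: "0 < q" and b: "q * b < 1" and a: "1 < q * a"
    and tau: "tau = q * (a - b) / (1 - q * b)" "tau' = q * (a - b) / (q * a - 1)"
    and th: "\<theta> = (p * a - 1) / tau" "m = (1 - p * b) / tau'"
  shows "p / q + m = 1 + \<theta>"
proof -
  have ab: "0 < q * (a - b)" using a b by (simp add: algebra_simps)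
  then have "a - b > 0" using q by (simp add: zero_less_mult_iff)
  then show ?thesis
    using q a b by (simp add: th tau divide_simps) (simp add: algebra_simps)
qed

text \<open>Replacing \<open>X\<close> by \<open>A * V\<close> leaves
  \<open>V powr (1 - m) * U powr m\<close>, to which Young's inequality applies.\<close>

lemma factor_upper:
  fixes X U V A \<theta> m e :: real
  assumes pos: "0 < V" "0 < U" "0 < A" "0 \<le> X" and m: "0 \<le> m" "m \<le> 1" and e: "0 < e" "e + m = 1 + \<theta>"
    and X: "X \<le> A * V"
  shows "X powr e * V powr - \<theta> * U powr m \<le> A powr e * (V + U)"
proof -
  have "X powr e \<le> (A * V) powr e" using pos e X by (intro powr_mono2) auto
  then have "X powr e * V powr - \<theta> * U powr m \<le> (A * V) powr e * V powr - \<theta> * U powr m"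
    by (intro mult_right_mono) auto
  also have "\<dots> = A powr e * (V powr (1 - m) * U powr m)"
  proof -
    have "V powr e * V powr - \<theta> = V powr (1 - m)"
    proof -
      have "e + - \<theta> = 1 - m" using e by linarith
      then show ?thesis by (simp only: powr_add[symmetric])
    qed
    then show ?thesis using pos by (simp add: powr_mult mult_ac)
  qed
  also have "\<dots> \<le> A powr e * ((1 - m) * V + m * U)"
    using pos m by (intro mult_left_mono Youngs_inequality_0) auto
  also have "\<dots> \<le> A powr e * (V + U)"
    using pos m by (intro mult_left_mono add_mono mult_left_le_one_le) auto
  finally show ?thesis .
qed

text \<open>Replacing \<open>U\<close> by \<open>X / A\<close> leaves a multiple of
  \<open>X powr (1 + \<theta>) * V powr - \<theta>\<close>, which is convex in \<open>X\<close>; the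
  bound is its tangent at \<open>X = L * V\<close>. The parameter \<open>L\<close> stays free for a
  later choice.\<close>

lemma factor_lower:
  fixes X U V A \<theta> m e L :: real
  assumes pos: "0 < V" "0 < U" "0 < A" "0 \<le> X" "0 < L" and m: "0 \<le> m" and th: "0 \<le> \<theta>" and e: "e + m = 1 + \<theta>"
    and X: "X \<le> A * U"
  shows "A powr - m * (1 + \<theta>) * L powr \<theta> * X
    \<le> X powr e * V powr - \<theta> * U powr m + A powr - m * \<theta> * L powr (1 + \<theta>) * V"
proof (cases "X = 0")
  case True
  then show ?thesis using pos th by simp
next
  case False
  then have X0: "0 < X" using pos by simp
  have "1 + \<theta> \<le> (L * V / X) powr - \<theta> + \<theta> * (L * V / X)"
    using pos X0 th by (intro powr_minus_ge_tangent) auto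
  then have "A powr - m * L powr \<theta> * X * (1 + \<theta>)
      \<le> A powr - m * L powr \<theta> * X * ((L * V / X) powr - \<theta> + \<theta> * (L * V / X))"
    using X0 by (intro mult_left_mono) auto
  also have "\<dots> = A powr - m * (X powr (1 + \<theta>) * V powr - \<theta>) + A powr - m * \<theta> * L powr (1 + \<theta>) * V"
    using pos X0 by (simp add: powr_mult powr_divide powr_add powr_minus_divide field_simps)
  also have "A powr - m * (X powr (1 + \<theta>) * V powr - \<theta>) \<le> X powr e * V powr - \<theta> * U powr m"
  proof -
    have "(X / A) powr m \<le> U powr m"
      using pos X m by (intro powr_mono2) (auto simp: field_simps)
    then have "X powr e * V powr - \<theta> * (X / A) powr m \<le> X powr e * V powr - \<theta> * U powr m"
      by (intro mult_left_mono) auto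
    moreover have "X powr e * X powr m = X powr (1 + \<theta>)" using e by (simp add: powr_add[symmetric])
    then have "X powr e * V powr - \<theta> * (X / A) powr m = A powr - m * (X powr (1 + \<theta>) * V powr - \<theta>)"
      using pos X0 by (simp add: powr_divide powr_minus_divide mult_ac)
    ultimately show ?thesis by simp
  qed
  finally show ?thesis by (simp add: mult_ac)
qed

section \<open>Integrable majorants from the Rubio de Francia algorithm\<close>

lemma A1_majorant:
  fixes w :: "real ^ 'n \<Rightarrow> real"
  assumes pair: "muckenhoupt_pair w s t t' K"
    and H [measurable]: "H \<in> borel_measurable lebesgue"
    and int: "(\<integral>\<^sup>+x. ennreal (w x) * epow (H x) t \<partial>lebesgue) < \<infinity>"
    and nz: "\<not> (AE x in lebesgue. H x = 0)"
  shows "\<exists>A v. A1_weight A v \<and> (AE x in lebesgue. H x \<le> ennreal (v x)) \<and>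
    (\<integral>\<^sup>+x. ennreal (v x powr t * w x) \<partial>lebesgue) < \<infinity>"
proof -
  interpret muckenhoupt_pair w s t t' K by (rule pair)
  have t0: "0 < t" using t by simp
  have int': "(\<integral>\<^sup>+x. epow (H x) t \<partial>wmeasure w) < \<infinity>"
    using int by (subst nn_integral_density) auto
  have "sets (wmeasure w) = sets lebesgue" by simp
  from rubio_de_francia[OF this t0 maximal_bounded H int']
  obtain v A where v [measurable]: "v \<in> borel_measurable lebesgue" and Hv: "\<And>x. H x \<le> v x"
    and vint: "(\<integral>\<^sup>+x. epow (v x) t \<partial>wmeasure w) < \<infinity>"
    and A: "0 < A" "\<And>x. maximal lebesgue v x \<le> ennreal A * v x"
    by blast
  have vint': "(\<integral>\<^sup>+x. ennreal (w x) * epow (v x) t \<partial>lebesgue) < \<infinity>"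
    using vint by (subst (asm) nn_integral_density) auto
  then have "AE x in lebesgue. ennreal (w x) * epow (v x) t \<noteq> \<infinity>"
    by (intro nn_integral_noteq_infinite) auto
  then have fin: "AE x in lebesgue. v x < \<infinity>"
  proof eventually_elim
    fix x assume "ennreal (w x) * epow (v x) t \<noteq> \<infinity>"
    then have "epow (v x) t \<noteq> top"
      using w_pos[of x] by (auto simp: ennreal_mult_top ennreal_eq_0_iff)
    then show "v x < \<infinity>" using t0 by (simp add: less_top)
  qed
  have "\<not> (AE x in lebesgue. v x = 0)"
  proof
    assume "AE x in lebesgue. v x = 0"
    then have "AE x in lebesgue. H x = 0"
    proof eventually_elim
      fix x assume "v x = 0" then show "H x = 0" using Hv[of x] by simp
    qed
    with nz show False ..
  qed
  from A1_weight_of_maximal[OF v A fin this]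
  obtain v' where v': "A1_weight A v'" "AE x in lebesgue. ennreal (v' x) = v x" by blast
  have v'_pos: "0 < v' x" for x using v'(1) by (simp add: A1_weight_def)
  have "AE x in lebesgue. H x \<le> ennreal (v' x)"
    using v'(2) by eventually_elim (simp add: Hv)
  moreover have "(\<integral>\<^sup>+x. ennreal (v' x powr t * w x) \<partial>lebesgue) < \<infinity>"
  proof -
    have "(\<integral>\<^sup>+x. ennreal (v' x powr t * w x) \<partial>lebesgue) = (\<integral>\<^sup>+x. ennreal (w x) * epow (v x) t \<partial>lebesgue)"
    proof (rule nn_integral_cong_AE, use v'(2) in eventually_elim)
      fix x assume "ennreal (v' x) = v x"
      then have "epow (v x) t = ennreal (v' x powr t)"
        using v'_pos[of x] by (metis epow_ennreal)
      then show "ennreal (v' x powr t * w x) = ennreal (w x) * epow (v x) t"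
        using w_pos[of x] by (simp add: ennreal_mult mult.commute)
    qed
    then show ?thesis using vint' by simp
  qed
  ultimately show ?thesis using v'(1) by blast
qed

text \<open>\<open>H1\<close> and \<open>H2\<close> are chosen so that the \<open>t\<close>-th power
  of \<open>H1\<close> times \<open>w\<close> and the \<open>t'\<close>-th power of
  \<open>H2\<close> times \<open>s\<close> are both \<open>h * w powr e\<close>. One integrability
  assumption thus feeds \<open>A1_majorant\<close> for the pair and for its dual, and both majorants
  dominate the same function.\<close>

lemma joint_majorants:
  fixes w :: "real ^ 'n \<Rightarrow> real"
  assumes pair: "muckenhoupt_pair w s t t' K"
    and h [measurable]: "h \<in> borel_measurable lebesgue"
    and int: "(\<integral>\<^sup>+x. h x * ennreal (w x powr e) \<partial>lebesgue) < \<infinity>"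
    and nz: "\<not> (AE x in lebesgue. h x = 0)"
  shows "\<exists>A u D v. A1_weight A u \<and> A1_weight D v \<and>
    (AE x in lebesgue. h x * ennreal (w x powr e) \<le> ennreal (v x powr t * w x)) \<and>
    (AE x in lebesgue. h x * ennreal (w x powr e) \<le> ennreal (u x powr t' * w x powr (1 - t'))) \<and>
    (\<integral>\<^sup>+x. ennreal (v x powr t * w x) \<partial>lebesgue) < \<infinity> \<and>
    (\<integral>\<^sup>+x. ennreal (u x powr t' * w x powr (1 - t')) \<partial>lebesgue) < \<infinity>"
proof -
  interpret muckenhoupt_pair w s t t' K by (rule pair)
  have t0: "0 < t" "0 < t'" using t exponents(1) by auto
  let ?G = "\<lambda>x. h x * ennreal (w x powr (e - 1))"
  define H1 where "H1 x = epow (?G x) (1 / t)" for x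
  define H2 where "H2 x = ennreal (w x) * epow (?G x) (1 / t')" for x
  have Hm [measurable]: "H1 \<in> borel_measurable lebesgue" "H2 \<in> borel_measurable lebesgue"
    unfolding H1_def H2_def by measurable
  have wG: "ennreal (w x) * ?G x = h x * ennreal (w x powr e)" for x
  proof -
    have "w x * w x powr (e - 1) = w x powr e"
      using w_pos[of x] powr_add[of "w x" 1 "e - 1"] by simp
    then have "ennreal (w x) * ennreal (w x powr (e - 1)) = ennreal (w x powr e)"
      using w_pos[of x] by (simp add: ennreal_mult'[symmetric] less_imp_le)
    then show ?thesis by (simp only: mult.left_commute[of "ennreal (w x)"])
  qed
  have H1: "ennreal (w x) * epow (H1 x) t = h x * ennreal (w x powr e)" for x
    using t0 by (simp only: H1_def epow_epow wG) (simp add: wG)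
  have H2: "ennreal (s x) * epow (H2 x) t' = h x * ennreal (w x powr e)" for x
  proof -
    have "epow (H2 x) t' = ennreal (w x powr t') * ?G x"
      unfolding H2_def using t0 w_pos[of x]
      by (subst epow_mult) (simp_all add: epow_epow epow_ennreal)
    moreover have "ennreal (s x) * ennreal (w x powr t') = ennreal (w x)"
    proof -
      have "s x * w x powr t' = w x" using w_pos[of x] by (simp add: s_eq powr_add[symmetric])
      then show ?thesis using s_pos[of x] by (simp add: ennreal_mult'[symmetric] less_imp_le)
    qed
    ultimately show ?thesis by (simp only: mult.assoc[symmetric] wG[symmetric])
  qed
  have nz1: "\<not> (AE x in lebesgue. H1 x = 0)"
  proof
    assume "AE x in lebesgue. H1 x = 0"
    then have "AE x in lebesgue. h x = 0"
    proof eventually_elim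
      fix x assume "H1 x = 0"
      then show "h x = 0" using t0 w_pos[of x] by (auto simp: H1_def ennreal_eq_0_iff)
    qed
    with nz show False ..
  qed
  have nz2: "\<not> (AE x in lebesgue. H2 x = 0)"
  proof
    assume "AE x in lebesgue. H2 x = 0"
    then have "AE x in lebesgue. h x = 0"
    proof eventually_elim
      fix x assume "H2 x = 0"
      then show "h x = 0" using t0 w_pos[of x] by (auto simp: H2_def ennreal_eq_0_iff)
    qed
    with nz show False ..
  qed
  obtain D v where v: "A1_weight D v" "AE x in lebesgue. H1 x \<le> ennreal (v x)"
    "(\<integral>\<^sup>+x. ennreal (v x powr t * w x) \<partial>lebesgue) < \<infinity>"
    using A1_majorant[OF pair Hm(1) _ nz1] int unfolding H1 by blast
  obtain A u where u: "A1_weight A u" "AE x in lebesgue. H2 x \<le> ennreal (u x)"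
    "(\<integral>\<^sup>+x. ennreal (u x powr t' * s x) \<partial>lebesgue) < \<infinity>"
    using A1_majorant[OF dual Hm(2) _ nz2] int unfolding H2 by blast
  have v_pos: "0 < v x" and u_pos: "0 < u x" for x
    using u(1) v(1) by (auto simp: A1_weight_def)
  have "AE x in lebesgue. h x * ennreal (w x powr e) \<le> ennreal (v x powr t * w x)"
    using v(2)
  proof eventually_elim
    fix x assume "H1 x \<le> ennreal (v x)"
    then have "ennreal (w x) * epow (H1 x) t \<le> ennreal (w x) * epow (ennreal (v x)) t"
      using t0 by (intro mult_left_mono epow_mono) auto
    then show "h x * ennreal (w x powr e) \<le> ennreal (v x powr t * w x)"
      using v_pos[of x] w_pos[of x] unfolding H1 by (simp add: epow_ennreal ennreal_mult' mult.commute)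
  qed
  moreover have "AE x in lebesgue. h x * ennreal (w x powr e) \<le> ennreal (u x powr t' * s x)"
    using u(2)
  proof eventually_elim
    fix x assume "H2 x \<le> ennreal (u x)"
    then have "ennreal (s x) * epow (H2 x) t' \<le> ennreal (s x) * epow (ennreal (u x)) t'"
      using t0 by (intro mult_left_mono epow_mono) auto
    then show "h x * ennreal (w x powr e) \<le> ennreal (u x powr t' * s x)"
      using u_pos[of x] s_pos[of x] unfolding H2 by (simp add: epow_ennreal ennreal_mult' mult.commute)
  qed
  ultimately show ?thesis
    using u v unfolding s_eq by blast
qed

section \<open>Integrals of powers in place of norms\<close>

definition Lp_int :: "real \<Rightarrow> (real ^ 'n \<Rightarrow> real) \<Rightarrow> (real ^ 'n \<Rightarrow> ennreal) \<Rightarrow> ennreal" where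
  "Lp_int p w f = (\<integral>\<^sup>+x. epow (f x) p \<partial>wmeasure w)"

lemma Lp_norm_eq: "Lp_norm p w f = epow (Lp_int p w f) (1 / p)"
  by (simp add: Lp_norm_def Lp_int_def)

lemma Lp_int_eq_lebesgue:
  assumes [measurable]: "w \<in> borel_measurable lebesgue" "f \<in> borel_measurable lebesgue"
  shows "Lp_int p w f = (\<integral>\<^sup>+x. ennreal (w x) * epow (f x) p \<partial>lebesgue)"
  unfolding Lp_int_def by (rule nn_integral_density) measurable

lemma root_le_iff:
  assumes "0 < p" "0 < C"
  shows "epow I (1 / p) \<le> ennreal C * epow J (1 / p) \<longleftrightarrow> I \<le> ennreal (C powr p) * J"
proof -
  have p: "0 < 1 / p" using assms by simp
  have "epow (ennreal C * epow J (1 / p)) (1 / (1 / p)) = ennreal (C powr p) * J"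
    using assms by (simp add: epow_mult epow_epow epow_ennreal)
  then show ?thesis unfolding epow_le_iff[OF p] by simp
qed

lemma Lp_bound_iff:
  assumes p: "0 < p"
  shows "Lp_bound p w \<F> \<longleftrightarrow>
    (\<exists>C::real. 0 < C \<and> (\<forall>(f, g)\<in>\<F>. Lp_int p w f < \<infinity> \<longrightarrow> Lp_int p w f \<le> ennreal C * Lp_int p w g))"
    (is "_ \<longleftrightarrow> ?R")
proof
  assume "Lp_bound p w \<F>"
  then obtain C where C: "0 < C" "\<And>f g. (f, g) \<in> \<F> \<Longrightarrow> Lp_norm p w f < \<infinity> \<Longrightarrow> Lp_norm p w f \<le> ennreal C * Lp_norm p w g"
    unfolding Lp_bound_def by blast
  have "Lp_int p w f \<le> ennreal (C powr p) * Lp_int p w g" if "(f, g) \<in> \<F>" "Lp_int p w f < \<infinity>" for f g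
    using C(2)[OF that(1)] that(2) p unfolding Lp_norm_eq root_le_iff[OF p C(1)] by simp
  then show ?R using C(1) by (intro exI[of _ "C powr p"]) auto
next
  assume ?R
  then obtain C where C: "0 < C" "\<And>f g. (f, g) \<in> \<F> \<Longrightarrow> Lp_int p w f < \<infinity> \<Longrightarrow> Lp_int p w f \<le> ennreal C * Lp_int p w g"
    by blast
  have C': "0 < C powr (1 / p)" "(C powr (1 / p)) powr p = C" using C p by (simp_all add: powr_powr)
  have "Lp_norm p w f \<le> ennreal (C powr (1 / p)) * Lp_norm p w g" if "(f, g) \<in> \<F>" "Lp_norm p w f < \<infinity>" for f g
    using C(2)[OF that(1)] that(2) p unfolding Lp_norm_eq root_le_iff[OF p C'(1)] C'(2) by simp
  then show "Lp_bound p w \<F>"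
    unfolding Lp_bound_def using C'(1) by blast
qed

text \<open>\<open>M powr (p / q)\<close> has two factors:
  \<open>2 powr (k * (1 + \<theta>))\<close> compensates the \<open>2 powr k\<close> in
  \<open>A\<close>, and \<open>2 powr (k * p)\<close> is the gain left over. The powers of
  \<open>c\<close> cancel, so the resulting bound does not depend on the normalization of the
  pair.\<close>

lemma gliding_hump_arith:
  fixes k p q \<theta> m c S C A M :: real
  assumes pos: "0 < p" "0 < q" "0 < c" "1 \<le> S" "0 < C" and e: "p / q + m = 1 + \<theta>"
    and A: "A = 2 powr k * c" and M: "M = 2 powr (k * q * ((1 + \<theta>) / p + 1))"
    and le: "A powr - m * (c / S) powr \<theta> * c \<le> C * ((A / M) powr (p / q) * (2 * S))"
  shows "2 powr (k * p) \<le> 2 * C * S powr (1 + \<theta>)"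
proof -
  have A0: "0 < A" and M0: "0 < M" and S0: "0 < S" using pos by (auto simp: A M)
  have Me: "M powr (p / q) = 2 powr (k * (1 + \<theta>)) * 2 powr (k * p)"
  proof -
    have "k * q * ((1 + \<theta>) / p + 1) * (p / q) = k * (1 + \<theta>) + k * p"
      using pos by (simp add: field_simps)
    then show ?thesis by (simp only: M powr_powr powr_add)
  qed
  have Ae: "A powr m * A powr (p / q) = 2 powr (k * (1 + \<theta>)) * c powr (1 + \<theta>)"
  proof -
    have "A powr m * A powr (p / q) = A powr (1 + \<theta>)" using e by (simp add: powr_add[symmetric] add.commute)
    also have "\<dots> = 2 powr (k * (1 + \<theta>)) * c powr (1 + \<theta>)" using pos by (simp add: A powr_mult powr_powr)
    finally show ?thesis .
  qed
  have "A powr m * (A powr - m * (c / S) powr \<theta> * c) \<le> A powr m * (C * ((A / M) powr (p / q) * (2 * S)))"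
    using le by (rule mult_left_mono) simp
  moreover have "A powr m * (A powr - m * (c / S) powr \<theta> * c) = c powr (1 + \<theta>) / S powr \<theta>"
    using A0 S0 pos by (simp add: powr_minus_divide powr_divide powr_add)
  moreover have "A powr m * (C * ((A / M) powr (p / q) * (2 * S)))
    = (A powr m * A powr (p / q)) * (2 * C * S) / M powr (p / q)"
    using A0 M0 by (simp add: powr_divide)
  moreover have "\<dots> = c powr (1 + \<theta>) * (2 * C * S) / 2 powr (k * p)"
    unfolding Ae Me by simp
  ultimately have "c powr (1 + \<theta>) / S powr \<theta> \<le> c powr (1 + \<theta>) * (2 * C * S) / 2 powr (k * p)" by simp
  then have "c powr (1 + \<theta>) * 2 powr (k * p) \<le> c powr (1 + \<theta>) * (2 * C * (S * S powr \<theta>))"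
    using S0 by (simp add: field_simps)
  then have "2 powr (k * p) \<le> 2 * C * (S * S powr \<theta>)" using pos by simp
  then show ?thesis using S0 by (simp add: powr_add)
qed

locale factored_weight =
  fixes p q a b tau tau' \<theta> m :: real and w om u v :: "real ^ 'n \<Rightarrow> real" and A D :: real
  assumes p: "0 < p" and q: "0 < q" and b: "0 \<le> b" "q * b < 1" "p * b \<le> 1" and a: "1 < q * a" "1 \<le> p * a"
    and tau: "tau = q * (a - b) / (1 - q * b)" "tau' = q * (a - b) / (q * a - 1)"
    and th: "\<theta> = (p * a - 1) / tau" "m = (1 - p * b) / tau'"
    and u: "A1_weight A u" and v: "A1_weight D v"
    and w_measurable [measurable]: "w \<in> borel_measurable lebesgue"
    and om_measurable [measurable]: "om \<in> borel_measurable lebesgue"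
    and om_pos: "0 < om x" and w_eq: "AE x in lebesgue. w x = om x powr (1 - q * b)"
begin

definition W where "W x = u x powr (1 - p * b) * v x powr - (p * a - 1)"
definition V where "V x = v x powr tau * om x"
definition U where "U x = u x powr tau' * om x powr (1 - tau')"

lemma um [measurable]: "u \<in> borel_measurable lebesgue" and vm [measurable]: "v \<in> borel_measurable lebesgue"
  and u_pos: "0 < u x" and v_pos: "0 < v x"
  using u v by (auto simp: A1_weight_def)

lemma WUV_measurable [measurable]:
  "W \<in> borel_measurable lebesgue" "V \<in> borel_measurable lebesgue" "U \<in> borel_measurable lebesgue"
  unfolding W_def V_def U_def by measurable

lemma V_pos: "0 < V x" and U_pos: "0 < U x" and W_pos: "0 < W x"
  using u_pos[of x] v_pos[of x] om_pos[of x] by (simp_all add: V_def U_def W_def)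

lemma W_in_class:
  "W \<in> A_class (p * a)" "W \<in> RH_class (if 1 - p * b = 0 then \<infinity> else ennreal (1 / (1 - p * b)))"
proof -
  have prod: "A1_product u v A D (1 - p * b) (p * a - 1)"
    using u v p b a by (intro A1_product.intro) auto
  have eq: "A1_product.W u v (1 - p * b) (p * a - 1) = W"
    unfolding W_def by (rule ext) (rule A1_product.W_def[OF prod])
  then show "W \<in> A_class (p * a)" "W \<in> RH_class (if 1 - p * b = 0 then \<infinity> else ennreal (1 / (1 - p * b)))"
    using A1_product.W_in_A_class[OF prod] A1_product.W_in_RH_class[OF prod] unfolding eq by simp_all
qed

lemma exps: "p / q + m = 1 + \<theta>" "0 \<le> \<theta>" "0 \<le> m" "m \<le> 1" "0 < p / q"
proof -
  show e: "p / q + m = 1 + \<theta>" by (rule exponent_relation[OF q b(2) a(1) tau th])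
  have ab: "0 < q * (a - b)" using a b by (simp add: algebra_simps)
  then show "0 \<le> \<theta>" "0 \<le> m" unfolding th tau using a b by simp_all
  have "1 \<le> tau'" unfolding tau using a b by (simp add: field_simps)
  then show "m \<le> 1" unfolding th using p b by simp (metis add_increasing2 diff_le_eq mult_nonneg_nonneg less_imp_le order_trans)
  show "0 < p / q" using p q by simp
qed

lemma finite_part:
  assumes "epow y q * ennreal (w x) \<le> ennreal E * ennreal z" "w x = om x powr (1 - q * b)"
  obtains r where "0 \<le> r" "y = ennreal r"
proof -
  have "0 < w x" using assms(2) om_pos[of x] by simp
  moreover have "epow y q * ennreal (w x) < top"
    using assms(1) by (rule order_le_less_trans) (simp add: ennreal_mult_less_top)
  ultimately have "y \<noteq> top" using q by (auto simp: ennreal_top_mult)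
  then show ?thesis using that by (cases y) auto
qed

lemma real_part:
  assumes "epow (ennreal r) q * ennreal (w x) \<le> ennreal E * ennreal z" "w x = om x powr (1 - q * b)"
    "0 \<le> r" "0 < E" "0 < z"
  shows "r powr q * w x \<le> E * z"
proof -
  have "0 < w x" using assms(2) om_pos[of x] by simp
  then show ?thesis
    using assms q by (simp add: epow_ennreal ennreal_mult[symmetric] less_imp_le)
qed

text \<open>The integrated form of \<open>factor_upper\<close>. Besides bounding right-hand sides,
  it makes the left-hand side at \<open>p\<close> finite, as the convention on the hypothesis
  demands.\<close>

lemma Lp_int_upper:
  assumes [measurable]: "\<phi> \<in> borel_measurable lebesgue" and E: "0 < E"
    and le: "AE x in lebesgue. epow (\<phi> x) q * ennreal (w x) \<le> ennreal E * ennreal (V x)"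
    and S: "(\<integral>\<^sup>+x. ennreal (V x) \<partial>lebesgue) \<le> ennreal S" "(\<integral>\<^sup>+x. ennreal (U x) \<partial>lebesgue) \<le> ennreal S" "0 \<le> S"
  shows "Lp_int p W \<phi> \<le> ennreal (E powr (p / q) * (2 * S))"
proof -
  have "Lp_int p W \<phi> = (\<integral>\<^sup>+x. ennreal (W x) * epow (\<phi> x) p \<partial>lebesgue)"
    by (rule Lp_int_eq_lebesgue) measurable
  also have "\<dots> \<le> (\<integral>\<^sup>+x. ennreal (E powr (p / q)) * (ennreal (V x) + ennreal (U x)) \<partial>lebesgue)"
  proof (rule nn_integral_mono_AE, use le w_eq in eventually_elim)
    fix x assume *: "epow (\<phi> x) q * ennreal (w x) \<le> ennreal E * ennreal (V x)" "w x = om x powr (1 - q * b)"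
    obtain r where r: "0 \<le> r" "\<phi> x = ennreal r" by (rule finite_part[OF *])
    have X: "r powr q * w x \<le> E * V x"
      using * r E V_pos[of x] by (intro real_part) auto
    have "r powr p * W x = (r powr q * w x) powr (p / q) * V x powr - \<theta> * U x powr m"
      unfolding W_def V_def U_def *(2)
      by (rule weight_factorization[OF q b(2) a(1) tau th u_pos v_pos om_pos r(1)])
    also have "\<dots> \<le> E powr (p / q) * (V x + U x)"
      using exps *(2) by (intro factor_upper V_pos U_pos E X) auto
    finally have "ennreal (W x * r powr p) \<le> ennreal (E powr (p / q) * (V x + U x))"
      by (simp add: ennreal_leI mult.commute)
    then show "ennreal (W x) * epow (\<phi> x) p \<le> ennreal (E powr (p / q)) * (ennreal (V x) + ennreal (U x))"
      using r p W_pos[of x] V_pos[of x] U_pos[of x] by (simp add: epow_ennreal ennreal_mult less_imp_le)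
  qed
  also have "\<dots> = ennreal (E powr (p / q)) * ((\<integral>\<^sup>+x. ennreal (V x) \<partial>lebesgue) + (\<integral>\<^sup>+x. ennreal (U x) \<partial>lebesgue))"
  proof -
    have "(\<integral>\<^sup>+x. ennreal (E powr (p / q)) * (ennreal (V x) + ennreal (U x)) \<partial>lebesgue)
      = ennreal (E powr (p / q)) * (\<integral>\<^sup>+x. ennreal (V x) + ennreal (U x) \<partial>lebesgue)"
      by (rule nn_integral_cmult) measurable
    also have "(\<integral>\<^sup>+x. ennreal (V x) + ennreal (U x) \<partial>lebesgue)
      = (\<integral>\<^sup>+x. ennreal (V x) \<partial>lebesgue) + (\<integral>\<^sup>+x. ennreal (U x) \<partial>lebesgue)"
      by (rule nn_integral_add) measurable
    finally show ?thesis .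
  qed
  also have "\<dots> \<le> ennreal (E powr (p / q)) * (ennreal S + ennreal S)"
    by (intro mult_left_mono add_mono S) auto
  also have "\<dots> = ennreal (E powr (p / q) * (2 * S))"
    unfolding ennreal_plus[OF S(3) S(3), symmetric] mult_2[of S] using S(3)
    by (intro ennreal_mult[symmetric]) auto
  finally show ?thesis .
qed

text \<open>The integrated form of \<open>factor_lower\<close>: the integral at \<open>q\<close> is
  recovered from the one at \<open>p\<close> up to an error controlled by the integral of
  \<open>V\<close>.\<close>

lemma Lp_int_lower:
  assumes [measurable]: "\<phi> \<in> borel_measurable lebesgue" and E: "0 < E" and L: "0 < L"
    and le: "AE x in lebesgue. epow (\<phi> x) q * ennreal (w x) \<le> ennreal E * ennreal (U x)"
    and S: "(\<integral>\<^sup>+x. ennreal (V x) \<partial>lebesgue) \<le> ennreal S" "0 \<le> S"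
  shows "ennreal (E powr - m * (1 + \<theta>) * L powr \<theta>) * Lp_int q w \<phi>
    \<le> Lp_int p W \<phi> + ennreal (E powr - m * \<theta> * L powr (1 + \<theta>)) * ennreal S"
proof -
  let ?k1 = "E powr - m * (1 + \<theta>) * L powr \<theta>" and ?k2 = "E powr - m * \<theta> * L powr (1 + \<theta>)"
  have k: "0 \<le> ?k1" "0 \<le> ?k2" using exps by simp_all
  have "ennreal ?k1 * Lp_int q w \<phi> = ennreal ?k1 * (\<integral>\<^sup>+x. ennreal (w x) * epow (\<phi> x) q \<partial>lebesgue)"
    by (subst Lp_int_eq_lebesgue) auto
  also have "\<dots> = (\<integral>\<^sup>+x. ennreal ?k1 * (ennreal (w x) * epow (\<phi> x) q) \<partial>lebesgue)"
    by (rule nn_integral_cmult[symmetric]) measurable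
  also have "\<dots> \<le> (\<integral>\<^sup>+x. ennreal (W x) * epow (\<phi> x) p + ennreal ?k2 * ennreal (V x) \<partial>lebesgue)"
  proof (rule nn_integral_mono_AE, use le w_eq in eventually_elim)
    fix x assume *: "epow (\<phi> x) q * ennreal (w x) \<le> ennreal E * ennreal (U x)" "w x = om x powr (1 - q * b)"
    obtain r where r: "0 \<le> r" "\<phi> x = ennreal r" by (rule finite_part[OF *])
    have w0: "0 < w x" using *(2) om_pos[of x] by simp
    have X: "r powr q * w x \<le> E * U x"
      using * r E U_pos[of x] by (intro real_part) auto
    have "?k1 * (r powr q * w x) \<le> (r powr q * w x) powr (p / q) * V x powr - \<theta> * U x powr m + ?k2 * V x"
      using exps w0 by (intro factor_lower V_pos U_pos E X L) auto
    also have "(r powr q * w x) powr (p / q) * V x powr - \<theta> * U x powr m = r powr p * W x"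
      unfolding W_def V_def U_def *(2)
      by (rule weight_factorization[OF q b(2) a(1) tau th u_pos v_pos om_pos r(1), symmetric])
    finally have "ennreal (?k1 * (w x * r powr q)) \<le> ennreal (W x * r powr p + ?k2 * V x)"
      by (simp add: ennreal_leI mult.commute)
    moreover have "ennreal (?k1 * (w x * r powr q)) = ennreal ?k1 * (ennreal (w x) * epow (\<phi> x) q)"
      using k r q w0 by (simp add: epow_ennreal ennreal_mult less_imp_le del: ennreal_mult'')
    moreover have "ennreal (W x * r powr p + ?k2 * V x) = ennreal (W x) * epow (\<phi> x) p + ennreal ?k2 * ennreal (V x)"
    proof -
      have "ennreal (W x * r powr p + ?k2 * V x) = ennreal (W x * r powr p) + ennreal (?k2 * V x)"
        using W_pos[of x] mult_nonneg_nonneg[OF k(2) less_imp_le[OF V_pos[of x]]]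
        by (intro ennreal_plus) (auto simp: less_imp_le)
      also have "ennreal (W x * r powr p) = ennreal (W x) * epow (\<phi> x) p"
        using r p W_pos[of x] by (simp add: epow_ennreal ennreal_mult less_imp_le)
      also have "ennreal (?k2 * V x) = ennreal ?k2 * ennreal (V x)"
        by (rule ennreal_mult[OF k(2) less_imp_le[OF V_pos]])
      finally show ?thesis .
    qed
    ultimately show "ennreal ?k1 * (ennreal (w x) * epow (\<phi> x) q) \<le> ennreal (W x) * epow (\<phi> x) p + ennreal ?k2 * ennreal (V x)"
      by simp
  qed
  also have "\<dots> = (\<integral>\<^sup>+x. ennreal (W x) * epow (\<phi> x) p \<partial>lebesgue) + (\<integral>\<^sup>+x. ennreal ?k2 * ennreal (V x) \<partial>lebesgue)"
    by (rule nn_integral_add) measurable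
  also have "(\<integral>\<^sup>+x. ennreal (W x) * epow (\<phi> x) p \<partial>lebesgue) = Lp_int p W \<phi>"
    by (rule Lp_int_eq_lebesgue[symmetric]) measurable
  also have "(\<integral>\<^sup>+x. ennreal ?k2 * ennreal (V x) \<partial>lebesgue) = ennreal ?k2 * (\<integral>\<^sup>+x. ennreal (V x) \<partial>lebesgue)"
    by (rule nn_integral_cmult) measurable
  also have "Lp_int p W \<phi> + \<dots> \<le> Lp_int p W \<phi> + ennreal ?k2 * ennreal S"
    by (intro add_left_mono mult_left_mono S) auto
  finally show ?thesis .
qed

end

section \<open>The gliding hump\<close>

lemma nn_integral_normalized_sum:
  fixes F G :: "nat \<Rightarrow> 'a \<Rightarrow> ennreal"
  assumes Fm [measurable]: "\<And>k. F k \<in> borel_measurable N" "\<And>k. G k \<in> borel_measurable N"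
    and c: "\<And>k. 0 < c k" "\<And>k. (\<integral>\<^sup>+x. F k x \<partial>N) = ennreal (c k)"
    and G: "\<And>k. ennreal (M k) * (\<integral>\<^sup>+x. G k x \<partial>N) \<le> ennreal (c k)"
  shows "(\<integral>\<^sup>+x. (\<Sum>k. ennreal ((1 / 2) ^ k / c k) * (F k x + ennreal (M k) * G k x)) \<partial>N) < \<infinity>"
proof -
  have term_le: "(\<integral>\<^sup>+x. ennreal ((1 / 2) ^ k / c k) * (F k x + ennreal (M k) * G k x) \<partial>N) \<le> ennreal ((1 / 2) ^ k) * 2" for k
  proof -
    have "(\<integral>\<^sup>+x. ennreal ((1 / 2) ^ k / c k) * (F k x + ennreal (M k) * G k x) \<partial>N)
      = ennreal ((1 / 2) ^ k / c k) * (\<integral>\<^sup>+x. F k x + ennreal (M k) * G k x \<partial>N)"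
      by (rule nn_integral_cmult) measurable
    also have "(\<integral>\<^sup>+x. F k x + ennreal (M k) * G k x \<partial>N) = (\<integral>\<^sup>+x. F k x \<partial>N) + (\<integral>\<^sup>+x. ennreal (M k) * G k x \<partial>N)"
      by (rule nn_integral_add) measurable
    also have "(\<integral>\<^sup>+x. ennreal (M k) * G k x \<partial>N) = ennreal (M k) * (\<integral>\<^sup>+x. G k x \<partial>N)"
      by (rule nn_integral_cmult) measurable
    also have "ennreal ((1 / 2) ^ k / c k) * ((\<integral>\<^sup>+x. F k x \<partial>N) + ennreal (M k) * (\<integral>\<^sup>+x. G k x \<partial>N))
      \<le> ennreal ((1 / 2) ^ k / c k) * (ennreal (c k) + ennreal (c k))"
      by (intro mult_left_mono add_mono G) (auto simp: c(2))
    also have "\<dots> = (ennreal ((1 / 2) ^ k / c k) * ennreal (c k)) * 2"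
      by (simp only: mult_2_right[symmetric] mult.assoc)
    also have "ennreal ((1 / 2) ^ k / c k) * ennreal (c k) = ennreal ((1 / 2) ^ k)"
      using c(1)[of k] by (subst ennreal_mult[symmetric]) auto
    finally show ?thesis .
  qed
  have "(\<integral>\<^sup>+x. (\<Sum>k. ennreal ((1 / 2) ^ k / c k) * (F k x + ennreal (M k) * G k x)) \<partial>N)
    = (\<Sum>k. \<integral>\<^sup>+x. ennreal ((1 / 2) ^ k / c k) * (F k x + ennreal (M k) * G k x) \<partial>N)"
    by (rule nn_integral_suminf) measurable
  also have "\<dots> \<le> (\<Sum>k. ennreal ((1 / 2) ^ k) * 2)"
    by (intro suminf_le term_le) auto
  also have "\<dots> \<le> 2 * 2" by (rule suminf_half_powers_le) simp
  also have "\<dots> < \<infinity>" by (simp add: ennreal_mult_less_top)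
  finally show ?thesis .
qed

lemma le_suminf_term:
  fixes f :: "nat \<Rightarrow> ennreal"
  shows "f k \<le> (\<Sum>k. f k)"
proof -
  have "(\<Sum>j\<in>{k}. f j) \<le> (\<Sum>j. f j)" by (intro sum_le_suminf) auto
  then show ?thesis by simp
qed

lemma le_of_scaled_le:
  assumes "0 < c" "ennreal (1 / c) * y \<le> z"
  shows "y \<le> ennreal c * z"
proof -
  have "y = ennreal c * (ennreal (1 / c) * y)"
    using assms(1) by (simp add: mult.assoc[symmetric] ennreal_mult'[symmetric])
  also have "\<dots> \<le> ennreal c * z" using assms(2) by (rule mult_left_mono) simp
  finally show ?thesis .
qed

text \<open>Only pairs with a finite left-hand side count, and a violated inequality makes this side
  nonzero. It is therefore a positive real \<open>c k\<close>, by which the pair can be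
  normalized.\<close>

lemma Lp_bound_failure:
  assumes q: "0 < q" and fail: "\<not> Lp_bound q w \<F>" and M: "\<And>k. 0 < M k"
  obtains f g c where "\<And>k::nat. (f k, g k) \<in> \<F>" "\<And>k. 0 < c k" "\<And>k. Lp_int q w (f k) = ennreal (c k)"
    "\<And>k. ennreal (M k) * Lp_int q w (g k) \<le> ennreal (c k)"
proof -
  have "\<exists>f g c. (f, g) \<in> \<F> \<and> 0 < c \<and> Lp_int q w f = ennreal c \<and> ennreal (M k) * Lp_int q w g \<le> ennreal c" for k
  proof -
    obtain f g where fg: "(f, g) \<in> \<F>" "Lp_int q w f < \<infinity>" "\<not> Lp_int q w f \<le> ennreal (M k) * Lp_int q w g"
      using fail M[of k] unfolding Lp_bound_iff[OF q] by blast
    then have "Lp_int q w f \<noteq> 0" by auto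
    then obtain c where c: "0 < c" "Lp_int q w f = ennreal c"
      using fg(2) by (cases "Lp_int q w f" rule: ennreal_trichotomy) auto
    have "ennreal (M k) * Lp_int q w g \<le> ennreal c" using fg(3) c(2) by simp
    with fg(1) c show ?thesis by blast
  qed
  then show ?thesis using that by metis
qed

text \<open>With \<open>a\<close> and \<open>b\<close> for the reciprocals of \<open>p0\<close> and
  \<open>q0\<close>, the case \<open>q0 = \<infinity>\<close> is just \<open>b = 0\<close>. The
  reverse Hoelder condition on \<open>w\<close> is given as the inequality itself, which covers the
  exponent 1 as well.\<close>

theorem limited_range_extrapolation:
  fixes w :: "real ^ 'n \<Rightarrow> real"
  assumes meas: "\<forall>(f, g)\<in>\<F>. f \<in> borel_measurable lebesgue \<and> g \<in> borel_measurable lebesgue"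
    and p: "0 < p" and q: "0 < q" and b: "0 \<le> b" "q * b < 1" "p * b \<le> 1" and a: "1 < q * a" "1 \<le> p * a"
    and hyp: "\<And>W. W \<in> A_class (p * a) \<Longrightarrow> W \<in> RH_class (if 1 - p * b = 0 then \<infinity> else ennreal (1 / (1 - p * b)))
      \<Longrightarrow> Lp_bound p W \<F>"
    and w: "w \<in> A_class (q * a)"
    and RH: "\<exists>C::real. \<forall>c r. 0 < r \<longrightarrow>
      epow (average (ball c r) (\<lambda>y. epow (ennreal (w y)) (1 / (1 - q * b)))) (1 / (1 / (1 - q * b)))
        \<le> ennreal C * average (ball c r) (\<lambda>y. ennreal (w y))"
  shows "Lp_bound q w \<F>"
proof (cases "AE x in lebesgue. w x = 0")
  \<comment> \<open>A weight that is zero almost everywhere has no positive representative, but all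
    its integrals vanish.\<close>
  case True
  have weight: "weight w" using w by (simp add: A_class_def)
  note [measurable] = weight_measurable[OF weight]
  have "Lp_int q w f = 0" if "(f, g) \<in> \<F>" for f g
  proof -
    have [measurable]: "f \<in> borel_measurable lebesgue" using meas that by auto
    have "Lp_int q w f = (\<integral>\<^sup>+x. ennreal (w x) * epow (f x) q \<partial>lebesgue)"
      by (rule Lp_int_eq_lebesgue) measurable
    also have "\<dots> = (\<integral>\<^sup>+x. 0 \<partial>(lebesgue :: (real ^ 'n) measure))"
      by (rule nn_integral_cong_AE, use True in eventually_elim) simp
    finally show ?thesis by simp
  qed
  then show ?thesis unfolding Lp_bound_iff[OF q] by (intro exI[of _ 1]) auto
next
  case nz: False
  show ?thesis
  proof (rule ccontr)
    assume fail: "\<not> Lp_bound q w \<F>"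
    have weight: "weight w" using w by (simp add: A_class_def)
    note wm [measurable] = weight_measurable[OF weight]
    have w_AE_pos: "AE x in lebesgue. 0 < w x" by (rule A_class_pos[OF w a(1) nz])
    define s where "s = 1 / (1 - q * b)"
    \<comment> \<open>\<open>w\<close> may vanish on a null set, where \<open>om\<close> is made positive.\<close>
    define om where "om x = (if 0 < w x then w x powr s else 1)" for x
    define tau where "tau = q * (a - b) / (1 - q * b)"
    define tau' where "tau' = q * (a - b) / (q * a - 1)"
    define sig where "sig x = om x powr (1 - tau')" for x
    define \<theta> where "\<theta> = (p * a - 1) / tau"
    define m where "m = (1 - p * b) / tau'"
    have s: "1 \<le> s" using b q by (simp add: s_def)
    have tau_eq: "tau = s * (q * a - 1) + 1"
      using b(2) by (simp add: tau_def s_def divide_simps) (simp add: algebra_simps)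
    have tau'_eq: "tau' = tau / (tau - 1)"
    proof -
      have "tau - 1 = (q * a - 1) / (1 - q * b)" unfolding tau_eq s_def by simp
      then show ?thesis using b(2) a(1) by (simp add: tau'_def tau_def)
    qed
    obtain K where pair: "muckenhoupt_pair om sig tau tau' K"
      using muckenhoupt_pair_powr[OF w a(1) s nz _ om_def tau_eq tau'_eq sig_def] RH
      unfolding s_def[symmetric] by blast
    interpret muckenhoupt_pair om sig tau tau' K by (rule pair)
    have w_eq: "AE x in lebesgue. w x = om x powr (1 - q * b)"
      using w_AE_pos by eventually_elim (use b(2) in \<open>simp add: om_def s_def powr_powr\<close>)
    \<comment> \<open>The violated constants grow at the rate that \<open>gliding_hump_arith\<close>
      calls for.\<close>
    define M where "M k = 2 powr (real k * q * ((1 + \<theta>) / p + 1))" for k :: nat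
    have M: "0 < M k" for k by (simp add: M_def)
    obtain f g c where fg: "\<And>k::nat. (f k, g k) \<in> \<F>" and c: "\<And>k. 0 < c k" "\<And>k. Lp_int q w (f k) = ennreal (c k)"
      and gc: "\<And>k. ennreal (M k) * Lp_int q w (g k) \<le> ennreal (c k)"
      using Lp_bound_failure[OF q fail, of M] M by metis
    have fm [measurable]: "f k \<in> borel_measurable lebesgue" and gm [measurable]: "g k \<in> borel_measurable lebesgue" for k
      using meas fg[of k] by auto
    \<comment> \<open>The factor \<open>M k\<close> in front of \<open>g k\<close> is affordable
      because the pair violates the inequality with this constant; in return \<open>h\<close>
      dominates \<open>g k\<close> with a constant better by \<open>M k\<close> than the one for
      \<open>f k\<close>.\<close>
    define h where "h x = (\<Sum>k. ennreal ((1 / 2) ^ k / c k) * (epow (f k x) q + ennreal (M k) * epow (g k x) q))" for x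
    have hm [measurable]: "h \<in> borel_measurable lebesgue" unfolding h_def by measurable
    have hint: "(\<integral>\<^sup>+x. h x * ennreal (om x powr (1 - q * b)) \<partial>lebesgue) < \<infinity>"
    proof -
      have "(\<integral>\<^sup>+x. h x * ennreal (om x powr (1 - q * b)) \<partial>lebesgue) = (\<integral>\<^sup>+x. ennreal (w x) * h x \<partial>lebesgue)"
        by (rule nn_integral_cong_AE, use w_eq in eventually_elim) (simp add: mult.commute)
      also have "\<dots> = (\<integral>\<^sup>+x. h x \<partial>wmeasure w)"
        by (rule nn_integral_density[symmetric]) measurable
      also have "\<dots> < \<infinity>"
        unfolding h_def
        by (rule nn_integral_normalized_sum) (use c gc in \<open>simp_all add: Lp_int_def\<close>)
      finally show ?thesis .
    qed
    have f_le_h: "epow (f k x) q \<le> ennreal (2 powr real k * c k) * h x"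
      and g_le_h: "epow (g k x) q \<le> ennreal (2 powr real k * c k / M k) * h x" for k x
    proof -
      have *: "ennreal ((1 / 2) ^ k / c k) * (epow (f k x) q + ennreal (M k) * epow (g k x) q) \<le> h x"
        unfolding h_def by (rule le_suminf_term)
      have half: "(1 / 2) ^ k / c k = 1 / (2 powr real k * c k)"
        by (simp add: powr_realpow power_one_over)
      have "ennreal (1 / (2 powr real k * c k)) * epow (f k x) q \<le> h x"
        using * unfolding half by (rule order_trans[rotated]) (auto intro: mult_left_mono)
      then show "epow (f k x) q \<le> ennreal (2 powr real k * c k) * h x"
        using c(1)[of k] by (intro le_of_scaled_le) auto
      have "ennreal (1 / (2 powr real k * c k / M k)) * epow (g k x) q
        = ennreal (1 / (2 powr real k * c k)) * (ennreal (M k) * epow (g k x) q)"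
        using c(1)[of k] M[of k] by (simp add: mult.assoc[symmetric] ennreal_mult[symmetric] less_imp_le)
      also have "\<dots> \<le> h x"
        using * unfolding half by (rule order_trans[rotated]) (auto intro: mult_left_mono)
      finally show "epow (g k x) q \<le> ennreal (2 powr real k * c k / M k) * h x"
        using c(1)[of k] M[of k] by (intro le_of_scaled_le) auto
    qed
    \<comment> \<open>The Rubio de Francia algorithm started from zero would yield no positive
      weight.\<close>
    have hnz: "\<not> (AE x in lebesgue. h x = 0)"
    proof
      assume "AE x in lebesgue. h x = 0"
      then have "AE x in lebesgue. ennreal (w x) * epow (f 0 x) q = 0"
      proof eventually_elim
        fix x assume "h x = 0" then show "ennreal (w x) * epow (f 0 x) q = 0" using f_le_h[of 0 x] by simp
      qed
      then have "Lp_int q w (f 0) = 0"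
        unfolding Lp_int_eq_lebesgue[OF wm fm] by (subst nn_integral_0_iff_AE) measurable
      then show False using c(1)[of 0] c(2)[of 0] by simp
    qed
    obtain A u D v where uv: "A1_weight A u" "A1_weight D v"
      and hV: "AE x in lebesgue. h x * ennreal (om x powr (1 - q * b)) \<le> ennreal (v x powr tau * om x)"
      and hU: "AE x in lebesgue. h x * ennreal (om x powr (1 - q * b)) \<le> ennreal (u x powr tau' * om x powr (1 - tau'))"
      and Vint: "(\<integral>\<^sup>+x. ennreal (v x powr tau * om x) \<partial>lebesgue) < \<infinity>"
      and Uint: "(\<integral>\<^sup>+x. ennreal (u x powr tau' * om x powr (1 - tau')) \<partial>lebesgue) < \<infinity>"
      using joint_majorants[OF pair hm hint hnz] by blast
    interpret factored_weight p q a b tau tau' \<theta> m w om u v A D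
      by (intro factored_weight.intro p q b a tau_def tau'_def \<theta>_def m_def uv wm w_measurable w_pos w_eq) 
    obtain S where S: "1 \<le> S" "(\<integral>\<^sup>+x. ennreal (V x) \<partial>lebesgue) \<le> ennreal S" "(\<integral>\<^sup>+x. ennreal (U x) \<partial>lebesgue) \<le> ennreal S"
    proof -
      obtain S1 where S1: "(\<integral>\<^sup>+x. ennreal (V x) \<partial>lebesgue) = ennreal S1"
        using Vint unfolding V_def less_top_ennreal infinity_ennreal_def by auto
      obtain S2 where S2: "(\<integral>\<^sup>+x. ennreal (U x) \<partial>lebesgue) = ennreal S2"
        using Uint unfolding U_def less_top_ennreal infinity_ennreal_def by auto
      show ?thesis
        by (rule that[of "max 1 (max S1 S2)"]) (auto simp: S1 S2 intro!: ennreal_leI)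
    qed
    obtain C where C: "0 < C" "\<And>f g. (f, g) \<in> \<F> \<Longrightarrow> Lp_int p W f < \<infinity> \<Longrightarrow> Lp_int p W f \<le> ennreal C * Lp_int p W g"
      using hyp[OF W_in_class] unfolding Lp_bound_iff[OF p] by blast
    have scaled: "AE x in lebesgue. epow (\<phi> x) q * ennreal (w x) \<le> ennreal E * ennreal (V x)"
      "AE x in lebesgue. epow (\<phi> x) q * ennreal (w x) \<le> ennreal E * ennreal (U x)"
      if "\<And>x. epow (\<phi> x) q \<le> ennreal E * h x" for \<phi> E
    proof -
      have *: "epow (\<phi> x) q * ennreal (w x) \<le> ennreal E * z"
        if z: "h x * ennreal (w x) \<le> z" for x z
      proof -
        have "epow (\<phi> x) q * ennreal (w x) \<le> ennreal E * (h x * ennreal (w x))"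
          unfolding mult.assoc[symmetric] using \<open>\<And>x. epow (\<phi> x) q \<le> ennreal E * h x\<close> by (rule mult_right_mono) simp
        also have "\<dots> \<le> ennreal E * z" using z by (rule mult_left_mono) simp
        finally show ?thesis .
      qed
      show "AE x in lebesgue. epow (\<phi> x) q * ennreal (w x) \<le> ennreal E * ennreal (V x)"
        using hV w_eq unfolding V_def[symmetric] by eventually_elim (rule *, simp)
      show "AE x in lebesgue. epow (\<phi> x) q * ennreal (w x) \<le> ennreal E * ennreal (U x)"
        using hU w_eq unfolding U_def[symmetric] by eventually_elim (rule *, simp)
    qed
    have "2 powr (real k * p) \<le> 2 * C * S powr (1 + \<theta>)" for k
    proof -
      define E where "E = 2 powr real k * c k"
      have E: "0 < E" "0 < E / M k" using c(1)[of k] M[of k] by (auto simp: E_def)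
      have S0: "0 < S" "0 \<le> S" using S(1) by auto
      have f_up: "Lp_int p W (f k) \<le> ennreal (E powr (p / q) * (2 * S))"
        by (rule Lp_int_upper[OF fm E(1) scaled(1) S(2,3) S0(2)]) (use f_le_h in \<open>simp add: E_def\<close>)
      have g_up: "Lp_int p W (g k) \<le> ennreal ((E / M k) powr (p / q) * (2 * S))"
        by (rule Lp_int_upper[OF gm E(2) scaled(1) S(2,3) S0(2)]) (use g_le_h in \<open>simp add: E_def\<close>)
      have f_fin: "Lp_int p W (f k) < \<infinity>" using f_up by (rule order_le_less_trans) simp
      have "Lp_int p W (f k) \<le> ennreal C * Lp_int p W (g k)" by (rule C(2)[OF fg f_fin])
      also have "\<dots> \<le> ennreal C * ennreal ((E / M k) powr (p / q) * (2 * S))"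
        using g_up by (rule mult_left_mono) simp
      also have "\<dots> = ennreal (C * ((E / M k) powr (p / q) * (2 * S)))"
        using C(1) S0 by (intro ennreal_mult[symmetric]) auto
      finally have fC: "Lp_int p W (f k) \<le> ennreal (C * ((E / M k) powr (p / q) * (2 * S)))" .
      \<comment> \<open>This value of \<open>L\<close> makes the error term of the lower bound absorb exactly the factor \<open>\<theta>\<close>.\<close>
      define L where "L = c k / S"
      have L: "0 < L" using c(1)[of k] S0 by (simp add: L_def)
      have "ennreal (E powr - m * (1 + \<theta>) * L powr \<theta>) * Lp_int q w (f k)
        \<le> Lp_int p W (f k) + ennreal (E powr - m * \<theta> * L powr (1 + \<theta>)) * ennreal S"
        by (rule Lp_int_lower[OF fm E(1) L scaled(2) S(2) S0(2)]) (use f_le_h in \<open>simp add: E_def\<close>)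
      also have "\<dots> \<le> ennreal (C * ((E / M k) powr (p / q) * (2 * S))) + ennreal (E powr - m * \<theta> * L powr (1 + \<theta>)) * ennreal S"
        using fC by (rule add_right_mono)
      also have "\<dots> = ennreal (C * ((E / M k) powr (p / q) * (2 * S)) + E powr - m * \<theta> * L powr (1 + \<theta>) * S)"
        using C(1) S0 exps by (simp add: ennreal_mult)
      finally have "ennreal (E powr - m * (1 + \<theta>) * L powr \<theta> * c k)
        \<le> ennreal (C * ((E / M k) powr (p / q) * (2 * S)) + E powr - m * \<theta> * L powr (1 + \<theta>) * S)"
        using c exps by (simp add: ennreal_mult less_imp_le)
      then have "E powr - m * (1 + \<theta>) * L powr \<theta> * c k
        \<le> C * ((E / M k) powr (p / q) * (2 * S)) + E powr - m * \<theta> * L powr (1 + \<theta>) * S"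
        using C(1) S0 exps by (subst (asm) ennreal_le_iff) auto
      moreover have "E powr - m * \<theta> * L powr (1 + \<theta>) * S = E powr - m * \<theta> * L powr \<theta> * c k"
        using L S0 by (simp add: powr_add) (simp add: L_def)
      moreover have "E powr - m * (1 + \<theta>) * L powr \<theta> * c k
        = E powr - m * L powr \<theta> * c k + E powr - m * \<theta> * L powr \<theta> * c k"
        by (simp add: algebra_simps)
      ultimately have "E powr - m * L powr \<theta> * c k \<le> C * ((E / M k) powr (p / q) * (2 * S))"
        by linarith
      then show ?thesis
        unfolding L_def by (rule gliding_hump_arith[OF p q c(1) S(1) C(1) exps(1) E_def M_def])
    qed
    moreover obtain k :: nat where "log 2 (2 * C * S powr (1 + \<theta>)) < real k * p"
      using p reals_Archimedean3 by blast
    then have "2 * C * S powr (1 + \<theta>) < 2 powr (real k * p)"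
      using C(1) S(1) by (subst (asm) log_less_iff) auto
    ultimately show False by (meson not_le)
  qed
qed

section \<open>Vector-valued families\<close>

lemma infsum_ennreal_eq_suminf:
  fixes f :: "nat \<Rightarrow> ennreal"
  shows "(\<Sum>\<^sub>\<infinity>j\<in>J. f j) = (\<Sum>j. if j \<in> J then f j else 0)"
proof -
  have "(\<Sum>\<^sub>\<infinity>j\<in>J. f j) = (\<Sum>\<^sub>\<infinity>j\<in>UNIV. if j \<in> J then f j else 0)"
    by (rule infsum_cong_neutral) auto
  moreover have "(\<lambda>j. if j \<in> J then f j else 0) summable_on UNIV"
    by (rule nonneg_summable_on_complete) simp
  ultimately show ?thesis
    by (metis has_sum_imp_sums has_sum_infsum sums_unique)
qed

lemma epow_lr_sum:
  assumes "0 < r"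
  shows "epow (lr_sum r J f x) r = (\<Sum>j. if j \<in> J then epow (f j x) r else 0)"
  using assms by (simp add: lr_sum_def epow_epow infsum_ennreal_eq_suminf)

text \<open>Nothing is assumed about \<open>f j\<close> outside \<open>J\<close>, where the summand
  is zero.\<close>

lemma measurable_if_mem:
  assumes "\<And>j. j \<in> J \<Longrightarrow> f j \<in> borel_measurable lebesgue"
  shows "(\<lambda>x. if j \<in> J then epow (f j x) r else 0) \<in> borel_measurable lebesgue"
  using assms by (cases "j \<in> J") auto

lemma borel_measurable_lr_sum:
  assumes "\<And>j. j \<in> J \<Longrightarrow> f j \<in> borel_measurable lebesgue"
  shows "lr_sum r J f \<in> borel_measurable lebesgue"
proof -
  note [measurable] = measurable_if_mem[OF assms]
  have "lr_sum r J f = (\<lambda>x. epow (\<Sum>j. if j \<in> J then epow (f j x) r else 0) (1 / r))"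
    by (simp add: lr_sum_def infsum_ennreal_eq_suminf fun_eq_iff)
  moreover have "(\<lambda>x. epow (\<Sum>j. if j \<in> J then epow (f j x) r else 0) (1 / r)) \<in> borel_measurable lebesgue"
    by measurable
  ultimately show ?thesis by simp
qed

text \<open>At the exponent \<open>r\<close> itself the outer root cancels, and sum and integral can
  be interchanged.\<close>

lemma Lp_int_lr_sum:
  fixes f :: "nat \<Rightarrow> real ^ 'n \<Rightarrow> ennreal"
  assumes r: "0 < r" and f: "\<And>j. j \<in> J \<Longrightarrow> f j \<in> borel_measurable lebesgue"
  shows "Lp_int r w (lr_sum r J f) = (\<Sum>j. if j \<in> J then Lp_int r w (f j) else 0)"
proof -
  have "Lp_int r w (lr_sum r J f) = (\<integral>\<^sup>+x. (\<Sum>j. if j \<in> J then epow (f j x) r else 0) \<partial>wmeasure w)"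
    by (simp add: Lp_int_def epow_lr_sum[OF r])
  also have "\<dots> = (\<Sum>j. \<integral>\<^sup>+x. (if j \<in> J then epow (f j x) r else 0) \<partial>wmeasure w)"
    by (intro nn_integral_suminf) (simp only: measurable_density_eq1, intro measurable_if_mem f)
  also have "\<dots> = (\<Sum>j. if j \<in> J then Lp_int r w (f j) else 0)"
    by (rule suminf_cong) (simp add: Lp_int_def)
  finally show ?thesis .
qed

text \<open>Finiteness of the left-hand side for the sum passes to each term. The scalar bound thus
  applies to every pair with the same constant and can be summed.\<close>

lemma Lp_bound_lr_sum:
  fixes \<F> :: "((real ^ 'n \<Rightarrow> ennreal) \<times> (real ^ 'n \<Rightarrow> ennreal)) set"
  assumes r: "0 < r" and bound: "Lp_bound r w \<F>"
    and meas: "\<forall>(f, g)\<in>\<F>. f \<in> borel_measurable lebesgue \<and> g \<in> borel_measurable lebesgue"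
  shows "Lp_bound r w {(lr_sum r J f, lr_sum r J g) | J f g. \<forall>j\<in>J. (f j, g j) \<in> \<F>}"
proof -
  obtain C where C: "0 < C" "\<And>f g. (f, g) \<in> \<F> \<Longrightarrow> Lp_int r w f < \<infinity> \<Longrightarrow> Lp_int r w f \<le> ennreal C * Lp_int r w g"
    using bound unfolding Lp_bound_iff[OF r] by blast
  have "Lp_int r w (lr_sum r J f) \<le> ennreal C * Lp_int r w (lr_sum r J g)"
    if fg: "\<forall>j\<in>J. (f j, g j) \<in> \<F>" and fin: "Lp_int r w (lr_sum r J f) < \<infinity>" for J f g
  proof -
    have m: "\<And>j. j \<in> J \<Longrightarrow> f j \<in> borel_measurable lebesgue" "\<And>j. j \<in> J \<Longrightarrow> g j \<in> borel_measurable lebesgue"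
      using meas fg by auto
    have fs: "Lp_int r w (lr_sum r J f) = (\<Sum>j. if j \<in> J then Lp_int r w (f j) else 0)"
      by (rule Lp_int_lr_sum[OF r m(1)])
    have gs: "Lp_int r w (lr_sum r J g) = (\<Sum>j. if j \<in> J then Lp_int r w (g j) else 0)"
      by (rule Lp_int_lr_sum[OF r m(2)])
    have "Lp_int r w (f j) \<le> ennreal C * Lp_int r w (g j)" if j: "j \<in> J" for j
    proof -
      have "Lp_int r w (f j) \<le> Lp_int r w (lr_sum r J f)"
        using le_suminf_term[of "\<lambda>j. if j \<in> J then Lp_int r w (f j) else 0" j] j unfolding fs by simp
      then have "Lp_int r w (f j) < \<infinity>" using fin by (rule order_le_less_trans)
      then show ?thesis using C(2) fg j by blast
    qed
    then have "(\<Sum>j. if j \<in> J then Lp_int r w (f j) else 0)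
      \<le> (\<Sum>j. ennreal C * (if j \<in> J then Lp_int r w (g j) else 0))"
      by (intro suminf_le) auto
    then show ?thesis unfolding fs gs by simp
  qed
  then show ?thesis
    unfolding Lp_bound_iff[OF r] using C(1) by (intro exI[of _ C]) auto
qed

section \<open>Translation of the exponents and conclusion\<close>

definition inverse_real :: "ennreal \<Rightarrow> real" where
  "inverse_real q0 = enn2real (inverse q0)"

lemma inverse_real_bounds:
  assumes "0 < p" "ennreal p \<le> q0"
  shows "0 \<le> inverse_real q0" "p * inverse_real q0 \<le> 1" "ennreal p < q0 \<Longrightarrow> p * inverse_real q0 < 1"
    and "p0 < p \<Longrightarrow> p0 > 0 \<Longrightarrow> inverse_real q0 < 1 / p0"
proof -
  show "0 \<le> inverse_real q0" by (simp add: inverse_real_def)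
  consider "q0 = top" | Q where "q0 = ennreal Q" "p \<le> Q"
    using assms by (cases q0) auto
  note cases = this
  show "p * inverse_real q0 \<le> 1"
    by (cases rule: cases) (use assms in \<open>auto simp: inverse_real_def inverse_ennreal field_simps\<close>)
  show "p * inverse_real q0 < 1" if "ennreal p < q0"
    by (cases rule: cases) (use assms that in \<open>auto simp: inverse_real_def inverse_ennreal field_simps ennreal_less_iff\<close>)
  show "inverse_real q0 < 1 / p0" if "p0 < p" "p0 > 0"
    by (cases rule: cases) (use assms that in \<open>auto simp: inverse_real_def inverse_ennreal field_simps\<close>)
qed

text \<open>The conjugate of \<open>q0 / p\<close> is the reciprocal of \<open>1 - p / q0\<close>.
  The denominator vanishes at the endpoint \<open>p = q0\<close>; for
  \<open>q0 = \<infinity>\<close> it is 1, and so is the exponent.\<close>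

lemma conj_exponent_eq:
  assumes "0 < p" "ennreal p \<le> q0"
  shows "conj_exponent (q0 / ennreal p)
    = (if 1 - p * inverse_real q0 = 0 then \<infinity> else ennreal (1 / (1 - p * inverse_real q0)))"
proof (cases q0)
  case top
  then show ?thesis using assms by (simp add: conj_exponent_def inverse_real_def ennreal_top_divide)
next
  case (real Q)
  then have Q: "0 < p" "p \<le> Q" using assms by auto
  have "inverse (q0 / ennreal p) = ennreal (p / Q)"
    using Q real by (simp add: divide_ennreal inverse_ennreal)
  then have "1 - inverse (q0 / ennreal p) = ennreal (1 - p / Q)"
    using Q by (simp add: ennreal_minus flip: ennreal_1)
  moreover have "inverse_real q0 = 1 / Q" using Q real by (simp add: inverse_real_def inverse_ennreal divide_inverse)
  moreover have "p = Q \<or> 0 < 1 - p / Q" using Q by (auto simp: field_simps)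
  ultimately show ?thesis
    using Q by (auto simp: conj_exponent_def inverse_ennreal inverse_eq_divide)
qed

text \<open>The definition of the class with exponent 1 contains no inequality, but there the
  inequality holds trivially with constant 1, so that this exponent joins the general case.\<close>

lemma RH_class_inequality:
  assumes w: "w \<in> RH_class (ennreal s)" and s: "1 \<le> s"
  shows "\<exists>C::real. \<forall>c r. 0 < r \<longrightarrow> epow (average (ball c r) (\<lambda>y. epow (ennreal (w y)) s)) (1 / s)
    \<le> ennreal C * average (ball c r) (\<lambda>y. ennreal (w y))"
proof (cases "s = 1")
  case True
  then show ?thesis by (intro exI[of _ 1]) simp
next
  case False
  then have "ennreal s \<noteq> 1" "enn2real (ennreal s) = s" using s by (simp_all add: ennreal_eq_1)
  then show ?thesis using w unfolding RH_class_def by auto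
qed

lemma scalar_extrapolation:
  fixes p0 :: real and q0 :: ennreal
    and \<F> :: "((real ^ 'n \<Rightarrow> ennreal) \<times> (real ^ 'n \<Rightarrow> ennreal)) set"
  assumes p0: "0 < p0"
    and meas: "\<forall>(f, g)\<in>\<F>. f \<in> borel_measurable lebesgue \<and> g \<in> borel_measurable lebesgue"
    and p: "p0 \<le> p" "ennreal p \<le> q0"
      "\<forall>w \<in> A_class (p / p0) \<inter> RH_class (conj_exponent (q0 / ennreal p)). Lp_bound p w \<F>"
    and q: "p0 < q" "ennreal q < q0"
    and w: "w \<in> A_class (q / p0) \<inter> RH_class (conj_exponent (q0 / ennreal q))"
  shows "Lp_bound q w \<F>"
proof -
  define b where "b = inverse_real q0"
  define a where "a = 1 / p0"
  have pq: "0 < p" "0 < q" "ennreal q \<le> q0" using p0 p q by auto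
  have b: "0 \<le> b" "q * b < 1" "p * b \<le> 1"
    unfolding b_def using inverse_real_bounds[OF pq(1) p(2)] inverse_real_bounds[OF pq(2,3)] q(2) by auto
  have a: "1 < q * a" "1 \<le> p * a" "q / p0 = q * a" "p / p0 = p * a"
    unfolding a_def using p0 p q by (auto simp: field_simps)
  have conj: "conj_exponent (q0 / ennreal q) = ennreal (1 / (1 - q * b))"
    using conj_exponent_eq[OF pq(2,3)] b(2) by (simp add: b_def)
  have s: "1 \<le> 1 / (1 - q * b)" using b pq by simp
  show ?thesis
  proof (rule limited_range_extrapolation[OF meas pq(1,2) b a(1,2)])
    show "Lp_bound p W \<F>" if "W \<in> A_class (p * a)"
      "W \<in> RH_class (if 1 - p * b = 0 then \<infinity> else ennreal (1 / (1 - p * b)))" for W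
      using that p(3) unfolding conj_exponent_eq[OF pq(1) p(2)] b_def a(4) by blast
    show "w \<in> A_class (q * a)" using w a(3) by simp
    show "\<exists>C::real. \<forall>c r. 0 < r \<longrightarrow>
      epow (average (ball c r) (\<lambda>y. epow (ennreal (w y)) (1 / (1 - q * b)))) (1 / (1 / (1 - q * b)))
        \<le> ennreal C * average (ball c r) (\<lambda>y. ennreal (w y))"
      using w unfolding conj by (intro RH_class_inequality s) simp
  qed
qed

theorem theorem4p9:
  fixes p0 :: real and q0 :: ennreal
    and \<F> :: "((real ^ 'n \<Rightarrow> ennreal) \<times> (real ^ 'n \<Rightarrow> ennreal)) set"
  assumes "0 < p0" and "ennreal p0 < q0"
    and "\<forall>(f, g)\<in>\<F>. f \<in> borel_measurable lebesgue \<and> g \<in> borel_measurable lebesgue"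
    and "\<exists>p::real. p0 \<le> p \<and> ennreal p \<le> q0 \<and>
           (\<forall>w \<in> A_class (p / p0) \<inter> RH_class (conj_exponent (q0 / ennreal p)). Lp_bound p w \<F>)"
  shows "(\<forall>q::real. p0 < q \<and> ennreal q < q0 \<longrightarrow>
            (\<forall>w \<in> A_class (q / p0) \<inter> RH_class (conj_exponent (q0 / ennreal q)). Lp_bound q w \<F>))
       \<and> (\<forall>q r :: real. p0 < q \<and> ennreal q < q0 \<and> p0 < r \<and> ennreal r < q0 \<longrightarrow>
            (\<forall>w \<in> A_class (q / p0) \<inter> RH_class (conj_exponent (q0 / ennreal q)).
               Lp_bound q w {(lr_sum r J f, lr_sum r J g) | J f g. \<forall>j\<in>J. (f j, g j) \<in> \<F>}))"
proof -
  obtain p where p: "p0 \<le> p" "ennreal p \<le> q0"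
    "\<forall>w \<in> A_class (p / p0) \<inter> RH_class (conj_exponent (q0 / ennreal p)). Lp_bound p w \<F>"
    using assms(4) by blast
  note scalar = scalar_extrapolation[OF assms(1,3) p]
  have "Lp_bound q w {(lr_sum r J f, lr_sum r J g) | J f g. \<forall>j\<in>J. (f j, g j) \<in> \<F>}" (is "Lp_bound q w ?G")
    if q: "p0 < q" "ennreal q < q0" and r: "p0 < r" "ennreal r < q0"
      and w: "w \<in> A_class (q / p0) \<inter> RH_class (conj_exponent (q0 / ennreal q))" for q r w
  \<comment> \<open>The exponent \<open>r\<close> takes the place of \<open>p\<close>: at
    \<open>r\<close> the family of sums inherits the scalar bound for every admissible
    weight.\<close>
  proof (rule scalar_extrapolation[OF assms(1) _ _ _ _ q w])
    have r0: "0 < r" using r(1) assms(1) by simp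
    show "\<forall>(F, G)\<in>?G. F \<in> borel_measurable lebesgue \<and> G \<in> borel_measurable lebesgue"
      using assms(3) by (auto intro!: borel_measurable_lr_sum)
    show "p0 \<le> r" "ennreal r \<le> q0" using r by auto
    show "\<forall>w \<in> A_class (r / p0) \<inter> RH_class (conj_exponent (q0 / ennreal r)). Lp_bound r w ?G"
      using Lp_bound_lr_sum[OF r0 scalar[OF r] assms(3)] by blast
  qed
  with scalar show ?thesis by blast
qed

end
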